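(* Let $\gamma=[0;1,1,c_3,1,c_5,1,c_7,1,\dots]$, i.e. $\gamma$ has infinite continued fraction expansion $[c_0;c_1,c_2,\dots]$ with $c_0=0$, $c_n=1$ for $n$ even $\ge2$ and for $n=1$, and $c_{2n+1}\in\{1,2\}$ for all $n\in\mathbb{N}$; let $p_n/q_n$ be its convergents. Let $d\ge2$, $a>0$, and consider the $d$-dimensional hyperrectangular lattice graph with edge lengths $a_1=\gamma a$ and $a_j=a$ for $j=2,\dots,d$, with Hamiltonian $H$ having $\delta$ couplings of strength $\alpha\in\left[\frac{4\pi(2-\sqrt{3})}{a},\frac{2\pi^2}{5a}\right]$ at all vertices. Then $k^2$ is the lower endpoint of a spectral gap of $H$ if and only if $k^2=\left(\frac{q_{2n}\pi}{a}\right)^2$ for some $n$ with $c_{2n+1}=2$.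
   Context: $[c_0;c_1,c_2,\dots]$ denotes the continued fraction $c_0+\cfrac{1}{c_1+\cfrac{1}{c_2+\cdots}}$; the $n$-th convergent is $p_n/q_n=[c_0;c_1,\dots,c_n]$ in lowest terms with $q_n>0$. The lattice graph $\Gamma$ has vertex set $\{(n_1a_1,\dots,n_da_d): n_i\in\mathbb{Z}\}\subset\mathbb{R}^d$, with an edge (segment of length $a_j$) between two vertices iff they differ by $a_je_j$ for some $j$. $H$ is the self-adjoint operator on $L^2(\Gamma)$ acting as $\psi\mapsto-\psi''$ on each edge, with domain consisting of functions $H^2$ on each edge satisfying at every vertex $v$: $\psi$ is continuous at $v$, and the sum over the $2d$ incident edges of the derivatives at $v$ taken in the direction away from $v$ equals $\alpha\psi(v)$. A spectral gap is an open interval $(E_1,E_2)$ with $E_1<E_2$, $E_1,E_2\in\sigma(H)$ and $(E_1,E_2)\cap\sigma(H)=\emptyset$. *)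

theory Defs
  imports "HOL-Analysis.Analysis"
begin

fun cfr :: "(nat \<Rightarrow> nat) \<Rightarrow> nat \<Rightarrow> nat \<Rightarrow> rat" where
  "cfr c m 0 = of_nat (c m)"
| "cfr c m (Suc k) = of_nat (c m) + 1 / cfr c (Suc m) k"

definition conv_p :: "(nat \<Rightarrow> nat) \<Rightarrow> nat \<Rightarrow> int" where
  "conv_p c n = fst (quotient_of (cfr c 0 n))"

definition conv_q :: "(nat \<Rightarrow> nat) \<Rightarrow> nat \<Rightarrow> int" where
  "conv_q c n = snd (quotient_of (cfr c 0 n))"

definition has_cf_expansion :: "real \<Rightarrow> (nat \<Rightarrow> nat) \<Rightarrow> bool" where
  "has_cf_expansion \<gamma> c \<longleftrightarrow> (\<forall>n\<ge>1. c n \<ge> 1) \<and> (\<lambda>n. real_of_rat (cfr c 0 n)) \<longlonglongrightarrow> \<gamma>"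

text \<open>Vertices: integer vectors (n_1,...,n_d), encoded as functions nat => int vanishing from index d on
  (index j here corresponds to coordinate j+1 of the paper). The vertex with index n sits at
  (n_1 a_1, ..., n_d a_d). Edges: pairs (v,j), j < d, the segment from v to v + e_j, of length aa j,
  parametrised by t in [0, aa j] starting at v.\<close>
definition lat_vertices :: "nat \<Rightarrow> (nat \<Rightarrow> int) set" where
  "lat_vertices d = {v. \<forall>i\<ge>d. v i = 0}"

definition lat_edges :: "nat \<Rightarrow> ((nat \<Rightarrow> int) \<times> nat) set" where
  "lat_edges d = {(v, j). v \<in> lat_vertices d \<and> j < d}"

type_synonym gfun = "(nat \<Rightarrow> int) \<Rightarrow> nat \<Rightarrow> real \<Rightarrow> complex"

definition gnorm2 :: "nat \<Rightarrow> (nat \<Rightarrow> real) \<Rightarrow> gfun \<Rightarrow> ennreal" where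
  "gnorm2 d aa \<psi> =
     (\<integral>\<^sup>+ e. (\<integral>\<^sup>+ t\<in>{0..aa (snd e)}. ennreal ((cmod (\<psi> (fst e) (snd e) t))\<^sup>2) \<partial>lebesgue)
        \<partial>count_space (lat_edges d))"

definition in_L2 :: "nat \<Rightarrow> (nat \<Rightarrow> real) \<Rightarrow> gfun \<Rightarrow> bool" where
  "in_L2 d aa \<psi> \<longleftrightarrow>
     (\<forall>(v, j)\<in>lat_edges d. set_borel_measurable lebesgue {0..aa j} (\<psi> v j)) \<and> gnorm2 d aa \<psi> < \<infinity>"

definition L2_eq :: "nat \<Rightarrow> (nat \<Rightarrow> real) \<Rightarrow> gfun \<Rightarrow> gfun \<Rightarrow> bool" where
  "L2_eq d aa \<phi> \<psi> \<longleftrightarrow>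
     (\<forall>(v, j)\<in>lat_edges d. AE t in lebesgue. t \<in> {0..aa j} \<longrightarrow> \<phi> v j t = \<psi> v j t)"

text \<open>H^2 on an edge [0,L]: f is differentiable on [0,L] with continuous derivative g, and
  g is absolutely continuous with derivative h (i.e. g t = g 0 + integral of h), h being
  (square integrable, required globally below) the second derivative f''.\<close>
definition H2_data :: "real \<Rightarrow> (real \<Rightarrow> complex) \<Rightarrow> (real \<Rightarrow> complex) \<Rightarrow> (real \<Rightarrow> complex) \<Rightarrow> bool" where
  "H2_data L f g h \<longleftrightarrow>
     continuous_on {0..L} g \<and>
     (\<forall>t\<in>{0..L}. (f has_vector_derivative g t) (at t within {0..L})) \<and>
     h integrable_on {0..L} \<and>
     (\<forall>t\<in>{0..L}. g t = g 0 + integral {0..t} h)"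

text \<open>hdom d aa \<alpha> \<psi> u: \<psi> is in the domain of H (delta coupling of strength \<alpha> at every vertex),
  and u is its edgewise second derivative, so that H \<psi> = - u.\<close>
definition hdom :: "nat \<Rightarrow> (nat \<Rightarrow> real) \<Rightarrow> real \<Rightarrow> gfun \<Rightarrow> gfun \<Rightarrow> bool" where
  "hdom d aa \<alpha> \<psi> u \<longleftrightarrow>
     in_L2 d aa \<psi> \<and> in_L2 d aa u \<and>
     (\<exists>D :: gfun.
        (\<forall>(v, j)\<in>lat_edges d. H2_data (aa j) (\<psi> v j) (D v j) (u v j)) \<and>
        (\<forall>v\<in>lat_vertices d. \<exists>c::complex.
            (\<forall>j<d. \<psi> v j 0 = c \<and> \<psi> (v(j := v j - 1)) j (aa j) = c) \<and>
            (\<Sum>j<d. D v j 0 - D (v(j := v j - 1)) j (aa j)) = complex_of_real \<alpha> * c))"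

definition resolvent_pt :: "nat \<Rightarrow> (nat \<Rightarrow> real) \<Rightarrow> real \<Rightarrow> complex \<Rightarrow> bool" where
  "resolvent_pt d aa \<alpha> E \<longleftrightarrow>
     (\<forall>f. in_L2 d aa f \<longrightarrow>
        (\<exists>\<psi> u. hdom d aa \<alpha> \<psi> u \<and> L2_eq d aa (\<lambda>v j t. - u v j t - E * \<psi> v j t) f)) \<and>
     (\<exists>C::real. \<forall>\<psi> u. hdom d aa \<alpha> \<psi> u \<longrightarrow>
        gnorm2 d aa \<psi> \<le> ennreal C * gnorm2 d aa (\<lambda>v j t. - u v j t - E * \<psi> v j t))"

definition spectrum_H :: "nat \<Rightarrow> (nat \<Rightarrow> real) \<Rightarrow> real \<Rightarrow> complex set" where
  "spectrum_H d aa \<alpha> = {E. \<not> resolvent_pt d aa \<alpha> E}"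

definition spectral_gap :: "complex set \<Rightarrow> real \<Rightarrow> real \<Rightarrow> bool" where
  "spectral_gap S E1 E2 \<longleftrightarrow> E1 < E2 \<and> complex_of_real E1 \<in> S \<and> complex_of_real E2 \<in> S \<and>
     (\<forall>E\<in>{E1<..<E2}. complex_of_real E \<notin> S)"

end

theory Submission
  imports Defs
begin

text \<open>In terms of its vertex values, the equation \<open>H \<psi> = k\<^sup>2 \<psi> + f\<close> becomes a difference equation on the
  lattice with hopping coefficients \<open>1 / sin (k a\<^sub>j)\<close>. If the diagonal coefficient dominates, this is solved
  in \<open>l\<^sup>2\<close> by iteration; otherwise there is a bounded Bloch solution, and cutting it off exponentially shows that
  the resolvent is unbounded. So \<open>k\<^sup>2\<close> lies in the spectrum iff some \<open>k a\<^sub>j\<close> is a multiple of \<open>\<pi>\<close> or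
  \<open>\<alpha> / (2 k)\<close> is at most the sum of the \<open>tan (\<pi> / 2 * frac (k a\<^sub>j / \<pi>))\<close>. Between multiples of \<open>\<pi>\<close> this sum
  increases while \<open>\<alpha> / (2 k)\<close> decreases, so the gaps open exactly at those \<open>k\<close> with some \<open>k a\<^sub>j\<close> a multiple of \<open>\<pi>\<close>
  for which the sum is less than \<open>\<alpha> / (2 k)\<close>.

  For \<open>k = m \<pi> / a\<close> the condition reads \<open>m tan (\<pi> / 2 * frac (m \<gamma>)) < A\<close> with
  \<open>2 (2 - sqrt 3) \<le> A = \<alpha> a / (2 \<pi>) \<le> \<pi> / 5\<close>. It forces \<open>m * frac (m \<gamma>) < 2 / 5\<close>, so by Legendre's criterion
  \<open>m\<close> comes from a convergent below \<open>\<gamma>\<close>. Writing \<open>D\<^sub>n\<close> for the distance from \<open>q\<^sub>n \<gamma>\<close> to \<open>p\<^sub>n\<close>, the number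
  \<open>1 / (q\<^sub>n D\<^sub>n) = q\<^sub>n\<^sub>+\<^sub>1 / q\<^sub>n + D\<^sub>n\<^sub>+\<^sub>1 / D\<^sub>n\<close> for even \<open>n\<close> is at most \<open>5 / 2\<close> if \<open>c\<^sub>n\<^sub>+\<^sub>1 = 1\<close> and greater than \<open>3\<close>
  if \<open>c\<^sub>n\<^sub>+\<^sub>1 = 2\<close>; in the latter case \<open>q\<^sub>n \<ge> 2\<close> and \<open>2 tan (\<pi> / 12) = 2 (2 - sqrt 3)\<close> give the converse. For
  \<open>k = m \<pi> / (\<gamma> a)\<close> the analogous condition is too strong for the convergents above \<open>\<gamma>\<close>.\<close>

section \<open>Continued fractions\<close>

text \<open>A point is spectral if solvability or the norm bound fails, so each is proved or refuted
  directly. Where no \<open>sin (k a_j)\<close> vanishes, end values and inhomogeneity determine an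
  edge function, and eliminating slopes compares the diagonal
  \<open>\<alpha> + 2 k * sum of cot (k a_j)\<close> with the hopping total
  \<open>2 k * sum of 1 / |sin (k a_j)|\<close>. As \<alpha> is positive, only the upper side of
  this comparison can fail, and the half-angle formula turns \<open>1 / |sin x| - cot x\<close> into
  the tangent. Where a sine vanishes, elimination breaks down, but a Bloch solution that is 0 at all
  vertices takes over. At multiples of \<pi> the fractional part equals its limit from the right.
  The tangent sum at such a point therefore decides about the energies just above it. At
  \<open>k = m \<pi> / a\<close> the d - 1 equal directions contribute 0, so the condition does not
  see d; at \<open>k = m \<pi> / (\<gamma> a)\<close> they enter with weight d - 1, which is at
  least 1. The interval for A fits the bounds 5/2 and 3: \<open>\<pi> / 5\<close> is
  \<open>(\<pi> / 2) / (5 / 2)\<close>, and \<open>\<pi> / 12\<close> is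
  \<open>(\<pi> / 2) / (3 * 2)\<close> with 2 the lower bound for the denominators
  concerned.\<close>

fun cf_num :: "(nat \<Rightarrow> nat) \<Rightarrow> nat \<Rightarrow> int" where
  "cf_num c 0 = int (c 0)"
| "cf_num c (Suc 0) = int (c 0) * int (c 1) + 1"
| "cf_num c (Suc (Suc n)) = int (c (n + 2)) * cf_num c (Suc n) + cf_num c n"

fun cf_den :: "(nat \<Rightarrow> nat) \<Rightarrow> nat \<Rightarrow> int" where
  "cf_den c 0 = 1"
| "cf_den c (Suc 0) = int (c 1)"
| "cf_den c (Suc (Suc n)) = int (c (n + 2)) * cf_den c (Suc n) + cf_den c n"

text \<open>\<open>cfr\<close> peels partial quotients off at the front, while \<open>cf_num\<close>
  and \<open>cf_den\<close> recur at the back. This shift identity and the next one translate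
  between the two, which is what the induction in \<open>cfr_eq_quotient\<close> needs.\<close>

lemma cf_den_Suc: "cf_den c (Suc n) = cf_num (c \<circ> Suc) n"
  by (induction n rule: induct_nat_012) auto

lemma cf_num_Suc: "cf_num c (Suc n) = int (c 0) * cf_den c (Suc n) + cf_den (c \<circ> Suc) n"
proof (induction n rule: induct_nat_012)
  case (ge2 n)
  show ?case unfolding cf_num.simps(3)[of c "Suc n"] ge2 by (simp add: algebra_simps comp_def)
qed (auto simp: algebra_simps)

lemma cf_den_pos:
  assumes "\<And>n. n \<ge> 1 \<Longrightarrow> c n \<ge> 1"
  shows "cf_den c n > 0"
proof (induction n rule: induct_nat_012)
  case 1 show ?case using assms[of 1] by simp
next
  case (ge2 n) then show ?case by (simp add: add_nonneg_pos)
qed simp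

lemma cfr_Suc_shift: "cfr c (Suc m) k = cfr (c \<circ> Suc) m k"
  by (induction k arbitrary: m) auto

lemma cfr_eq_quotient:
  assumes "\<And>n. n \<ge> 1 \<Longrightarrow> c n \<ge> 1"
  shows "cfr c 0 n = of_int (cf_num c n) / of_int (cf_den c n)"
  using assms
proof (induction n arbitrary: c)
  case (Suc n)
  have "cfr (c \<circ> Suc) 0 n = of_int (cf_num (c \<circ> Suc) n) / of_int (cf_den (c \<circ> Suc) n)"
    using Suc.prems by (intro Suc.IH) auto
  moreover have "cf_den c (Suc n) > 0" using Suc.prems by (rule cf_den_pos)
  moreover have "cf_den (c \<circ> Suc) n > 0" using Suc.prems by (intro cf_den_pos) auto
  moreover have "cfr c 0 (Suc n) = of_nat (c 0) + 1 / (of_int (cf_den c (Suc n)) / of_int (cf_den (c \<circ> Suc) n))"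
    using calculation(1) by (simp add: cfr_Suc_shift cf_den_Suc)
  ultimately show ?case
    by (simp add: cf_num_Suc field_simps del: cfr.simps)
qed simp

lemma cf_det: "cf_num c (Suc n) * cf_den c n - cf_num c n * cf_den c (Suc n) = (-1) ^ n"
  by (induction n) (auto simp: algebra_simps)

text \<open>A common divisor divides the determinant, which is a unit. Coprimality ensures that
  \<open>quotient_of\<close> returns exactly these two integers.\<close>

lemma cf_coprime: "coprime (cf_num c n) (cf_den c n)"
proof (rule coprimeI)
  fix x assume "x dvd cf_num c n" "x dvd cf_den c n"
  then have "x dvd (-1) ^ n" unfolding cf_det[of c n, symmetric] by (intro dvd_diff) auto
  then show "is_unit x" by (cases "even n") auto
qed

lemma conv_q_eq:
  assumes "\<And>n. n \<ge> 1 \<Longrightarrow> c n \<ge> 1"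
  shows "conv_q c n = cf_den c n"
proof -
  have "cfr c 0 n = Fract (cf_num c n) (cf_den c n)"
    using cfr_eq_quotient[OF assms] by (simp add: Fract_of_int_quotient)
  then show ?thesis unfolding conv_q_def
    by (simp add: quotient_of_Fract normalize_stable cf_den_pos[OF assms] cf_coprime)
qed

section \<open>Approximation of \<gamma> by its convergents\<close>

locale cf_expansion =
  fixes c :: "nat \<Rightarrow> nat" and \<gamma> :: real
  assumes cf: "has_cf_expansion \<gamma> c"
begin

lemma c_ge_1: "n \<ge> 1 \<Longrightarrow> c n \<ge> 1"
  using cf by (simp add: has_cf_expansion_def)

abbreviation "P \<equiv> cf_num c"
abbreviation "Q \<equiv> cf_den c"

definition D :: "nat \<Rightarrow> real" where "D n = (-1) ^ n * (Q n * \<gamma> - P n)"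

lemma Q_pos: "Q n > 0" by (rule cf_den_pos) (rule c_ge_1)

lemma Q_mono: "Q n \<le> Q (Suc n)"
proof (cases n)
  case 0 then show ?thesis using c_ge_1[of 1] by simp
next
  case (Suc k)
  have "1 * Q (Suc k) \<le> int (c (k + 2)) * Q (Suc k)"
    using c_ge_1[of "k + 2"] Q_pos[of "Suc k"] by (intro mult_right_mono) auto
  then show ?thesis using Q_pos[of k] Suc by simp
qed

lemma Q_ge: "int n \<le> Q (Suc n)"
proof (induction n)
  case 0 then show ?case using Q_pos[of "Suc 0"] by simp
next
  case (Suc k)
  have "1 * Q (Suc k) \<le> int (c (k + 2)) * Q (Suc k)"
    using c_ge_1[of "k + 2"] Q_pos[of "Suc k"] by (intro mult_right_mono) auto
  then show ?case using Q_pos[of k] Suc by simp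
qed

lemma det_real: "real_of_int (P (Suc n)) * Q n - real_of_int (P n) * Q (Suc n) = (-1) ^ n"
proof -
  have "real_of_int (P (Suc n) * Q n - P n * Q (Suc n)) = real_of_int ((-1) ^ n)"
    by (simp only: cf_det)
  then show ?thesis by simp
qed

text \<open>Convergents of equal parity, multiplied by \<open>(-1) ^ n\<close>, increase strictly by
  the determinant identity, and their limit is \<gamma> with the same sign. So even convergents lie
  below \<gamma> and odd ones above.\<close>

lemma D_pos: "D n > 0"
proof -
  define x where "x k = (-1) ^ n * (real_of_int (P (n + 2 * k)) / Q (n + 2 * k))" for k
  have step: "x k < x (Suc k)" for k
  proof -
    define m where "m = n + 2 * k"
    have q: "real_of_int (Q m) > 0" "real_of_int (Q (Suc m)) > 0" "real_of_int (Q (Suc (Suc m))) > 0"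
      by (simp_all only: of_int_0_less_iff Q_pos)
    have "real_of_int (P (Suc (Suc m))) * Q m - real_of_int (P m) * Q (Suc (Suc m))
        = c (m + 2) * (real_of_int (P (Suc m)) * Q m - real_of_int (P m) * Q (Suc m))"
      by (simp add: algebra_simps)
    also have "\<dots> = real (c (m + 2)) * (-1) ^ n"
      unfolding det_real by (simp add: m_def power_add power_mult)
    finally have e: "real_of_int (P (Suc (Suc m))) * Q m - real_of_int (P m) * Q (Suc (Suc m)) = real (c (m + 2)) * (-1) ^ n" .
    have "x (Suc k) - x k
        = (-1) ^ n * (real_of_int (P (Suc (Suc m))) / Q (Suc (Suc m)) - real_of_int (P m) / Q m)"
      by (simp add: x_def m_def algebra_simps)
    also have "real_of_int (P (Suc (Suc m))) / Q (Suc (Suc m)) - real_of_int (P m) / Q m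
        = real (c (m + 2)) * (-1) ^ n / (real_of_int (Q m) * Q (Suc (Suc m)))"
      unfolding e[symmetric]
      by (subst diff_frac_eq) (use q in \<open>simp_all add: mult.commute del: cf_num.simps cf_den.simps\<close>)
    also have "(-1) ^ n * (real (c (m + 2)) * (-1) ^ n / (real_of_int (Q m) * Q (Suc (Suc m))))
        = c (m + 2) / (real_of_int (Q m) * Q (Suc (Suc m)))"
      by (cases "even n") auto
    also have "\<dots> > 0" using q c_ge_1[of "m + 2"] by (intro divide_pos_pos mult_pos_pos) auto
    finally show ?thesis by simp
  qed
  have "(\<lambda>k. real_of_rat (cfr c 0 k)) \<longlonglongrightarrow> \<gamma>" using cf by (simp add: has_cf_expansion_def)
  then have "(\<lambda>k. real_of_int (P k) / Q k) \<longlonglongrightarrow> \<gamma>"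
    using cfr_eq_quotient[OF c_ge_1] by (simp add: of_rat_divide)
  then have "(\<lambda>k. real_of_int (P (n + 2 * k)) / Q (n + 2 * k)) \<longlonglongrightarrow> \<gamma>"
    by (rule LIMSEQ_subseq_LIMSEQ[where f = "\<lambda>k. n + 2 * k", unfolded comp_def])
       (auto simp: strict_mono_def)
  then have lim: "x \<longlonglongrightarrow> (-1) ^ n * \<gamma>" unfolding x_def by (intro tendsto_mult tendsto_const)
  have "incseq x" using step by (intro incseq_SucI) (auto intro: less_imp_le)
  \<comment> \<open>The limit yields only a weak inequality; taking it at index 1 and adding one
    strict step from index 0 keeps the conclusion strict.\<close>
  then have "x 1 \<le> (-1) ^ n * \<gamma>" using lim by (rule incseq_le)
  with step[of 0] have "x 0 < (-1) ^ n * \<gamma>" by simp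
  then have "Q n * x 0 < Q n * ((-1) ^ n * \<gamma>)" using Q_pos[of n] by simp
  then show ?thesis using Q_pos[of n] by (simp add: D_def x_def algebra_simps)
qed

lemma D_rec: "D n = c (n + 2) * D (Suc n) + D (Suc (Suc n))"
  by (simp add: D_def algebra_simps)

text \<open>This is the determinant identity with the \<gamma> terms cancelling. Divided by
  \<open>Q n * D n\<close> it expresses the reciprocal of that product as a sum of two ratios, and
  every later bound on \<open>Q n * D n\<close> is read off from it.\<close>

lemma Q_D: "Q (Suc n) * D n + Q n * D (Suc n) = 1"
proof -
  have "Q (Suc n) * D n + Q n * D (Suc n) = (-1) ^ n * (real_of_int (P (Suc n)) * Q n - real_of_int (P n) * Q (Suc n))"
    by (simp add: D_def algebra_simps)
  then show ?thesis by (simp add: det_real)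
qed

lemma D_antimono: "D (Suc n) < D n"
proof -
  have "1 * D (Suc n) \<le> c (n + 2) * D (Suc n)"
    using c_ge_1[of "n + 2"] D_pos[of "Suc n"] by (intro mult_right_mono) auto
  then show ?thesis using D_rec[of n] D_pos[of "Suc (Suc n)"] by simp
qed

text \<open>Legendre's criterion: expand \<open>(p, m)\<close> in the unimodular basis formed by two consecutive convergents.\<close>
lemma legendre:
  fixes m p :: int
  assumes m: "m \<ge> 1" and small: "m * \<bar>m * \<gamma> - p\<bar> < 1 / 2"
  obtains n j where "j \<ge> 1" "m = j * Q n" "p = j * P n"
proof -
  have ex: "\<exists>n. m < Q (Suc n)" using Q_ge[of "nat (m + 1)"] m by (intro exI[of _ "nat (m + 1)"]) auto
  \<comment> \<open>The index is chosen so that \<open>Q n \<le> m < Q (Suc n)\<close>; the lower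
    bound at \<open>n = 0\<close> holds because \<open>Q 0 = 1\<close>.\<close>
  define n where "n = (LEAST n. m < Q (Suc n))"
  have up: "m < Q (Suc n)" unfolding n_def using ex by (rule LeastI_ex)
  have lo: "Q n \<le> m"
  proof (cases n)
    case 0 then show ?thesis using m by simp
  next
    case (Suc k)
    then have "\<not> m < Q (Suc k)" unfolding n_def by (intro not_less_Least) auto
    then show ?thesis using Suc by simp
  qed
  define \<epsilon> :: int where "\<epsilon> = (-1) ^ n"
  have eps: "\<epsilon> * \<epsilon> = 1" "\<bar>\<epsilon>\<bar> = 1" unfolding \<epsilon>_def by (cases "even n"; auto)+
  \<comment> \<open>Coordinates by Cramer's rule; the determinant \<open>\<epsilon>\<close> is its
    own inverse, so they are integers.\<close>
  define x where "x = \<epsilon> * (P (Suc n) * m - Q (Suc n) * p)"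
  define y where "y = \<epsilon> * (Q n * p - P n * m)"
  have det: "P (Suc n) * Q n - P n * Q (Suc n) = \<epsilon>" unfolding \<epsilon>_def by (rule cf_det)
  have "x * Q n + y * Q (Suc n) = \<epsilon> * (P (Suc n) * Q n - P n * Q (Suc n)) * m"
    by (simp add: x_def y_def algebra_simps)
  then have mm: "m = x * Q n + y * Q (Suc n)" by (simp add: det eps)
  have "x * P n + y * P (Suc n) = \<epsilon> * (P (Suc n) * Q n - P n * Q (Suc n)) * p"
    by (simp add: x_def y_def algebra_simps)
  then have pp: "p = x * P n + y * P (Suc n)" by (simp add: det eps)
  show thesis
  proof (cases "y = 0")
    case True
    then have "x * Q n > 0" using mm m by simp
    then have "x > 0" using Q_pos[of n] by (simp add: zero_less_mult_iff)
    then show thesis using True mm pp by (intro that[of x n]) auto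
  next
    case False
    have "m * \<gamma> - p = x * (Q n * \<gamma> - P n) + y * (Q (Suc n) * \<gamma> - P (Suc n))"
      by (subst mm, subst pp) (simp add: algebra_simps)
    also have "\<dots> = (-1) ^ n * (x * D n - y * D (Suc n))"
      by (cases "even n") (auto simp: D_def algebra_simps)
    finally have diff: "\<bar>m * \<gamma> - p\<bar> = \<bar>x * D n - y * D (Suc n)\<bar>" by (simp add: abs_mult)
    \<comment> \<open>Since \<open>0 < m < Q (Suc n)\<close>, a nonzero \<open>y\<close> forces
      \<open>x\<close> to have the opposite sign. The two terms then reinforce each other, and the
      first alone has size at least \<open>D n\<close>.\<close>
    have "D n \<le> \<bar>x * D n - y * D (Suc n)\<bar>"
    proof (cases "y > 0")
      case True
      have "x < 0"
      proof (rule ccontr)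
        assume "\<not> x < 0"
        then have "0 \<le> x * Q n" using Q_pos[of n] by simp
        moreover have "1 * Q (Suc n) \<le> y * Q (Suc n)"
          using True Q_pos[of "Suc n"] by (intro mult_right_mono) auto
        ultimately show False using mm up by simp
      qed
      then have "1 * D n \<le> - x * D n" using D_pos[of n] by (intro mult_right_mono) auto
      moreover have "0 \<le> y * D (Suc n)" using True D_pos[of "Suc n"] by simp
      ultimately show ?thesis by linarith
    next
      case n: False
      then have y: "y < 0" using False by simp
      have "x > 0"
      proof (rule ccontr)
        assume "\<not> x > 0"
        then have "x * Q n \<le> 0" using Q_pos[of n] by (simp add: mult_nonpos_nonneg)
        moreover have "y * Q (Suc n) < 0" using y Q_pos[of "Suc n"] by (simp add: mult_neg_pos)
        ultimately show False using mm m by simp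
      qed
      then have "1 * D n \<le> x * D n" using D_pos[of n] by (intro mult_right_mono) auto
      moreover have "0 \<le> - y * D (Suc n)" using y D_pos[of "Suc n"] by (simp add: mult_nonpos_nonneg)
      ultimately show ?thesis by linarith
    qed
    then have Dle: "D n \<le> \<bar>m * \<gamma> - p\<bar>" using diff by simp
    have absD: "\<bar>Q n * \<gamma> - P n\<bar> = D n" using D_pos[of n] unfolding D_def
      by (cases "even n") auto
    \<comment> \<open>A nonzero integer \<open>y\<close> is impossible: written through the two
      approximation errors, its size is at most \<open>2 * m * \<bar>m * \<gamma> - p\<bar>\<close>,
      which is below 1.\<close>
    have "1 \<le> \<bar>y\<bar>" using False by simp
    also have "\<bar>y\<bar> = \<bar>Q n * p - P n * m\<bar>" using eps by (simp add: y_def abs_mult)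
    finally have "1 \<le> real_of_int \<bar>Q n * p - P n * m\<bar>" by linarith
    also have "\<dots> = \<bar>Q n * (p - m * \<gamma>) + m * (Q n * \<gamma> - P n)\<bar>" by (simp add: algebra_simps)
    also have "\<dots> \<le> \<bar>Q n * (p - m * \<gamma>)\<bar> + \<bar>m * (Q n * \<gamma> - P n)\<bar>" by (rule abs_triangle_ineq)
    also have "\<dots> = Q n * \<bar>m * \<gamma> - p\<bar> + m * D n"
      using m Q_pos[of n] absD by (simp add: abs_mult abs_minus_commute)
    also have "\<dots> \<le> m * \<bar>m * \<gamma> - p\<bar> + m * \<bar>m * \<gamma> - p\<bar>"
      using lo m Dle by (intro add_mono mult_right_mono mult_left_mono) auto
    also have "\<dots> < 1" using small by simp
    finally show thesis by simp
  qed
qed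

end

text \<open>Convexity of the tangent up to \<open>pi / 2\<close>, together with
  \<open>tan 0 = 0\<close>.\<close>

lemma tan_scale_le:
  assumes "0 \<le> t" "t \<le> 1" "0 \<le> y" "y < pi / 2"
  shows "tan (t * y) \<le> t * tan y"
proof -
  have "convex_on {0..<pi/2} tan"
  proof (rule convex_on_realI[where f' = "\<lambda>x. inverse ((cos x)\<^sup>2)"])
    fix x :: real assume x: "x \<in> {0..<pi / 2}"
    then have "cos x > 0" by (intro cos_gt_zero_pi) auto
    then show "(tan has_real_derivative inverse ((cos x)\<^sup>2)) (at x)" by (intro DERIV_tan) auto
  next
    fix x z :: real assume x: "x \<in> {0..<pi / 2}" "z \<in> {0..<pi/2}" "x \<le> z"
    then have "cos z > 0" by (intro cos_gt_zero_pi) auto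
    moreover have "cos z \<le> cos x" using x by (subst cos_mono_le_eq) auto
    ultimately show "inverse ((cos x)\<^sup>2) \<le> inverse ((cos z)\<^sup>2)" by (intro le_imp_inverse_le power_mono) auto
  qed auto
  from convex_onD[OF this assms(1,2), of 0 y] assms show ?thesis by simp
qed

lemma tan_pi_12: "tan (pi / 12) = 2 - sqrt 3"
proof -
  have "tan (pi / 12) = tan (pi / 3 - pi / 4)" by (simp add: field_simps)
  also have "\<dots> = (tan (pi / 3) - tan (pi / 4)) / (1 + tan (pi / 3) * tan (pi / 4))"
  proof (rule tan_diff)
    show "cos (pi / 3) \<noteq> 0" by (simp add: cos_60)
    show "cos (pi / 4) \<noteq> 0" by (simp add: cos_45)
    show "cos (pi / 3 - pi / 4) \<noteq> 0"
      using cos_gt_zero_pi[of "pi / 3 - pi / 4"] by (simp add: field_simps)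
  qed
  also have "\<dots> = (sqrt 3 - 1) / (1 + sqrt 3)" by (simp add: tan_60 tan_45)
  also have "\<dots> = 2 - sqrt 3"
  proof (subst divide_eq_eq)
    have "1 + sqrt 3 \<noteq> 0" using real_sqrt_ge_zero[of 3] by linarith
    then show "if 1 + sqrt 3 \<noteq> 0 then sqrt 3 - 1 = (2 - sqrt 3) * (1 + sqrt 3) else 2 - sqrt 3 = 0"
      by (simp add: algebra_simps)
  qed
  finally show ?thesis .
qed

lemma tan_ge_self:
  assumes "0 \<le> x" "x < pi / 2" shows "x \<le> tan (x :: real)"
  using abs_tan_ge[of x] tan_gt_zero[of x] assms by (cases "x = 0") auto

section \<open>The gap condition for partial quotients 1 and 2\<close>

locale cf_one_two = cf_expansion +
  assumes c0: "c 0 = 0" and c1: "c 1 = 1"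
    and ceven: "\<And>n. n \<ge> 1 \<Longrightarrow> c (2 * n) = 1"
    and codd: "\<And>n. c (2 * n + 1) \<in> {1, 2}"
begin

text \<open>The ratio of \<open>D (2 * n + 1)\<close> to \<open>D (2 * n)\<close> lies between 1/2
  and 3/4. As \<open>c (2 * n + 2) = 1\<close>, \<open>D (2 * n)\<close> exceeds
  \<open>D (2 * n + 1)\<close> by \<open>D (2 * n + 2)\<close>, which is less than
  \<open>D (2 * n + 1)\<close> but more than a third of it, the next partial quotient being at most
  2.\<close>

lemma D_half: "D (2 * n) < 2 * D (2 * n + 1)" and D_34: "4 * D (2 * n + 1) < 3 * D (2 * n)"
proof -
  have "c (2 * n + 2) = 1" using ceven[of "n + 1"] by simp
  then have 1: "D (2 * n) = D (2 * n + 1) + D (2 * n + 2)" using D_rec[of "2 * n"] by simp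
  have 2: "D (2 * n + 1) = c (2 * n + 3) * D (2 * n + 2) + D (2 * n + 3)"
    using D_rec[of "2 * n + 1"] by (simp add: numeral_3_eq_3)
  have "c (2 * n + 3) * D (2 * n + 2) \<le> 2 * D (2 * n + 2)"
    using codd[of "n + 1"] D_pos[of "2 * n + 2"] by (intro mult_right_mono) (auto simp: numeral_3_eq_3)
  moreover have "D (2 * n + 2) < D (2 * n + 1)" "D (2 * n + 3) < D (2 * n + 2)"
    using D_antimono[of "2 * n + 1"] D_antimono[of "2 * n + 2"] by (auto simp: numeral_3_eq_3)
  ultimately show "D (2 * n) < 2 * D (2 * n + 1)" "4 * D (2 * n + 1) < 3 * D (2 * n)"
    using 1 2 by linarith+
qed

lemma Q_even: "n \<ge> 1 \<Longrightarrow> Q (2 * n) = Q (2 * n - 1) + Q (2 * n - 2)"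
  using ceven[of n] by (cases n) auto

lemma Q_odd: "n \<ge> 1 \<Longrightarrow> Q (2 * n + 1) = c (2 * n + 1) * Q (2 * n) + Q (2 * n - 1)"
  by (cases n) auto

lemma Q_odd_le: "Q (2 * n + 1) \<le> 3 * Q (2 * n)"
proof (cases n)
  case 0 then show ?thesis using c1 by simp
next
  case (Suc m)
  have "int (c (2 * n + 1)) * Q (2 * n) \<le> 2 * Q (2 * n)"
    using codd[of n] Q_pos[of "2 * n"] by (intro mult_right_mono) auto
  then show ?thesis using Q_odd[of n] Q_mono[of "2 * n - 1"] Suc by simp
qed

text \<open>The mirror image of the bounds for \<open>D\<close>: the ratio of
  \<open>Q (2 * n - 1)\<close> to \<open>Q (2 * n)\<close> lies between 1/2 and 3/4.\<close>

lemma Q_prev: assumes "n \<ge> 1" shows "Q (2 * n) \<le> 2 * Q (2 * n - 1)" "4 * Q (2 * n - 1) \<le> 3 * Q (2 * n)"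
proof -
  obtain m where m: "n = Suc m" using assms by (cases n) auto
  show "Q (2 * n) \<le> 2 * Q (2 * n - 1)" "4 * Q (2 * n - 1) \<le> 3 * Q (2 * n)"
    using Q_even[of n] Q_mono[of "2 * m"] Q_odd_le[of m] m by auto
qed

text \<open>With \<open>c (2 * n + 1) = 1\<close> the denominator ratio is at most 1 + 3/4 and the
  \<open>D\<close> ratio at most 3/4, so the reciprocal of the product is at most 5/2. At
  \<open>n = 0\<close> the denominator ratio is just 1.\<close>

lemma QD_one:
  assumes "c (2 * n + 1) = 1" shows "2 / 5 \<le> Q (2 * n) * D (2 * n)"
proof -
  have "4 * Q (2 * n + 1) \<le> 7 * Q (2 * n)"
    using Q_odd[of n] Q_prev(2)[of n] assms c1 by (cases "n = 0") auto
  then have "real_of_int (4 * Q (2 * n + 1)) \<le> 7 * Q (2 * n)" by linarith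
  then have "4 * Q (2 * n + 1) * D (2 * n) \<le> 7 * Q (2 * n) * D (2 * n)"
    using D_pos[of "2 * n"] by (intro mult_right_mono) auto
  moreover have "Q (2 * n) * (4 * D (2 * n + 1)) \<le> Q (2 * n) * (3 * D (2 * n))"
    using D_34[of n] Q_pos[of "2 * n"] by (intro mult_left_mono) auto
  ultimately show ?thesis using Q_D[of "2 * n"] by simp
qed

text \<open>The two ratios are at most 3 and 1. This crude bound serves only to exclude proper
  multiples of convergents.\<close>

lemma QD_lower: "1 / 4 \<le> Q (2 * n) * D (2 * n)"
proof -
  have "real_of_int (Q (2 * n + 1)) \<le> 3 * Q (2 * n)" using Q_odd_le[of n] by linarith
  then have "Q (2 * n + 1) * D (2 * n) \<le> 3 * Q (2 * n) * D (2 * n)"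
    using D_pos[of "2 * n"] by (intro mult_right_mono) auto
  moreover have "Q (2 * n) * D (2 * n + 1) \<le> Q (2 * n) * D (2 * n)"
    using D_antimono[of "2 * n"] Q_pos[of "2 * n"] by (intro mult_left_mono) auto
  ultimately show ?thesis using Q_D[of "2 * n"] by simp
qed

text \<open>The denominator ratio is now at least 2 + 1/2 and the \<open>D\<close> ratio more than
  1/2, so the reciprocal exceeds 3. As \<open>c 1 = 1\<close>, the index is at least 1, which also
  gives the bound on \<open>Q\<close>.\<close>

lemma QD_two:
  assumes "c (2 * n + 1) = 2" shows "Q (2 * n) * D (2 * n) < 1 / 3" "Q (2 * n) \<ge> 2"
proof -
  have n: "n \<ge> 1" using assms c1 by (cases n) auto
  show "Q (2 * n) \<ge> 2" using Q_even[OF n] Q_pos[of "2 * n - 1"] Q_pos[of "2 * n - 2"] by simp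
  have "5 * Q (2 * n) \<le> 2 * Q (2 * n + 1)"
    using Q_odd[OF n] Q_prev(1)[OF n] assms by simp
  then have "real_of_int (5 * Q (2 * n)) \<le> 2 * Q (2 * n + 1)" by linarith
  then have "5 * Q (2 * n) * D (2 * n) \<le> 2 * Q (2 * n + 1) * D (2 * n)"
    using D_pos[of "2 * n"] by (intro mult_right_mono) auto
  moreover have "Q (2 * n) * D (2 * n) < Q (2 * n) * (2 * D (2 * n + 1))"
    using D_half[of n] Q_pos[of "2 * n"] by (intro mult_strict_left_mono) auto
  ultimately show "Q (2 * n) * D (2 * n) < 1 / 3" using Q_D[of "2 * n"] by simp
qed

text \<open>These are the bounds on \<open>D\<close> at index 0, where \<open>D 0 = \<gamma>\<close>
  and \<open>D 1 = 1 - \<gamma>\<close>.\<close>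

lemma gamma_bounds: "1 / 2 \<le> \<gamma>" "\<gamma> \<le> 2 / 3"
proof -
  have D0: "D 0 = \<gamma>" using c0 by (simp add: D_def)
  have D1: "D 1 = 1 - \<gamma>" using c0 c1 by (simp add: D_def)
  show "1 / 2 \<le> \<gamma>" using D_antimono[of 0] D0 D1 by simp
  show "\<gamma> \<le> 2 / 3" using D_half[of 0] D0 D1 by simp
qed

lemma frac_gap_iff:
  fixes m :: int
  assumes m: "m \<ge> 1" and A: "2 * (2 - sqrt 3) \<le> A" "A \<le> pi / 5"
  shows "m * tan (pi / 2 * frac (m * \<gamma>)) < A \<longleftrightarrow> (\<exists>n. c (2 * n + 1) = 2 \<and> m = Q (2 * n))"
proof
  assume less: "m * tan (pi / 2 * frac (m * \<gamma>)) < A"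
  define p where "p = \<lfloor>m * \<gamma>\<rfloor>"
  have fr: "frac (m * \<gamma>) = m * \<gamma> - p" by (simp add: frac_def p_def)
  have fr0: "0 \<le> frac (m * \<gamma>)" "frac (m * \<gamma>) < 1" by (auto simp: frac_lt_1)
  have "m * (pi / 2 * frac (m * \<gamma>)) \<le> m * tan (pi / 2 * frac (m * \<gamma>))"
    using m fr0 by (intro mult_left_mono tan_ge_self) auto
  also have "\<dots> < pi / 5" using less A by simp
  finally have small: "m * frac (m * \<gamma>) < 2 / 5" by (simp add: field_simps)
  then have "m * \<bar>m * \<gamma> - p\<bar> < 1 / 2" using fr fr0 by simp
  from legendre[OF m this] obtain k j where j: "j \<ge> 1" "m = j * Q k" "p = j * P k" by metis
  have "m * \<gamma> - p = j * (Q k * \<gamma> - P k)" unfolding j(2,3) by (simp add: algebra_simps)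
  then have e: "frac (m * \<gamma>) = j * (Q k * \<gamma> - P k)" using fr by simp
  have "even k"
  proof (rule ccontr)
    assume "odd k"
    then have "Q k * \<gamma> - P k < 0" using D_pos[of k] by (simp add: D_def)
    then have "j * (Q k * \<gamma> - P k) < 0" using j by (simp add: mult_pos_neg)
    then show False using e fr0 by simp
  qed
  then obtain n where n: "k = 2 * n" by (elim evenE)
  \<comment> \<open>Both factors scale with \<open>j\<close>, so by \<open>QD_lower\<close> any
    \<open>j \<ge> 2\<close> gives at least 1, which is above 2/5.\<close>
  have e: "m * frac (m * \<gamma>) = (j * j) * (Q (2 * n) * D (2 * n))"
    unfolding e using j n by (simp add: D_def)
  have j1: "j = 1"
  proof (rule ccontr)
    assume "j \<noteq> 1"
    then have "real_of_int 2 * real_of_int 2 \<le> real_of_int j * j"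
      using j by (intro mult_mono) auto
    then have "real_of_int 2 * real_of_int 2 * (1 / 4) \<le> (j * j) * (Q (2 * n) * D (2 * n))"
      using QD_lower[of n] by (intro mult_mono) auto
    then show False using e small by simp
  qed
  then have "c (2 * n + 1) \<noteq> 1" using QD_one[of n] small e by auto
  then have "c (2 * n + 1) = 2" using codd[of n] by blast
  then show "\<exists>n. c (2 * n + 1) = 2 \<and> m = Q (2 * n)" using j1 j n by auto
next
  assume "\<exists>n. c (2 * n + 1) = 2 \<and> m = Q (2 * n)"
  then obtain n where n: "c (2 * n + 1) = 2" "m = Q (2 * n)" by blast
  note b = QD_two[OF n(1)]
  have D0: "D (2 * n) > 0" by (rule D_pos)
  have "1 * D (2 * n) \<le> Q (2 * n) * D (2 * n)" using b(2) D0 by (intro mult_right_mono) auto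
  then have D1: "D (2 * n) < 1" using b by simp
  have "frac (m * \<gamma>) = D (2 * n)"
    using D0 D1 n by (simp add: frac_unique_iff) (simp add: D_def Ints_def)
  moreover have "D (2 * n) < 1 / (3 * m)" using b n by (simp add: field_simps)
  moreover have m2: "real_of_int m \<ge> 2" using b n by linarith
  ultimately have "tan (pi / 2 * frac (m * \<gamma>)) < tan (pi / 2 * (1 / (3 * m)))"
    using D0 by (intro tan_monotone) (auto simp: field_simps intro: order.strict_trans1[of _ 0])
  \<comment> \<open>The angle is rewritten as a multiple of \<open>pi / 12\<close> so that the
    tangent can be scaled down; the factor \<open>2 / m\<close> is at most 1 because
    \<open>m \<ge> 2\<close>.\<close>
  also have "pi / 2 * (1 / (3 * m)) = 2 / m * (pi / 12)" by simp
  also have "tan \<dots> \<le> 2 / m * tan (pi / 12)"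
    using m2 by (intro tan_scale_le) auto
  finally have "m * tan (pi / 2 * frac (m * \<gamma>)) < 2 * tan (pi / 12)" using m2 by (simp add: field_simps)
  then show "m * tan (pi / 2 * frac (m * \<gamma>)) < A" using A by (simp add: tan_pi_12)
qed

text \<open>Here \<open>e\<close> stands for \<open>d - 1\<close>. Put
  \<open>p = \<lfloor>m / \<gamma>\<rfloor>\<close>, so \<open>p * \<gamma> \<le> m\<close>; a
  failure would make \<open>p * (m - p * \<gamma>)\<close> less than
  \<open>2 / 5 * \<gamma>\<close>, hence below 4/15. Legendre's criterion then produces a convergent
  of odd index, for which this product is at least 1/3.\<close>

lemma frac_no_gap:
  fixes m :: int
  assumes m: "m \<ge> 1" and A: "A \<le> pi / 5" and e: "e \<ge> 1"
  shows "A * \<gamma> \<le> m * (e * tan (pi / 2 * frac (m / \<gamma>)))"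
proof (rule ccontr)
  assume "\<not> ?thesis"
  then have less: "m * (e * tan (pi / 2 * frac (m / \<gamma>))) < A * \<gamma>" by simp
  have g: "\<gamma> > 0" "\<gamma> \<le> 2 / 3" using gamma_bounds by auto
  define p where "p = \<lfloor>m / \<gamma>\<rfloor>"
  have fr: "frac (m / \<gamma>) = m / \<gamma> - p" by (simp add: frac_def p_def)
  have fr0: "0 \<le> frac (m / \<gamma>)" "frac (m / \<gamma>) < 1" by (auto simp: frac_lt_1)
  have "1 \<le> m / \<gamma>" using m g by (simp add: field_simps)
  then have p1: "p \<ge> 1" unfolding p_def by linarith
  have t: "pi / 2 * frac (m / \<gamma>) \<le> tan (pi / 2 * frac (m / \<gamma>))"
    using fr0 by (intro tan_ge_self) auto
  moreover have "0 \<le> pi / 2 * frac (m / \<gamma>)" using fr0 by simp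
  ultimately have "1 * (pi / 2 * frac (m / \<gamma>)) \<le> e * tan (pi / 2 * frac (m / \<gamma>))"
    using e by (intro mult_mono) auto
  then have "m * (pi / 2 * frac (m / \<gamma>)) \<le> m * (e * tan (pi / 2 * frac (m / \<gamma>)))"
    using m by (intro mult_left_mono) auto
  also have "\<dots> < A * \<gamma>" by fact
  also have "\<dots> \<le> pi / 5 * \<gamma>" using A g by simp
  finally have "m * frac (m / \<gamma>) < 2 / 5 * \<gamma>" by (simp add: field_simps)
  then have "m * (frac (m / \<gamma>) * \<gamma>) < 2 / 5 * \<gamma> * \<gamma>" using g by (simp add: field_simps)
  moreover have fg: "frac (m / \<gamma>) * \<gamma> = m - p * \<gamma>" using g fr by (simp add: field_simps)
  ultimately have lt: "m * (m - p * \<gamma>) < 2 / 5 * \<gamma> * \<gamma>" by simp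
  have d0: "0 \<le> m - p * \<gamma>" using fg fr0 g by (metis mult_nonneg_nonneg less_imp_le)
  have "(p * \<gamma>) * (m - p * \<gamma>) \<le> m * (m - p * \<gamma>)"
    using d0 by (intro mult_right_mono) auto
  also note lt
  finally have "(p * (m - p * \<gamma>)) * \<gamma> < (2 / 5 * \<gamma>) * \<gamma>" by (simp only: mult_ac)
  then have "p * (m - p * \<gamma>) < 2 / 5 * \<gamma>" by (rule mult_right_less_imp_less) (use g in simp)
  then have small: "p * (m - p * \<gamma>) < 4 / 15" using g by simp
  then have "p * \<bar>p * \<gamma> - m\<bar> < 1 / 2" using d0 by (simp add: abs_minus_commute)
  from legendre[OF p1 this] obtain k j where j: "j \<ge> 1" "p = j * Q k" "m = j * P k" by metis
  have e: "m - p * \<gamma> = j * (P k - Q k * \<gamma>)" unfolding j by (simp add: algebra_simps)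
  have "odd k"
  proof (rule ccontr)
    assume "\<not> odd k"
    then have "P k - Q k * \<gamma> < 0" using D_pos[of k] by (simp add: D_def)
    then have "j * (P k - Q k * \<gamma>) < 0" using j by (simp add: mult_pos_neg)
    then show False using e d0 by simp
  qed
  then obtain n where n: "k = 2 * n + 1" by (elim oddE)
  have e: "p * (m - p * \<gamma>) = (j * j) * (Q k * D k)"
    unfolding e using j n by (simp add: D_def algebra_simps)
  \<comment> \<open>For odd \<open>k\<close> the next partial quotient is 1, so the two ratios in
    \<open>Q_D\<close> are at most 2 and 1.\<close>
  have "Q (Suc k) \<le> 2 * Q k" using Q_prev(1)[of "n + 1"] n by simp
  then have "real_of_int (Q (Suc k)) \<le> 2 * Q k" by linarith
  then have "Q (Suc k) * D k \<le> 2 * Q k * D k"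
    using D_pos[of k] by (intro mult_right_mono) auto
  moreover have "Q k * D (Suc k) \<le> Q k * D k"
    using D_antimono[of k] Q_pos[of k] by (intro mult_left_mono) auto
  ultimately have "1 / 3 \<le> Q k * D k" using Q_D[of k] by simp
  moreover have "real_of_int 1 * real_of_int 1 \<le> real_of_int j * j" using j by (intro mult_mono) auto
  ultimately have "real_of_int 1 * real_of_int 1 * (1 / 3) \<le> (j * j) * (Q k * D k)"
    by (intro mult_mono) auto
  then show False using e small by simp
qed

end

section \<open>The differential equation on an edge\<close>

text \<open>\<open>sn\<close> and \<open>cs\<close> solve \<open>f'' = - k\<^sup>2 * f\<close> with
  initial data (0, 1) and (1, 0). Extending \<open>sn\<close> to \<open>k = 0\<close> by its limit
  lets energy 0 share all formulas.\<close>

definition sn :: "real \<Rightarrow> real \<Rightarrow> real" where "sn k t = (if k = 0 then t else sin (k * t) / k)"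
definition cs :: "real \<Rightarrow> real \<Rightarrow> real" where "cs k t = cos (k * t)"

lemma sn_0 [simp]: "sn k 0 = 0" and cs_0 [simp]: "cs k 0 = 1"
  by (auto simp: sn_def cs_def)

lemma sn_deriv: "(sn k has_real_derivative cs k t) (at t within X)"
proof (cases "k = 0")
  case True
  then have "sn k = (\<lambda>t. t)" by (auto simp: sn_def)
  then show ?thesis using True by (simp add: cs_def)
next
  case False
  then have "sn k = (\<lambda>t. sin (k * t) / k)" by (auto simp: sn_def)
  then show ?thesis using False by (auto intro!: derivative_eq_intros simp: cs_def)
qed

lemma cs_deriv: "(cs k has_real_derivative - (k\<^sup>2 * sn k t)) (at t within X)"
  unfolding cs_def[abs_def] by (auto intro!: derivative_eq_intros simp: sn_def power2_eq_square)

lemma cs_sn: "(cs k t)\<^sup>2 + k\<^sup>2 * (sn k t)\<^sup>2 = 1"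
  by (auto simp: cs_def sn_def power_divide power_mult_distrib)

lemma abs_cs_le: "\<bar>cs k t\<bar> \<le> 1" by (simp add: cs_def)

lemma abs_sn_le: "\<bar>sn k t\<bar> \<le> \<bar>t\<bar>"
proof (cases "k = 0")
  case False
  have "\<bar>sin (k * t)\<bar> \<le> \<bar>k * t\<bar>" by (rule abs_sin_x_le_abs_x)
  then show ?thesis using False
    by (simp add: sn_def abs_mult pos_divide_le_eq mult.commute)
qed (simp add: sn_def)

lemma continuous_on_sn [continuous_intros]: "continuous_on X (sn k)"
  by (rule DERIV_continuous_on[OF sn_deriv])

lemma continuous_on_cs [continuous_intros]: "continuous_on X (cs k)"
  by (rule DERIV_continuous_on[OF cs_deriv])

lemma H2_dataD:
  assumes "H2_data l f g h"
  shows "continuous_on {0..l} g"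
    and "t \<in> {0..l} \<Longrightarrow> (f has_vector_derivative g t) (at t within {0..l})"
    and "h integrable_on {0..l}"
    and "t \<in> {0..l} \<Longrightarrow> g t = g 0 + integral {0..t} h"
  using assms unfolding H2_data_def by blast+

lemma H2_dataI:
  assumes "continuous_on {0..l} g"
    and "\<And>t. t \<in> {0..l} \<Longrightarrow> (f has_vector_derivative g t) (at t within {0..l})"
    and "h integrable_on {0..l}"
    and "\<And>t. t \<in> {0..l} \<Longrightarrow> g t = g 0 + integral {0..t} h"
  shows "H2_data l f g h"
  using assms unfolding H2_data_def by blast

lemma H2_data_continuous: "H2_data l f g h \<Longrightarrow> continuous_on {0..l} f"
  by (rule continuous_on_vector_derivative) (rule H2_dataD(2))

lemma H2_data_add:
  assumes 1: "H2_data l f g h" and 2: "H2_data l f' g' h'"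
  shows "H2_data l (\<lambda>t. f t + f' t) (\<lambda>t. g t + g' t) (\<lambda>t. h t + h' t)"
proof (rule H2_dataI)
  fix t assume t: "t \<in> {0..l}"
  have "h integrable_on {0..t}" "h' integrable_on {0..t}"
    using H2_dataD(3)[OF 1] H2_dataD(3)[OF 2] t by (auto intro: integrable_on_subinterval)
  then show "g t + g' t = g 0 + g' 0 + integral {0..t} (\<lambda>t. h t + h' t)"
    using H2_dataD(4)[OF 1 t] H2_dataD(4)[OF 2 t] by (simp add: integral_add)
qed (auto intro!: continuous_intros derivative_intros integrable_add H2_dataD[OF 1] H2_dataD[OF 2])

lemma H2_data_smooth:
  assumes "\<And>t. t \<in> {0..l} \<Longrightarrow> (f has_vector_derivative g t) (at t within {0..l})"
    and "\<And>t. t \<in> {0..l} \<Longrightarrow> (g has_vector_derivative h t) (at t within {0..l})"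
    and "continuous_on {0..l} h"
  shows "H2_data l f g h"
proof (rule H2_dataI)
  show "continuous_on {0..l} g" using assms(2) by (rule continuous_on_vector_derivative)
  show "h integrable_on {0..l}" using assms(3) by (rule integrable_continuous_interval)
next
  fix t assume t: "t \<in> {0..l}"
  show "(f has_vector_derivative g t) (at t within {0..l})" using t by (rule assms(1))
  have "(h has_integral g t - g 0) {0..t}"
    using t by (intro fundamental_theorem_of_calculus has_vector_derivative_within_subset[OF assms(2)]) auto
  then show "g t = g 0 + integral {0..t} h" by (simp add: integral_unique)
qed

lemma H2_data_homogeneous:
  "H2_data l (\<lambda>t. cs k t *\<^sub>R A + sn k t *\<^sub>R B) (\<lambda>t. cs k t *\<^sub>R B - (k\<^sup>2 * sn k t) *\<^sub>R A)
     (\<lambda>t. - k\<^sup>2 *\<^sub>R (cs k t *\<^sub>R A + sn k t *\<^sub>R B))"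
  by (rule H2_data_smooth)
     (auto intro!: derivative_eq_intros sn_deriv cs_deriv continuous_intros simp: algebra_simps)

text \<open>Transporting the pair of value and derivative back to time 0 along the flow gives two
  quantities with zero derivative. Inverting that transport uses only \<open>cs_sn\<close>.\<close>

lemma harmonic_unique:
  fixes \<phi> \<phi>' :: "real \<Rightarrow> complex"
  assumes d1: "\<And>t. t \<in> {0..l} \<Longrightarrow> (\<phi> has_vector_derivative \<phi>' t) (at t within {0..l})"
    and d2: "\<And>t. t \<in> {0..l} \<Longrightarrow> (\<phi>' has_vector_derivative - k\<^sup>2 *\<^sub>R \<phi> t) (at t within {0..l})"
    and t: "t \<in> {0..l}"
  shows "\<phi> t = cs k t *\<^sub>R \<phi> 0 + sn k t *\<^sub>R \<phi>' 0"
    and "\<phi>' t = cs k t *\<^sub>R \<phi>' 0 - (k\<^sup>2 * sn k t) *\<^sub>R \<phi> 0"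
proof -
  define P where "P t = cs k t *\<^sub>R \<phi> t - sn k t *\<^sub>R \<phi>' t" for t
  define R where "R t = (k\<^sup>2 * sn k t) *\<^sub>R \<phi> t + cs k t *\<^sub>R \<phi>' t" for t
  have "(P has_vector_derivative 0) (at s within {0..l})" if "s \<in> {0..l}" for s
    unfolding P_def using that
    by (auto intro!: derivative_eq_intros sn_deriv cs_deriv d1 d2 simp: algebra_simps)
  then obtain p where p: "\<And>s. s \<in> {0..l} \<Longrightarrow> P s = p"
    using has_vector_derivative_zero_constant[of "{0..l}" P] by auto
  have "((\<lambda>s. k\<^sup>2 *\<^sub>R (sn k s *\<^sub>R \<phi> s) + cs k s *\<^sub>R \<phi>' s) has_vector_derivative 0) (at s within {0..l})"
    if "s \<in> {0..l}" for s
    using that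
    by (auto intro!: derivative_eq_intros sn_deriv cs_deriv d1 d2 simp: algebra_simps)
  then have "(R has_vector_derivative 0) (at s within {0..l})" if "s \<in> {0..l}" for s
    unfolding R_def using that by simp
  then obtain r where r: "\<And>s. s \<in> {0..l} \<Longrightarrow> R s = r"
    using has_vector_derivative_zero_constant[of "{0..l}" R] by auto
  have 0: "0 \<in> {0..l}" using t by auto
  have P0: "P t = \<phi> 0" and R0: "R t = \<phi>' 0" using p[OF 0] p[OF t] r[OF 0] r[OF t]
    by (auto simp: P_def R_def)
  have "cs k t *\<^sub>R P t + sn k t *\<^sub>R R t = ((cs k t)\<^sup>2 + k\<^sup>2 * (sn k t)\<^sup>2) *\<^sub>R \<phi> t"
    by (simp add: P_def R_def algebra_simps power2_eq_square)
  then show "\<phi> t = cs k t *\<^sub>R \<phi> 0 + sn k t *\<^sub>R \<phi>' 0" by (simp add: cs_sn P0 R0)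
  have "cs k t *\<^sub>R R t - (k\<^sup>2 * sn k t) *\<^sub>R P t = ((cs k t)\<^sup>2 + k\<^sup>2 * (sn k t)\<^sup>2) *\<^sub>R \<phi>' t"
    by (simp add: P_def R_def algebra_simps power2_eq_square)
  then show "\<phi>' t = cs k t *\<^sub>R \<phi>' 0 - (k\<^sup>2 * sn k t) *\<^sub>R \<phi> 0" by (simp add: cs_sn P0 R0)
qed

text \<open>Duhamel's integral is only absolutely continuous to second order when \<open>f\<close> is merely
  integrable. Splitting off the double primitive of \<open>f\<close> leaves an inhomogeneity that is continuous,
  so the rest can be differentiated twice everywhere.\<close>
definition prim :: "(real \<Rightarrow> complex) \<Rightarrow> real \<Rightarrow> complex" where
  "prim f t = integral {0..t} f"

text \<open>This is Duhamel's \<open>- integral of sn k (t - s) * f s\<close> over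
  \<open>{0..t}\<close>, integrated by parts twice, with \<open>sn k (t - s)\<close> expanded by the
  addition formula. It solves \<open>y'' + k\<^sup>2 * y = - f\<close> with zero initial
  data.\<close>

definition part :: "real \<Rightarrow> (real \<Rightarrow> complex) \<Rightarrow> real \<Rightarrow> complex" where
  "part k f t = k\<^sup>2 *\<^sub>R (sn k t *\<^sub>R prim (\<lambda>s. cs k s *\<^sub>R prim (prim f) s) t
     - cs k t *\<^sub>R prim (\<lambda>s. sn k s *\<^sub>R prim (prim f) s) t) - prim (prim f) t"

definition part' :: "real \<Rightarrow> (real \<Rightarrow> complex) \<Rightarrow> real \<Rightarrow> complex" where
  "part' k f t = k\<^sup>2 *\<^sub>R (cs k t *\<^sub>R prim (\<lambda>s. cs k s *\<^sub>R prim (prim f) s) t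
     + k\<^sup>2 *\<^sub>R sn k t *\<^sub>R prim (\<lambda>s. sn k s *\<^sub>R prim (prim f) s) t) - prim f t"

lemma part_0 [simp]: "part k f 0 = 0" "part' k f 0 = 0"
  by (auto simp: part_def part'_def prim_def)

lemma prim_continuous: "f integrable_on {0..l} \<Longrightarrow> continuous_on {0..l} (prim f)"
  unfolding prim_def by (rule indefinite_integral_continuous_1)

lemma prim_deriv:
  "continuous_on {0..l} f \<Longrightarrow> t \<in> {0..l} \<Longrightarrow> (prim f has_vector_derivative f t) (at t within {0..l})"
  unfolding prim_def by (rule integral_has_vector_derivative)

text \<open>The smooth summand satisfies \<open>y'' = k\<^sup>2 * (prim (prim f) - y)\<close>.
  Subtracting \<open>prim (prim f)\<close> contributes exactly \<open>- f\<close> to the second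
  derivative, and this is the only place where mere absolute continuity of the first derivative
  occurs.\<close>

lemma H2_data_part:
  assumes f: "f integrable_on {0..l}" and l: "0 \<le> l"
  shows "H2_data l (part k f) (part' k f) (\<lambda>t. - f t - k\<^sup>2 *\<^sub>R part k f t)"
proof -
  note c1 = prim_continuous[OF f]
  have c2: "continuous_on {0..l} (prim (prim f))"
    by (intro prim_continuous integrable_continuous_interval c1)
  define G where "G = prim (\<lambda>s. cs k s *\<^sub>R prim (prim f) s)"
  define K where "K = prim (\<lambda>s. sn k s *\<^sub>R prim (prim f) s)"
  have G: "(G has_vector_derivative cs k t *\<^sub>R prim (prim f) t) (at t within {0..l})"
    and K: "(K has_vector_derivative sn k t *\<^sub>R prim (prim f) t) (at t within {0..l})"
    if "t \<in> {0..l}" for t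
    unfolding G_def K_def using that by (intro prim_deriv continuous_intros c2; simp)+
  have F2: "(prim (prim f) has_vector_derivative prim f t) (at t within {0..l})" if "t \<in> {0..l}" for t
    using that c1 by (intro prim_deriv)
  define y where "y t = k\<^sup>2 *\<^sub>R (sn k t *\<^sub>R G t - cs k t *\<^sub>R K t)" for t
  define y' where "y' t = k\<^sup>2 *\<^sub>R (cs k t *\<^sub>R G t + k\<^sup>2 *\<^sub>R sn k t *\<^sub>R K t)" for t
  have one: "cs k t *\<^sub>R cs k t *\<^sub>R z + k\<^sup>2 *\<^sub>R sn k t *\<^sub>R sn k t *\<^sub>R z = z" for t and z :: complex
  proof -
    have "cs k t *\<^sub>R cs k t *\<^sub>R z + k\<^sup>2 *\<^sub>R sn k t *\<^sub>R sn k t *\<^sub>R z = ((cs k t)\<^sup>2 + k\<^sup>2 * (sn k t)\<^sup>2) *\<^sub>R z"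
      by (simp add: algebra_simps power2_eq_square)
    then show ?thesis by (simp add: cs_sn)
  qed
  have y: "(y has_vector_derivative y' t) (at t within {0..l})" if "t \<in> {0..l}" for t
    unfolding y_def y'_def using that
    by (auto intro!: derivative_eq_intros sn_deriv cs_deriv G K simp: algebra_simps)
  have y': "(y' has_vector_derivative k\<^sup>2 *\<^sub>R (prim (prim f) t - y t)) (at t within {0..l})" if "t \<in> {0..l}" for t
  proof -
    have "(y' has_vector_derivative k\<^sup>2 *\<^sub>R ((cs k t *\<^sub>R cs k t *\<^sub>R prim (prim f) t + - (k\<^sup>2 * sn k t) *\<^sub>R G t)
        + k\<^sup>2 *\<^sub>R (sn k t *\<^sub>R sn k t *\<^sub>R prim (prim f) t + cs k t *\<^sub>R K t))) (at t within {0..l})"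
      unfolding y'_def using that
      by (auto intro!: derivative_eq_intros sn_deriv cs_deriv G K simp: algebra_simps)
    also have "(cs k t *\<^sub>R cs k t *\<^sub>R prim (prim f) t + - (k\<^sup>2 * sn k t) *\<^sub>R G t)
        + k\<^sup>2 *\<^sub>R (sn k t *\<^sub>R sn k t *\<^sub>R prim (prim f) t + cs k t *\<^sub>R K t)
      = (cs k t *\<^sub>R cs k t *\<^sub>R prim (prim f) t + k\<^sup>2 *\<^sub>R sn k t *\<^sub>R sn k t *\<^sub>R prim (prim f) t) - y t"
      by (simp add: y_def algebra_simps)
    finally show ?thesis unfolding one .
  qed
  have cy: "continuous_on {0..l} y" using y by (rule continuous_on_vector_derivative)
  have "H2_data l y y' (\<lambda>t. k\<^sup>2 *\<^sub>R (prim (prim f) t - y t))"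
    by (intro H2_data_smooth y y' continuous_intros c2 cy)
  moreover have "H2_data l (\<lambda>t. - prim (prim f) t) (\<lambda>t. - prim f t) (\<lambda>t. - f t)"
  proof (rule H2_dataI)
    show "continuous_on {0..l} (\<lambda>t. - prim f t)" by (intro continuous_intros c1)
    show "((\<lambda>t. - prim (prim f) t) has_vector_derivative - prim f t) (at t within {0..l})"
      if "t \<in> {0..l}" for t
      using that by (intro has_vector_derivative_minus F2)
    show "(\<lambda>t. - f t) integrable_on {0..l}" using f by (rule integrable_neg)
  qed (simp add: prim_def integral_neg)
  ultimately have "H2_data l (\<lambda>t. y t + - prim (prim f) t) (\<lambda>t. y' t + - prim f t)
      (\<lambda>t. k\<^sup>2 *\<^sub>R (prim (prim f) t - y t) + - f t)"
    by (rule H2_data_add)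
  then show ?thesis
    by (simp add: part_def[abs_def] part'_def[abs_def] y_def[abs_def] y'_def[abs_def] G_def K_def algebra_simps)
qed

text \<open>With \<open>f\<close> the value of \<open>H - k\<^sup>2\<close> on
  \<open>\<psi>\<close>, the difference of \<open>\<psi>\<close> and \<open>part k f\<close> solves
  the homogeneous equation. The merely integrable terms cancel in it, so its derivative is the
  primitive of a continuous function and \<open>harmonic_unique\<close> applies.\<close>

lemma edge_solution:
  fixes k :: real
  assumes "H2_data l \<psi> D u" and l: "0 \<le> l" and t: "t \<in> {0..l}"
  defines "f \<equiv> \<lambda>t. - u t - k\<^sup>2 *\<^sub>R \<psi> t"
  shows "\<psi> t = cs k t *\<^sub>R \<psi> 0 + sn k t *\<^sub>R D 0 + part k f t"
    and "D t = cs k t *\<^sub>R D 0 - (k\<^sup>2 * sn k t) *\<^sub>R \<psi> 0 + part' k f t"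
proof -
  have c: "continuous_on {0..l} \<psi>" using assms(1) by (rule H2_data_continuous)
  have u: "u integrable_on {0..l}" using assms(1) by (rule H2_dataD)
  have f: "f integrable_on {0..l}" unfolding f_def
    by (intro integrable_diff integrable_neg u integrable_continuous_interval continuous_intros c)
  note p = H2_data_part[OF f l, of k]
  have cp: "continuous_on {0..l} (part k f)" using p by (rule H2_data_continuous)
  have "((\<lambda>t. D t - part' k f t) has_vector_derivative - k\<^sup>2 *\<^sub>R (\<psi> s - part k f s)) (at s within {0..l})"
    if s: "s \<in> {0..l}" for s
  proof -
    have *: "D t - part' k f t = (D 0 - part' k f 0) + prim (\<lambda>t. - k\<^sup>2 *\<^sub>R (\<psi> t - part k f t)) t"
      if t: "t \<in> {0..l}" for t
    proof -
      have sub: "g integrable_on {0..t}" if "g integrable_on {0..l}" for g :: "real \<Rightarrow> complex"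
        using that t by (auto intro: integrable_on_subinterval)
      have pi: "(\<lambda>t. - f t - k\<^sup>2 *\<^sub>R part k f t) integrable_on {0..t}"
        by (intro sub H2_dataD(3)[OF p])
      have "D t - part' k f t = D 0 + integral {0..t} u - (part' k f 0 + integral {0..t} (\<lambda>t. - f t - k\<^sup>2 *\<^sub>R part k f t))"
        using H2_dataD(4)[OF assms(1) t] H2_dataD(4)[OF p t] by simp
      also have "\<dots> = (D 0 - part' k f 0) + integral {0..t} (\<lambda>s. u s - (- f s - k\<^sup>2 *\<^sub>R part k f s))"
        using integral_diff[OF sub[OF u] pi] by simp
      finally show ?thesis by (simp add: prim_def f_def algebra_simps)
    qed
    have "((\<lambda>t. (D 0 - part' k f 0) + prim (\<lambda>t. - k\<^sup>2 *\<^sub>R (\<psi> t - part k f t)) t)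
        has_vector_derivative - k\<^sup>2 *\<^sub>R (\<psi> s - part k f s)) (at s within {0..l})"
      by (auto intro!: derivative_eq_intros prim_deriv continuous_intros c cp s)
    then show ?thesis by (rule has_vector_derivative_transform[OF s *, rotated])
  qed
  moreover have "((\<lambda>t. \<psi> t - part k f t) has_vector_derivative D s - part' k f s) (at s within {0..l})"
    if "s \<in> {0..l}" for s
    using that by (intro derivative_intros H2_dataD(2)[OF assms(1)] H2_dataD(2)[OF p])
  ultimately have "\<psi> t - part k f t = cs k t *\<^sub>R (\<psi> 0 - part k f 0) + sn k t *\<^sub>R (D 0 - part' k f 0)"
    "D t - part' k f t = cs k t *\<^sub>R (D 0 - part' k f 0) - (k\<^sup>2 * sn k t) *\<^sub>R (\<psi> 0 - part k f 0)"
    using harmonic_unique[of l "\<lambda>t. \<psi> t - part k f t" "\<lambda>t. D t - part' k f t" k t] t by blast+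
  then show "\<psi> t = cs k t *\<^sub>R \<psi> 0 + sn k t *\<^sub>R D 0 + part k f t"
    "D t = cs k t *\<^sub>R D 0 - (k\<^sup>2 * sn k t) *\<^sub>R \<psi> 0 + part' k f t"
    by (auto simp: algebra_simps)
qed

lemma part_bound:
  assumes f: "f absolutely_integrable_on {0..l}" and t: "t \<in> {0..l}"
  defines "I \<equiv> integral {0..l} (\<lambda>s. cmod (f s))"
  shows "cmod (part k f t) \<le> (l + 2 * k\<^sup>2 * l ^ 3) * I"
    and "cmod (part' k f t) \<le> (1 + k\<^sup>2 * l\<^sup>2 + k ^ 4 * l ^ 4) * I"
proof -
  have l: "0 \<le> l" using t by simp
  have fi: "f integrable_on {0..l}" "(\<lambda>s. cmod (f s)) integrable_on {0..l}"
    using f by (auto simp: absolutely_integrable_on_def)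
  have I: "0 \<le> I" unfolding I_def by (intro integral_nonneg fi) auto
  have b1: "cmod (prim f s) \<le> I" if s: "s \<in> {0..l}" for s
  proof -
    have sub: "f integrable_on {0..s}" "(\<lambda>s. cmod (f s)) integrable_on {0..s}"
      using fi s by (auto intro: integrable_on_subinterval)
    have "cmod (prim f s) \<le> integral {0..s} (\<lambda>s. cmod (f s))"
      unfolding prim_def by (intro integral_norm_bound_integral sub) auto
    also have "\<dots> \<le> I" unfolding I_def using s by (intro integral_subset_le sub fi) auto
    finally show ?thesis .
  qed
  have gen: "cmod (prim g s) \<le> B * l" if "continuous_on {0..l} g" "\<And>s. s \<in> {0..l} \<Longrightarrow> cmod (g s) \<le> B" "s \<in> {0..l}" for g s B
  proof -
    have "cmod (prim g s) \<le> B * (s - 0)"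
      unfolding prim_def using that
      by (intro integral_bound continuous_on_subset[OF that(1)]) auto
    also have "\<dots> \<le> B * l"
      using that(3) order.trans[OF norm_ge_zero that(2)[OF that(3)]] by (intro mult_left_mono) auto
    finally show ?thesis .
  qed
  have c1: "continuous_on {0..l} (prim f)" by (rule prim_continuous) (rule fi)
  have c2: "continuous_on {0..l} (prim (prim f))"
    by (intro prim_continuous integrable_continuous_interval c1)
  have b2: "cmod (prim (prim f) s) \<le> I * l" if "s \<in> {0..l}" for s
    using c1 b1 that by (rule gen)
  have b3: "cmod (prim (\<lambda>s. cs k s *\<^sub>R prim (prim f) s) t) \<le> (I * l) * l"
  proof (rule gen[OF _ _ t])
    show "continuous_on {0..l} (\<lambda>s. cs k s *\<^sub>R prim (prim f) s)" by (intro continuous_intros c2)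
    fix s assume "s \<in> {0..l}"
    then have "\<bar>cs k s\<bar> * cmod (prim (prim f) s) \<le> 1 * (I * l)"
      by (intro mult_mono abs_cs_le b2) auto
    then show "cmod (cs k s *\<^sub>R prim (prim f) s) \<le> I * l" by simp
  qed
  have snl: "\<bar>sn k s\<bar> \<le> l" if "s \<in> {0..l}" for s using abs_sn_le[of k s] that by simp
  have b4: "cmod (prim (\<lambda>s. sn k s *\<^sub>R prim (prim f) s) t) \<le> (l * (I * l)) * l"
  proof (rule gen[OF _ _ t])
    show "continuous_on {0..l} (\<lambda>s. sn k s *\<^sub>R prim (prim f) s)" by (intro continuous_intros c2)
    fix s assume s: "s \<in> {0..l}"
    then have "\<bar>sn k s\<bar> * cmod (prim (prim f) s) \<le> l * (I * l)"
      using l by (intro mult_mono snl b2) auto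
    then show "cmod (sn k s *\<^sub>R prim (prim f) s) \<le> l * (I * l)" by simp
  qed
  have "cmod (part k f t) \<le> k\<^sup>2 * (\<bar>sn k t\<bar> * cmod (prim (\<lambda>s. cs k s *\<^sub>R prim (prim f) s) t)
     + \<bar>cs k t\<bar> * cmod (prim (\<lambda>s. sn k s *\<^sub>R prim (prim f) s) t)) + cmod (prim (prim f) t)"
    unfolding part_def
    by (rule order.trans[OF norm_triangle_ineq4])
       (auto intro!: mult_left_mono order.trans[OF norm_triangle_ineq4])
  also have "\<dots> \<le> k\<^sup>2 * (l * ((I * l) * l) + 1 * ((l * (I * l)) * l)) + I * l"
    using l by (intro add_mono mult_left_mono mult_mono b3 b4 snl t abs_cs_le b2) auto
  finally show "cmod (part k f t) \<le> (l + 2 * k\<^sup>2 * l ^ 3) * I"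
    by (simp add: algebra_simps power2_eq_square power3_eq_cube)
  have "cmod (part' k f t) \<le> k\<^sup>2 * (\<bar>cs k t\<bar> * cmod (prim (\<lambda>s. cs k s *\<^sub>R prim (prim f) s) t)
     + k\<^sup>2 * (\<bar>sn k t\<bar> * cmod (prim (\<lambda>s. sn k s *\<^sub>R prim (prim f) s) t))) + cmod (prim f t)"
    unfolding part'_def
    by (rule order.trans[OF norm_triangle_ineq4])
       (auto intro!: mult_left_mono order.trans[OF norm_triangle_ineq] simp: abs_mult mult.assoc)
  also have "\<dots> \<le> k\<^sup>2 * (1 * ((I * l) * l) + k\<^sup>2 * (l * ((l * (I * l)) * l))) + I"
    using l by (intro add_mono mult_left_mono mult_mono b3 b4 snl t abs_cs_le b1) auto
  finally show "cmod (part' k f t) \<le> (1 + k\<^sup>2 * l\<^sup>2 + k ^ 4 * l ^ 4) * I"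
    by (simp add: algebra_simps power2_eq_square power4_eq_xxxx)
qed

text \<open>The trace estimate comes from integrating the derivative of \<open>(l - t) sn k t \<phi> t\<close>, using that
  the Wronskian \<open>cs k t \<phi> t - sn k t \<phi>' t = \<phi> 0\<close> is constant.\<close>
lemma harmonic_trace:
  fixes k :: real and A B :: complex
  assumes l: "0 < l"
  defines "\<phi> \<equiv> \<lambda>t. cs k t *\<^sub>R A + sn k t *\<^sub>R B"
  shows "l * cmod A \<le> 6 * integral {0..l} (\<lambda>t. cmod (\<phi> t))"
proof -
  define \<phi>' where "\<phi>' t = cs k t *\<^sub>R B - (k\<^sup>2 * sn k t) *\<^sub>R A" for t
  have d1: "(\<phi> has_vector_derivative \<phi>' t) (at t within {0..l})" if "t \<in> {0..l}" for t
    using H2_dataD(2)[OF H2_data_homogeneous that] by (simp add: \<phi>_def \<phi>'_def)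
  have c: "continuous_on {0..l} \<phi>" unfolding \<phi>_def by (intro continuous_intros)
  have W: "cs k t *\<^sub>R \<phi> t - sn k t *\<^sub>R \<phi>' t = A" for t
  proof -
    have "cs k t *\<^sub>R \<phi> t - sn k t *\<^sub>R \<phi>' t = ((cs k t)\<^sup>2 + k\<^sup>2 * (sn k t)\<^sup>2) *\<^sub>R A"
      by (simp add: \<phi>_def \<phi>'_def algebra_simps power2_eq_square)
    then show ?thesis by (simp add: cs_sn)
  qed
  define g where "g t = (2 * (l - t) * cs k t - sn k t) *\<^sub>R \<phi> t" for t
  have lin: "((\<lambda>t. (l - t) * sn k t) has_real_derivative (l - t) * cs k t - sn k t) (at t within {0..l})" for t
    by (auto intro!: derivative_eq_intros sn_deriv)
  have "((\<lambda>t. ((l - t) * sn k t) *\<^sub>R \<phi> t + (l * t - t\<^sup>2 / 2) *\<^sub>R A) has_vector_derivative g t) (at t within {0..l})"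
    if "t \<in> {0..l}" for t
  proof -
    have "((\<lambda>t. ((l - t) * sn k t) *\<^sub>R \<phi> t + (l * t - t\<^sup>2 / 2) *\<^sub>R A) has_vector_derivative
        (((l - t) * sn k t) *\<^sub>R \<phi>' t + ((l - t) * cs k t - sn k t) *\<^sub>R \<phi> t) + (l - t) *\<^sub>R A) (at t within {0..l})"
      using that
      by (intro has_vector_derivative_add has_vector_derivative_scaleR[OF lin d1])
         (auto intro!: derivative_eq_intros)
    also have "(((l - t) * sn k t) *\<^sub>R \<phi>' t + ((l - t) * cs k t - sn k t) *\<^sub>R \<phi> t) + (l - t) *\<^sub>R A = g t"
      unfolding W[of t, symmetric] g_def by (simp add: scaleR_conv_of_real algebra_simps)
    finally show ?thesis .
  qed
  from fundamental_theorem_of_calculus[OF less_imp_le[OF l] this]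
  have "integral {0..l} g = (l\<^sup>2 / 2) *\<^sub>R A"
    by (intro integral_unique) (simp_all add: power2_eq_square field_simps)
  then have "(l\<^sup>2 / 2) * cmod A = cmod (integral {0..l} g)" by simp
  also have "\<dots> \<le> integral {0..l} (\<lambda>t. (3 * l) * cmod (\<phi> t))"
  proof (rule integral_norm_bound_integral)
    show "g integrable_on {0..l}" unfolding g_def
      by (intro integrable_continuous_interval continuous_intros c)
    show "(\<lambda>t. 3 * l * cmod (\<phi> t)) integrable_on {0..l}"
      by (intro integrable_continuous_interval continuous_intros c)
    fix t assume t: "t \<in> {0..l}"
    have "\<bar>(l - t) * cs k t\<bar> \<le> l * 1" unfolding abs_mult using t abs_cs_le[of k t] by (intro mult_mono) auto
    moreover have "\<bar>sn k t\<bar> \<le> l" using abs_sn_le[of k t] t by simp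
    ultimately have "\<bar>2 * (l - t) * cs k t - sn k t\<bar> \<le> 3 * l" by linarith
    then show "cmod (g t) \<le> 3 * l * cmod (\<phi> t)" unfolding g_def by (auto intro!: mult_right_mono)
  qed
  also have "\<dots> = 3 * l * integral {0..l} (\<lambda>t. cmod (\<phi> t))" by simp
  finally show ?thesis using l by (simp add: power2_eq_square)
qed

section \<open>Square-integrable functions on an edge\<close>

definition en :: "real \<Rightarrow> (real \<Rightarrow> complex) \<Rightarrow> ennreal" where
  "en l f = (\<integral>\<^sup>+ t\<in>{0..l}. ennreal ((cmod (f t))\<^sup>2) \<partial>lebesgue)"

abbreviation "edge_meas l f \<equiv> set_borel_measurable lebesgue {0..l::real} (f :: real \<Rightarrow> complex)"

lemma en_indicator: "en l f = (\<integral>\<^sup>+ t. ennreal ((cmod (indicator {0..l} t *\<^sub>R f t))\<^sup>2) \<partial>lebesgue)"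
  unfolding en_def by (intro nn_integral_cong) (auto simp: indicator_def)

lemma en_cong: "(\<And>t. t \<in> {0..l} \<Longrightarrow> f t = g t) \<Longrightarrow> en l f = en l g"
  unfolding en_def by (intro nn_integral_cong) (auto simp: indicator_def)

lemma square_sum_le: "(a + b)\<^sup>2 \<le> 2 * a\<^sup>2 + 2 * (b :: real)\<^sup>2"
  using zero_le_power2[of "a - b"] by (simp add: power2_diff power2_sum)

lemma edge_meas_add: "edge_meas l f \<Longrightarrow> edge_meas l g \<Longrightarrow> edge_meas l (\<lambda>t. f t + g t)"
  unfolding set_borel_measurable_def scaleR_add_right by (rule borel_measurable_add)

lemma edge_meas_scale: "edge_meas l f \<Longrightarrow> edge_meas l (\<lambda>t. r *\<^sub>R f t)"
  using borel_measurable_scaleR[of "\<lambda>_. r" lebesgue "\<lambda>t. indicator {0..l} t *\<^sub>R f t"]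
  unfolding set_borel_measurable_def by (simp add: mult.commute)

lemma edge_meas_continuous:
  assumes "continuous_on {0..l} f" shows "edge_meas l f"
proof -
  have "(\<lambda>t. indicator {0..l} t *\<^sub>R f t) \<in> borel_measurable lborel"
    using borel_measurable_continuous_on_indicator[OF _ assms] by simp
  then show ?thesis unfolding set_borel_measurable_def by (rule measurable_completion)
qed

lemma en_add:
  assumes "edge_meas l f" "edge_meas l g"
  shows "en l (\<lambda>t. f t + g t) \<le> 2 * en l f + 2 * en l g"
proof -
  have m: "(\<lambda>t. ennreal ((cmod (indicator {0..l} t *\<^sub>R f t))\<^sup>2)) \<in> borel_measurable lebesgue"
    if "edge_meas l f" for f using that unfolding set_borel_measurable_def by measurable
  have "en l (\<lambda>t. f t + g t) \<le> (\<integral>\<^sup>+ t. 2 * ennreal ((cmod (indicator {0..l} t *\<^sub>R f t))\<^sup>2)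
      + 2 * ennreal ((cmod (indicator {0..l} t *\<^sub>R g t))\<^sup>2) \<partial>lebesgue)"
    unfolding en_indicator
  proof (intro nn_integral_mono)
    fix t
    have "(cmod (indicator {0..l} t *\<^sub>R (f t + g t)))\<^sup>2
        \<le> (cmod (indicator {0..l} t *\<^sub>R f t) + cmod (indicator {0..l} t *\<^sub>R g t))\<^sup>2"
      unfolding scaleR_add_right by (intro power_mono norm_triangle_ineq) auto
    also note square_sum_le
    finally have "ennreal ((cmod (indicator {0..l} t *\<^sub>R (f t + g t)))\<^sup>2)
        \<le> ennreal (2 * (cmod (indicator {0..l} t *\<^sub>R f t))\<^sup>2 + 2 * (cmod (indicator {0..l} t *\<^sub>R g t))\<^sup>2)"
      by (rule ennreal_leI)
    then show "ennreal ((cmod (indicator {0..l} t *\<^sub>R (f t + g t)))\<^sup>2)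
        \<le> 2 * ennreal ((cmod (indicator {0..l} t *\<^sub>R f t))\<^sup>2) + 2 * ennreal ((cmod (indicator {0..l} t *\<^sub>R g t))\<^sup>2)"
      by (simp add: ennreal_plus ennreal_mult)
  qed
  also have "\<dots> = 2 * en l f + 2 * en l g"
    unfolding en_indicator using m[OF assms(1)] m[OF assms(2)]
    by (simp add: nn_integral_add nn_integral_cmult)
  finally show ?thesis .
qed

lemma en_scale:
  assumes "edge_meas l f" shows "en l (\<lambda>t. r *\<^sub>R f t) = ennreal (r\<^sup>2) * en l f"
proof -
  have "(\<lambda>t. ennreal ((cmod (indicator {0..l} t *\<^sub>R f t))\<^sup>2)) \<in> borel_measurable lebesgue"
    using assms unfolding set_borel_measurable_def by measurable
  then have "ennreal (r\<^sup>2) * en l f = (\<integral>\<^sup>+ t. ennreal (r\<^sup>2) * ennreal ((cmod (indicator {0..l} t *\<^sub>R f t))\<^sup>2) \<partial>lebesgue)"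
    unfolding en_indicator by (simp add: nn_integral_cmult)
  also have "\<dots> = en l (\<lambda>t. r *\<^sub>R f t)"
    unfolding en_indicator
    by (intro nn_integral_cong) (simp add: ennreal_mult[symmetric] power_mult_distrib mult_ac)
  finally show ?thesis ..
qed

lemma en_bound:
  assumes "\<And>t. t \<in> {0..l} \<Longrightarrow> ennreal ((cmod (f t))\<^sup>2) \<le> B" and l: "0 \<le> l"
  shows "en l f \<le> B * ennreal l"
proof -
  have "en l f \<le> (\<integral>\<^sup>+ t. B * indicator {0..l} t \<partial>lebesgue)"
    unfolding en_def using assms by (intro nn_integral_mono) (auto simp: indicator_def)
  also have "\<dots> = B * ennreal l" using l by (simp add: nn_integral_cmult_indicator)
  finally show ?thesis .
qed

text \<open>Cauchy-Schwarz against the indicator of the edge.\<close>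

lemma L2_imp_L1:
  assumes m: "edge_meas l f" and fin: "en l f < \<infinity>" and l: "0 \<le> l"
  shows "f absolutely_integrable_on {0..l}"
    and "ennreal ((integral {0..l} (\<lambda>t. cmod (f t)))\<^sup>2) \<le> ennreal l * en l f"
proof -
  define g where "g t = indicator {0..l} t *\<^sub>R f t" for t
  have [measurable]: "g \<in> borel_measurable lebesgue"
    using m unfolding set_borel_measurable_def g_def by simp
  have [measurable]: "(indicator {0..l} :: real \<Rightarrow> ennreal) \<in> borel_measurable lebesgue"
    by (intro borel_measurable_indicator) auto
  have ind: "(\<integral>\<^sup>+ t. (indicator {0..l} t)\<^sup>2 \<partial>lebesgue) = ennreal l"
  proof -
    have "(\<integral>\<^sup>+ t. (indicator {0..l} t)\<^sup>2 \<partial>lebesgue) = (\<integral>\<^sup>+ t. indicator {0..l} t \<partial>lebesgue)"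
      by (intro nn_integral_cong) (auto simp: indicator_def)
    then show ?thesis using l by simp
  qed
  have "(\<integral>\<^sup>+ t. ennreal (cmod (g t)) * indicator {0..l} t \<partial>lebesgue)\<^sup>2
      \<le> (\<integral>\<^sup>+ t. (ennreal (cmod (g t)))\<^sup>2 \<partial>lebesgue) * (\<integral>\<^sup>+ t. (indicator {0..l} t)\<^sup>2 \<partial>lebesgue)"
    by (rule Cauchy_Schwarz_nn_integral) measurable
  also have "(\<integral>\<^sup>+ t. (ennreal (cmod (g t)))\<^sup>2 \<partial>lebesgue) = en l f"
    unfolding en_indicator g_def by (simp add: ennreal_power)
  also have "(\<integral>\<^sup>+ t. ennreal (cmod (g t)) * indicator {0..l} t \<partial>lebesgue) = (\<integral>\<^sup>+ t. ennreal (cmod (g t)) \<partial>lebesgue)"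
    by (intro nn_integral_cong) (auto simp: g_def indicator_def)
  finally have CS: "(\<integral>\<^sup>+ t. ennreal (cmod (g t)) \<partial>lebesgue)\<^sup>2 \<le> en l f * ennreal l" unfolding ind .
  also have "\<dots> < \<infinity>" using fin by (simp add: ennreal_mult_less_top)
  finally have "(\<integral>\<^sup>+ t. ennreal (cmod (g t)) \<partial>lebesgue) < \<infinity>"
    by (auto simp: power2_eq_square less_top[symmetric])
  then have gi: "integrable lebesgue g" by (intro integrableI_bounded) auto
  then show fi: "f absolutely_integrable_on {0..l}" by (simp add: set_integrable_def g_def[abs_def])
  have "(\<integral>\<^sup>+ t. ennreal (cmod (g t)) \<partial>lebesgue) = ennreal (LINT t|lebesgue. cmod (g t))"
    by (intro nn_integral_eq_integral integrable_norm gi) auto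
  also have "(LINT t|lebesgue. cmod (g t)) = (LINT t:{0..l}|lebesgue. cmod (f t))"
    unfolding set_lebesgue_integral_def by (intro Bochner_Integration.integral_cong) (auto simp: g_def)
  also have "\<dots> = integral {0..l} (\<lambda>t. cmod (f t))"
    by (rule set_lebesgue_integral_eq_integral) (rule set_integrable_norm[OF fi])
  finally have eq: "(\<integral>\<^sup>+ t. ennreal (cmod (g t)) \<partial>lebesgue) = ennreal (integral {0..l} (\<lambda>t. cmod (f t)))" .
  have "0 \<le> integral {0..l} (\<lambda>t. cmod (f t))"
    using fi by (intro integral_nonneg) (auto simp: absolutely_integrable_on_def)
  then show "ennreal ((integral {0..l} (\<lambda>t. cmod (f t)))\<^sup>2) \<le> ennreal l * en l f"
    using CS unfolding eq by (simp add: ennreal_power mult.commute)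
qed

text \<open>The sum of the two constants of \<open>part_bound\<close>, so that one constant serves
  the value and the derivative.\<close>

definition part_const :: "real \<Rightarrow> real \<Rightarrow> real" where
  "part_const k l = 1 + l + 2 * k\<^sup>2 * l ^ 3 + k\<^sup>2 * l\<^sup>2 + k ^ 4 * l ^ 4"

lemma part_L2:
  assumes m: "edge_meas l f" and fin: "en l f < \<infinity>" and t: "t \<in> {0..l}"
  shows "ennreal ((cmod (part k f t))\<^sup>2) \<le> ennreal ((part_const k l)\<^sup>2 * l) * en l f"
    and "ennreal ((cmod (part' k f t))\<^sup>2) \<le> ennreal ((part_const k l)\<^sup>2 * l) * en l f"
proof -
  have l: "0 \<le> l" using t by simp
  note L = L2_imp_L1[OF m fin l]
  define I where "I = integral {0..l} (\<lambda>s. cmod (f s))"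
  have I: "0 \<le> I" unfolding I_def
    using L(1) by (intro integral_nonneg) (auto simp: absolutely_integrable_on_def)
  have *: "ennreal (x\<^sup>2) \<le> ennreal ((part_const k l)\<^sup>2 * l) * en l f"
    if "x \<le> K * I" "0 \<le> x" "K \<le> part_const k l" for x K
  proof -
    have "x \<le> part_const k l * I" using that I by (meson mult_right_mono order.trans)
    then have "x\<^sup>2 \<le> (part_const k l * I)\<^sup>2" using that by (intro power_mono) auto
    then have "ennreal (x\<^sup>2) \<le> ennreal ((part_const k l)\<^sup>2) * ennreal (I\<^sup>2)"
      by (simp add: ennreal_mult[symmetric] power_mult_distrib ennreal_leI)
    also have "\<dots> \<le> ennreal ((part_const k l)\<^sup>2) * (ennreal l * en l f)"
      using L(2) unfolding I_def by (intro mult_left_mono) auto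
    finally show ?thesis using l by (simp add: ennreal_mult mult.assoc)
  qed
  note b = part_bound[OF L(1) t, of k, folded I_def]
  show "ennreal ((cmod (part k f t))\<^sup>2) \<le> ennreal ((part_const k l)\<^sup>2 * l) * en l f"
    using l by (intro *[OF b(1)]) (auto simp: part_const_def)
  show "ennreal ((cmod (part' k f t))\<^sup>2) \<le> ennreal ((part_const k l)\<^sup>2 * l) * en l f"
    using l by (intro *[OF b(2)]) (auto simp: part_const_def)
qed

text \<open>\<open>harmonic_trace\<close> is applied to \<open>\<psi>\<close> minus its particular
  solution, and integrals are turned into square norms by Cauchy-Schwarz; the constant is
  \<open>72 = 2 * 6\<^sup>2\<close>. The lemma ensures that the vertex values of a function in the
  domain are square summable.\<close>

lemma H2_data_trace:
  fixes k l :: real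
  assumes H: "H2_data l \<psi> D u" and l: "0 < l"
  defines "f \<equiv> \<lambda>t. - u t - k\<^sup>2 *\<^sub>R \<psi> t"
  assumes mf: "edge_meas l f" and finf: "en l f < \<infinity>" and fin: "en l \<psi> < \<infinity>"
  shows "ennreal ((cmod (\<psi> 0))\<^sup>2)
    \<le> ennreal (72 / l) * en l \<psi> + ennreal (72 * (part_const k l)\<^sup>2 * l) * en l f"
proof -
  have c: "continuous_on {0..l} \<psi>" using H by (rule H2_data_continuous)
  have fint: "f integrable_on {0..l}" unfolding f_def
    by (intro integrable_diff integrable_neg H2_dataD(3)[OF H] integrable_continuous_interval continuous_intros c)
  have cp: "continuous_on {0..l} (part k f)"
    using H2_data_part[OF fint less_imp_le[OF l]] by (rule H2_data_continuous)
  note L\<psi> = L2_imp_L1[OF edge_meas_continuous[OF c] fin less_imp_le[OF l]]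
  note Lf = L2_imp_L1[OF mf finf less_imp_le[OF l]]
  define I where "I = integral {0..l} (\<lambda>s. cmod (f s))"
  define J where "J = integral {0..l} (\<lambda>s. cmod (\<psi> s))"
  have I: "0 \<le> I" unfolding I_def
    using Lf(1) by (intro integral_nonneg) (auto simp: absolutely_integrable_on_def)
  have J: "0 \<le> J" unfolding J_def
    using L\<psi>(1) by (intro integral_nonneg) (auto simp: absolutely_integrable_on_def)
  define p where "p = part_const k l"
  have p: "0 \<le> p" using l by (simp add: p_def part_const_def)
  have "l * cmod (\<psi> 0) \<le> 6 * integral {0..l} (\<lambda>t. cmod (cs k t *\<^sub>R \<psi> 0 + sn k t *\<^sub>R D 0))"
    using l by (rule harmonic_trace)
  also have "integral {0..l} (\<lambda>t. cmod (cs k t *\<^sub>R \<psi> 0 + sn k t *\<^sub>R D 0)) = integral {0..l} (\<lambda>t. cmod (\<psi> t - part k f t))"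
  proof (rule integral_cong)
    fix t assume t: "t \<in> {0..l}"
    show "cmod (cs k t *\<^sub>R \<psi> 0 + sn k t *\<^sub>R D 0) = cmod (\<psi> t - part k f t)"
      using edge_solution(1)[OF H less_imp_le[OF l] t, of k] by (simp add: f_def)
  qed
  also have "\<dots> \<le> integral {0..l} (\<lambda>t. cmod (\<psi> t) + p * I)"
  proof (rule integral_le)
    show "(\<lambda>t. cmod (\<psi> t - part k f t)) integrable_on {0..l}"
      "(\<lambda>t. cmod (\<psi> t) + p * I) integrable_on {0..l}"
      by (intro integrable_continuous_interval continuous_intros c cp)+
    fix t assume t: "t \<in> {0..l}"
    have "cmod (part k f t) \<le> (l + 2 * k\<^sup>2 * l ^ 3) * I"
      unfolding I_def by (rule part_bound(1)[OF Lf(1) t])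
    also have "\<dots> \<le> p * I" using I l by (intro mult_right_mono) (auto simp: p_def part_const_def)
    finally show "cmod (\<psi> t - part k f t) \<le> cmod (\<psi> t) + p * I"
      using norm_triangle_ineq4[of "\<psi> t" "part k f t"] by linarith
  qed
  also have "\<dots> = J + l * (p * I)"
    unfolding J_def using l
    by (subst integral_add) (auto intro!: integrable_continuous_interval continuous_intros c)
  finally have "l * cmod (\<psi> 0) \<le> 6 * (J + l * (p * I))" by simp
  then have "(l * cmod (\<psi> 0))\<^sup>2 \<le> (6 * (J + l * (p * I)))\<^sup>2" using l by (intro power_mono) auto
  also have "\<dots> \<le> 36 * (2 * J\<^sup>2 + 2 * (l * (p * I))\<^sup>2)"
    using square_sum_le[of J "l * (p * I)"] by (simp only: power_mult_distrib[of 6]) simp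
  finally have "(cmod (\<psi> 0))\<^sup>2 \<le> 72 / l\<^sup>2 * J\<^sup>2 + 72 * p\<^sup>2 * I\<^sup>2"
    using l by (simp add: field_simps power_mult_distrib)
  then have "ennreal ((cmod (\<psi> 0))\<^sup>2) \<le> ennreal (72 / l\<^sup>2) * ennreal (J\<^sup>2) + ennreal (72 * p\<^sup>2) * ennreal (I\<^sup>2)"
    by (simp add: ennreal_mult[symmetric] ennreal_plus[symmetric] ennreal_leI del: ennreal_plus)
  also have "\<dots> \<le> ennreal (72 / l\<^sup>2) * (ennreal l * en l \<psi>) + ennreal (72 * p\<^sup>2) * (ennreal l * en l f)"
    using L\<psi>(2) Lf(2) unfolding I_def J_def by (intro add_mono mult_left_mono) auto
  also have "\<dots> = ennreal (72 / l) * en l \<psi> + ennreal (72 * p\<^sup>2 * l) * en l f"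
    using l by (simp add: mult.assoc[symmetric] ennreal_mult[symmetric] power2_eq_square)
  finally show ?thesis unfolding p_def .
qed

text \<open>The end value determines the initial slope \<open>B\<close> after division by
  \<open>sn k l\<close>, and \<open>\<bar>sn k t\<bar> \<le> l\<close> then bounds the whole
  function by the two end values and the particular solution. The 3 in \<open>K\<close> comes from
  squaring a sum of three terms.\<close>

lemma edge_energy:
  fixes k l :: real
  assumes rep: "\<And>t. t \<in> {0..l} \<Longrightarrow> \<psi> t = cs k t *\<^sub>R A + sn k t *\<^sub>R B + part k f t"
    and endval: "\<psi> l = b" and s: "sn k l \<noteq> 0" and l: "0 < l"
    and mf: "edge_meas l f" and finf: "en l f < \<infinity>"
  defines "K \<equiv> 3 * (1 + l / \<bar>sn k l\<bar>)\<^sup>2"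
  shows "en l \<psi> \<le> ennreal (K * l) * (ennreal ((cmod A)\<^sup>2) + ennreal ((cmod b)\<^sup>2)
    + 4 * (ennreal ((part_const k l)\<^sup>2 * l) * en l f))"
proof -
  define M where "M = ennreal ((part_const k l)\<^sup>2 * l) * en l f"
  define s' where "s' = \<bar>sn k l\<bar>"
  have s': "s' > 0" using s by (simp add: s'_def)
  have "sn k l *\<^sub>R B = b - cs k l *\<^sub>R A - part k f l" using rep[of l] l endval by simp
  then have "B = (1 / sn k l) *\<^sub>R (b - cs k l *\<^sub>R A - part k f l)" using s
    by (metis divideR_right divide_inverse mult_1 )
  then have "cmod B = cmod (b - cs k l *\<^sub>R A - part k f l) / s'" by (simp add: s'_def)
  also have "\<dots> \<le> (cmod b + cmod A + cmod (part k f l)) / s'"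
  proof (intro divide_right_mono)
    have "cmod (cs k l *\<^sub>R A) \<le> cmod A" using abs_cs_le[of k l] by (simp add: mult_left_le_one_le)
    then show "cmod (b - cs k l *\<^sub>R A - part k f l) \<le> cmod b + cmod A + cmod (part k f l)"
      using norm_triangle_ineq4[of "b - cs k l *\<^sub>R A" "part k f l"] norm_triangle_ineq4[of b "cs k l *\<^sub>R A"]
      by linarith
  qed (use s' in auto)
  finally have B: "cmod B \<le> (cmod b + cmod A + cmod (part k f l)) / s'" .
  define r where "r = 1 + l / s'"
  have r1: "1 \<le> r" using l s' by (simp add: r_def)
  have lr: "l / s' \<le> r" by (simp add: r_def)
  have "ennreal ((cmod (\<psi> t))\<^sup>2) \<le> ennreal K * (ennreal ((cmod A)\<^sup>2) + ennreal ((cmod b)\<^sup>2) + 4 * M)"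
    if t: "t \<in> {0..l}" for t
  proof -
    define x where "x = cmod (part k f t) + cmod (part k f l)"
    have "cmod (\<psi> t) \<le> cmod (cs k t *\<^sub>R A) + cmod (sn k t *\<^sub>R B) + cmod (part k f t)"
      unfolding rep[OF t] by (intro order.trans[OF norm_triangle_ineq] add_mono norm_triangle_ineq order_refl)
    also have "cmod (cs k t *\<^sub>R A) \<le> cmod A" using abs_cs_le[of k t] by (simp add: mult_left_le_one_le)
    also have "cmod (sn k t *\<^sub>R B) \<le> l * ((cmod b + cmod A + cmod (part k f l)) / s')"
      unfolding norm_scaleR using t abs_sn_le[of k t] B by (intro mult_mono) auto
    finally have "cmod (\<psi> t) \<le> cmod A + (l / s') * (cmod b + cmod A + cmod (part k f l)) + cmod (part k f t)"
      by simp
    also have "\<dots> \<le> r * cmod A + (l / s') * cmod b + (l / s') * cmod (part k f l) + 1 * cmod (part k f t)"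
      by (simp add: r_def algebra_simps)
    also have "\<dots> \<le> r * cmod A + r * cmod b + r * cmod (part k f l) + r * cmod (part k f t)"
      using r1 lr by (intro add_mono mult_right_mono) auto
    also have "\<dots> = r * (cmod A + cmod b + x)" by (simp add: x_def algebra_simps)
    finally have "(cmod (\<psi> t))\<^sup>2 \<le> (r * (cmod A + cmod b + x))\<^sup>2" by (intro power_mono) auto
    also have "\<dots> = r\<^sup>2 * (cmod A + cmod b + x)\<^sup>2" by (simp add: power_mult_distrib)
    also have "\<dots> \<le> r\<^sup>2 * (3 * ((cmod A)\<^sup>2 + (cmod b)\<^sup>2 + x\<^sup>2))"
    proof (intro mult_left_mono)
      have "3 * (a\<^sup>2 + b\<^sup>2 + c\<^sup>2) - (a + b + c)\<^sup>2 = (a - b)\<^sup>2 + (b - c)\<^sup>2 + (a - c)\<^sup>2" for a b c :: real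
        by (simp add: power2_eq_square algebra_simps)
      then show "(cmod A + cmod b + x)\<^sup>2 \<le> 3 * ((cmod A)\<^sup>2 + (cmod b)\<^sup>2 + x\<^sup>2)"
        using zero_le_power2[of "cmod A - cmod b"] zero_le_power2[of "cmod b - x"] zero_le_power2[of "cmod A - x"]
        by (metis add_nonneg_nonneg diff_ge_0_iff_ge)
    qed auto
    also have "\<dots> = K * ((cmod A)\<^sup>2 + (cmod b)\<^sup>2 + x\<^sup>2)" by (simp add: K_def r_def s'_def)
    also have "\<dots> \<le> K * ((cmod A)\<^sup>2 + (cmod b)\<^sup>2 + (2 * (cmod (part k f t))\<^sup>2 + 2 * (cmod (part k f l))\<^sup>2))"
      using square_sum_le[of "cmod (part k f t)" "cmod (part k f l)"]
      unfolding x_def by (intro mult_left_mono add_left_mono) (auto simp: K_def)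
    finally have "ennreal ((cmod (\<psi> t))\<^sup>2) \<le> ennreal K * (ennreal ((cmod A)\<^sup>2) + ennreal ((cmod b)\<^sup>2)
        + (2 * ennreal ((cmod (part k f t))\<^sup>2) + 2 * ennreal ((cmod (part k f l))\<^sup>2)))"
      by (subst (asm) ennreal_le_iff[symmetric]) (auto simp: K_def ennreal_mult ennreal_plus)
    also have "\<dots> \<le> ennreal K * (ennreal ((cmod A)\<^sup>2) + ennreal ((cmod b)\<^sup>2) + (2 * M + 2 * M))"
      unfolding M_def using l t
      by (intro mult_left_mono add_mono order_refl part_L2(1)[OF mf finf]) auto
    also have "2 * M + 2 * M = 4 * M" by (simp flip: distrib_right)
    finally show ?thesis .
  qed
  then have "en l \<psi> \<le> ennreal K * (ennreal ((cmod A)\<^sup>2) + ennreal ((cmod b)\<^sup>2) + 4 * M) * ennreal l"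
    using l by (intro en_bound) auto
  also have "\<dots> = ennreal (K * l) * (ennreal ((cmod A)\<^sup>2) + ennreal ((cmod b)\<^sup>2) + 4 * M)"
    using l by (simp add: ennreal_mult K_def mult_ac)
  finally show ?thesis unfolding M_def .
qed

section \<open>Difference equations on the lattice\<close>

abbreviation succ_v :: "(nat \<Rightarrow> int) \<Rightarrow> nat \<Rightarrow> nat \<Rightarrow> int" where "succ_v v j \<equiv> v(j := v j + 1)"
abbreviation pred_v :: "(nat \<Rightarrow> int) \<Rightarrow> nat \<Rightarrow> nat \<Rightarrow> int" where "pred_v v j \<equiv> v(j := v j - 1)"

lemma lat_vertices_shift [simp]:
  "v \<in> lat_vertices d \<Longrightarrow> j < d \<Longrightarrow> v(j := n) \<in> lat_vertices d"
  by (auto simp: lat_vertices_def)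

lemma lat_edges_eq: "lat_edges d = lat_vertices d \<times> {..<d}"
  by (auto simp: lat_edges_def)

text \<open>Counting measure makes Fatou's lemma and reindexing along lattice translations
  available.\<close>

definition vsum :: "nat \<Rightarrow> ((nat \<Rightarrow> int) \<Rightarrow> ennreal) \<Rightarrow> ennreal" where
  "vsum d h = (\<integral>\<^sup>+ v. h v \<partial>count_space (lat_vertices d))"

lemma vsum_mono: "(\<And>v. v \<in> lat_vertices d \<Longrightarrow> h v \<le> h' v) \<Longrightarrow> vsum d h \<le> vsum d h'"
  unfolding vsum_def by (intro nn_integral_mono) auto

lemma vsum_cong: "(\<And>v. v \<in> lat_vertices d \<Longrightarrow> h v = h' v) \<Longrightarrow> vsum d h = vsum d h'"
  unfolding vsum_def by (intro nn_integral_cong) auto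

lemma vsum_add: "vsum d (\<lambda>v. h v + h' v) = vsum d h + vsum d h'"
  unfolding vsum_def by (intro nn_integral_add) auto

lemma vsum_cmult: "vsum d (\<lambda>v. c * h v) = c * vsum d h"
  unfolding vsum_def by (intro nn_integral_cmult) auto

lemma vsum_sum: "vsum d (\<lambda>v. \<Sum>j\<in>J. h j v) = (\<Sum>j\<in>J. vsum d (h j))"
  unfolding vsum_def by (intro nn_integral_sum) auto

lemma vsum_ge_point: "v \<in> lat_vertices d \<Longrightarrow> h v \<le> vsum d h"
  unfolding vsum_def by (intro nn_integral_ge_point)

lemma vsum_succ: assumes "j < d" shows "vsum d (\<lambda>v. h (succ_v v j)) = vsum d h"
proof -
  have "bij_betw (\<lambda>v. succ_v v j) (lat_vertices d) (lat_vertices d)"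
    using assms by (intro bij_betw_byWitness[where f' = "\<lambda>v. pred_v v j"]) auto
  then show ?thesis unfolding vsum_def by (rule nn_integral_bij_count_space)
qed

lemma vsum_pred: assumes "j < d" shows "vsum d (\<lambda>v. h (pred_v v j)) = vsum d h"
  using vsum_succ[OF assms, of "\<lambda>v. h (pred_v v j)"] by simp

lemma nn_integral_count_space_Times_finite:
  assumes "finite J"
  shows "(\<integral>\<^sup>+ e. f e \<partial>count_space (A \<times> J)) = (\<Sum>j\<in>J. \<integral>\<^sup>+ v. f (v, j) \<partial>count_space A)"
proof -
  have "(\<integral>\<^sup>+ e. f e \<partial>count_space (A \<times> J)) = (\<integral>\<^sup>+ e. f e * indicator (A \<times> J) e \<partial>count_space UNIV)"
    by (simp add: nn_integral_count_space_indicator)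
  also have "\<dots> = (\<integral>\<^sup>+ j. \<integral>\<^sup>+ v. f (v, j) * indicator (A \<times> J) (v, j) \<partial>count_space UNIV \<partial>count_space UNIV)"
    by (rule nn_integral_snd_count_space[symmetric])
  also have "\<dots> = (\<Sum>j\<in>J. \<integral>\<^sup>+ v. f (v, j) * indicator (A \<times> J) (v, j) \<partial>count_space UNIV)"
    using assms by (intro nn_integral_count_space') auto
  also have "\<dots> = (\<Sum>j\<in>J. \<integral>\<^sup>+ v. f (v, j) \<partial>count_space A)"
    by (auto intro!: sum.cong nn_integral_cong simp: nn_integral_count_space_indicator indicator_def)
  finally show ?thesis .
qed

lemma weighted_square_sum_le:
  fixes q x :: "'a \<Rightarrow> real"
  assumes "\<And>j. j \<in> J \<Longrightarrow> 0 \<le> q j"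
  shows "(\<Sum>j\<in>J. q j * x j)\<^sup>2 \<le> (\<Sum>j\<in>J. q j) * (\<Sum>j\<in>J. q j * (x j)\<^sup>2)"
proof -
  have "(\<Sum>j\<in>J. sqrt (q j) * (sqrt (q j) * x j))\<^sup>2
      \<le> (\<Sum>j\<in>J. (sqrt (q j))\<^sup>2) * (\<Sum>j\<in>J. (sqrt (q j) * x j)\<^sup>2)"
    by (rule Cauchy_Schwarz_ineq_sum)
  moreover have "(\<Sum>j\<in>J. sqrt (q j) * (sqrt (q j) * x j)) = (\<Sum>j\<in>J. q j * x j)"
    using assms by (intro sum.cong) (auto simp: mult.assoc[symmetric] real_sqrt_mult_self)
  moreover have "(\<Sum>j\<in>J. (sqrt (q j))\<^sup>2) = (\<Sum>j\<in>J. q j)"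
    using assms by (intro sum.cong) auto
  moreover have "(\<Sum>j\<in>J. (sqrt (q j) * x j)\<^sup>2) = (\<Sum>j\<in>J. q j * (x j)\<^sup>2)"
    using assms by (intro sum.cong) (auto simp: power_mult_distrib)
  ultimately show ?thesis by simp
qed

lemma ennreal_linear:
  "0 \<le> a \<Longrightarrow> 0 \<le> x \<Longrightarrow> 0 \<le> b \<Longrightarrow> 0 \<le> y \<Longrightarrow>
    ennreal (a * x + b * y) = ennreal a * ennreal x + ennreal b * ennreal y"
  by (simp add: ennreal_mult ennreal_plus)

lemma ennreal_affine:
  "0 \<le> a \<Longrightarrow> 0 \<le> b \<Longrightarrow> 0 \<le> c \<Longrightarrow>
    ennreal a * (ennreal b * x) + ennreal c * x = ennreal (a * b + c) * x"
  by (simp add: ennreal_mult ennreal_plus distrib_right mult.assoc)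

text \<open>The setting for the equation \<open>m *\<^sub>R c v = T c v - G v\<close> on vertex
  functions. The assumption says that the diagonal \<open>m\<close> exceeds \<open>W\<close>, an
  upper bound for the norm of the hopping operator \<open>T\<close> both in \<open>l\<^sup>2\<close>
  and in the supremum norm.\<close>

locale vertex_operator =
  fixes d :: nat and w :: "nat \<Rightarrow> real" and m :: real
  assumes dominant: "2 * (\<Sum>j<d. \<bar>w j\<bar>) < \<bar>m\<bar>"
begin

definition W :: real where "W = 2 * (\<Sum>j<d. \<bar>w j\<bar>)"

definition T :: "((nat \<Rightarrow> int) \<Rightarrow> complex) \<Rightarrow> (nat \<Rightarrow> int) \<Rightarrow> complex" where
  "T c v = (\<Sum>j<d. w j *\<^sub>R (c (succ_v v j) + c (pred_v v j)))"

definition sq :: "((nat \<Rightarrow> int) \<Rightarrow> complex) \<Rightarrow> ennreal" where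
  "sq c = vsum d (\<lambda>v. ennreal ((cmod (c v))\<^sup>2))"

lemma W_nonneg: "0 \<le> W" by (simp add: W_def sum_nonneg)

lemma W_less: "W < \<bar>m\<bar>" using dominant by (simp add: W_def)

lemma W2_less: "W\<^sup>2 < m\<^sup>2"
  using power_strict_mono[OF W_less W_nonneg, of 2] by simp

lemma norm_T_le: "cmod (T c v) \<le> (\<Sum>j<d. \<bar>w j\<bar> * (cmod (c (succ_v v j)) + cmod (c (pred_v v j))))"
  unfolding T_def
  by (rule order.trans[OF norm_sum]) (auto intro!: sum_mono mult_left_mono norm_triangle_ineq)

lemma norm_T_sq_le:
  "(cmod (T c v))\<^sup>2 \<le> W * (\<Sum>j<d. \<bar>w j\<bar> * ((cmod (c (succ_v v j)))\<^sup>2 + (cmod (c (pred_v v j)))\<^sup>2))"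
proof -
  have s: "(a + b)\<^sup>2 \<le> 2 * (a\<^sup>2 + b\<^sup>2)" for a b :: real
    using square_sum_le[of a b] by simp
  have "(cmod (T c v))\<^sup>2 \<le> (\<Sum>j<d. \<bar>w j\<bar> * (cmod (c (succ_v v j)) + cmod (c (pred_v v j))))\<^sup>2"
    by (intro power_mono norm_T_le) auto
  also have "\<dots> \<le> (\<Sum>j<d. \<bar>w j\<bar>) * (\<Sum>j<d. \<bar>w j\<bar> * (cmod (c (succ_v v j)) + cmod (c (pred_v v j)))\<^sup>2)"
    by (rule weighted_square_sum_le) auto
  also have "\<dots> \<le> (\<Sum>j<d. \<bar>w j\<bar>) * (\<Sum>j<d. \<bar>w j\<bar> * (2 * ((cmod (c (succ_v v j)))\<^sup>2 + (cmod (c (pred_v v j)))\<^sup>2)))"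
    by (intro mult_left_mono sum_mono s sum_nonneg) auto
  also have "(\<Sum>j<d. \<bar>w j\<bar> * (2 * ((cmod (c (succ_v v j)))\<^sup>2 + (cmod (c (pred_v v j)))\<^sup>2)))
      = 2 * (\<Sum>j<d. \<bar>w j\<bar> * ((cmod (c (succ_v v j)))\<^sup>2 + (cmod (c (pred_v v j)))\<^sup>2))"
    by (simp add: sum_distrib_left mult_ac)
  finally show ?thesis by (simp add: W_def mult_ac)
qed

text \<open>Schur's test: Cauchy-Schwarz with weights \<open>\<bar>w j\<bar>\<close>, then
  translation invariance of the sum over the lattice for each of the neighbours.\<close>

lemma sq_T_le: "sq (T c) \<le> ennreal (W\<^sup>2) * sq c"
proof -
  have "sq (T c) \<le> vsum d (\<lambda>v. ennreal W * (\<Sum>j<d. ennreal \<bar>w j\<bar> *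
      (ennreal ((cmod (c (succ_v v j)))\<^sup>2) + ennreal ((cmod (c (pred_v v j)))\<^sup>2))))"
    unfolding sq_def
  proof (rule vsum_mono)
    fix v
    have "ennreal ((cmod (T c v))\<^sup>2)
      \<le> ennreal (W * (\<Sum>j<d. \<bar>w j\<bar> * ((cmod (c (succ_v v j)))\<^sup>2 + (cmod (c (pred_v v j)))\<^sup>2)))"
      by (intro ennreal_leI norm_T_sq_le)
    then show "ennreal ((cmod (T c v))\<^sup>2) \<le> ennreal W * (\<Sum>j<d. ennreal \<bar>w j\<bar> *
      (ennreal ((cmod (c (succ_v v j)))\<^sup>2) + ennreal ((cmod (c (pred_v v j)))\<^sup>2)))"
      using W_nonneg
      by (simp add: ennreal_mult sum_nonneg sum_ennreal[symmetric] ennreal_plus del: sum_ennreal)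
  qed
  also have "\<dots> = ennreal W * (\<Sum>j<d. ennreal \<bar>w j\<bar> * (sq c + sq c))"
    unfolding vsum_cmult vsum_sum vsum_add sq_def
    by (intro arg_cong2[where f = "(*)"] refl sum.cong arg_cong2[where f = "(+)"])
       (simp_all add: vsum_succ[where h = "\<lambda>v. ennreal ((cmod (c v))\<^sup>2)"] vsum_pred[where h = "\<lambda>v. ennreal ((cmod (c v))\<^sup>2)"])
  also have "\<dots> = ennreal W * ((\<Sum>j<d. ennreal \<bar>w j\<bar>) * (2 * sq c))"
    by (simp only: sum_distrib_right mult_2)
  also have "(\<Sum>j<d. ennreal \<bar>w j\<bar>) = ennreal (W / 2)" by (simp add: W_def)
  also have "ennreal W * (ennreal (W / 2) * (2 * sq c)) = (ennreal W * (ennreal (W / 2) * ennreal 2)) * sq c"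
    by (simp add: mult_ac)
  also have "ennreal W * (ennreal (W / 2) * ennreal 2) = ennreal (W\<^sup>2)"
    using W_nonneg by (simp add: ennreal_mult[symmetric] power2_eq_square del: ennreal_numeral)
  finally show ?thesis .
qed

text \<open>For \<open>p = m\<^sup>2 + W\<^sup>2\<close> and
  \<open>q = m\<^sup>2 - W\<^sup>2\<close> one has \<open>p + q = 2 * m\<^sup>2\<close>, so
  \<open>(x + y)\<^sup>2\<close> is at most
  \<open>2 * m\<^sup>2 * (x\<^sup>2 / p + y\<^sup>2 / q)\<close>. Dividing by
  \<open>m\<^sup>2\<close> and inserting \<open>sq_T_le\<close> produces these coefficients, and
  \<open>W < \<bar>m\<bar>\<close> makes the first a contraction factor.\<close>

definition \<sigma> :: real where "\<sigma> = 2 * W\<^sup>2 / (m\<^sup>2 + W\<^sup>2)"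
definition \<kappa> :: real where "\<kappa> = 2 / (m\<^sup>2 - W\<^sup>2)"

lemma sigma: "0 \<le> \<sigma>" "\<sigma> < 1"
proof -
  have "0 < m\<^sup>2 + W\<^sup>2" using W2_less zero_le_power2[of W] by linarith
  then show "0 \<le> \<sigma>" "\<sigma> < 1" using W2_less by (auto simp: \<sigma>_def)
qed

lemma kappa: "0 < \<kappa>" using W2_less by (simp add: \<kappa>_def)

lemma m_nonzero: "m \<noteq> 0" using W_less W_nonneg by auto

text \<open>The weights in Young's inequality are chosen such that the first coefficient stays below \<open>1\<close>.\<close>
lemma sq_step:
  assumes "\<And>v. v \<in> lat_vertices d \<Longrightarrow> m *\<^sub>R c' v = T c v - G v"
  shows "sq c' \<le> ennreal \<sigma> * sq c + ennreal \<kappa> * sq G"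
proof -
  have pos: "0 < m\<^sup>2 + W\<^sup>2" "0 < m\<^sup>2 - W\<^sup>2" using W2_less zero_le_power2[of W] by linarith+
  have m2: "0 < m\<^sup>2" using m_nonzero by simp
  have *: "(x + y)\<^sup>2 \<le> m\<^sup>2 * (2 / (m\<^sup>2 + W\<^sup>2) * x\<^sup>2 + \<kappa> * y\<^sup>2)" for x y
  proof -
    define p q where "p = m\<^sup>2 + W\<^sup>2" and "q = m\<^sup>2 - W\<^sup>2"
    have pq: "0 < p" "0 < q" "p + q = 2 * m\<^sup>2" using pos by (auto simp: p_def q_def)
    have "(q * x - p * y)\<^sup>2 \<ge> 0" by simp
    then have "p * q * (x + y)\<^sup>2 \<le> (p + q) * (q * x\<^sup>2 + p * y\<^sup>2)"
      by (simp add: power2_eq_square algebra_simps)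
    then have "(x + y)\<^sup>2 \<le> (p + q) * (q * x\<^sup>2 + p * y\<^sup>2) / (p * q)"
      using pq by (simp add: pos_le_divide_eq mult_ac)
    also have "\<dots> = m\<^sup>2 * (2 / p * x\<^sup>2 + 2 / q * y\<^sup>2)"
      using pq(1,2) unfolding pq(3) by (simp add: field_simps)
    finally show ?thesis by (simp add: p_def q_def \<kappa>_def)
  qed
  have "sq c' \<le> vsum d (\<lambda>v. ennreal (2 / (m\<^sup>2 + W\<^sup>2)) * ennreal ((cmod (T c v))\<^sup>2)
      + ennreal \<kappa> * ennreal ((cmod (G v))\<^sup>2))"
    unfolding sq_def
  proof (rule vsum_mono)
    fix v assume v: "v \<in> lat_vertices d"
    have "\<bar>m\<bar> * cmod (c' v) = cmod (T c v - G v)" unfolding assms[OF v, symmetric] by simp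
    also have "\<dots> \<le> cmod (T c v) + cmod (G v)" by (rule norm_triangle_ineq4)
    finally have "(\<bar>m\<bar> * cmod (c' v))\<^sup>2 \<le> (cmod (T c v) + cmod (G v))\<^sup>2" by (intro power_mono) auto
    also note *
    finally have "(cmod (c' v))\<^sup>2 \<le> 2 / (m\<^sup>2 + W\<^sup>2) * (cmod (T c v))\<^sup>2 + \<kappa> * (cmod (G v))\<^sup>2"
      using m2 by (simp add: power_mult_distrib)
    then have "ennreal ((cmod (c' v))\<^sup>2) \<le> ennreal (2 / (m\<^sup>2 + W\<^sup>2) * (cmod (T c v))\<^sup>2 + \<kappa> * (cmod (G v))\<^sup>2)"
      by (rule ennreal_leI)
    also have "\<dots> = ennreal (2 / (m\<^sup>2 + W\<^sup>2)) * ennreal ((cmod (T c v))\<^sup>2) + ennreal \<kappa> * ennreal ((cmod (G v))\<^sup>2)"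
      using pos kappa by (intro ennreal_linear) auto
    finally show "ennreal ((cmod (c' v))\<^sup>2) \<le> ennreal (2 / (m\<^sup>2 + W\<^sup>2)) * ennreal ((cmod (T c v))\<^sup>2)
      + ennreal \<kappa> * ennreal ((cmod (G v))\<^sup>2)" .
  qed
  also have "\<dots> = ennreal (2 / (m\<^sup>2 + W\<^sup>2)) * sq (T c) + ennreal \<kappa> * sq G"
    unfolding vsum_add vsum_cmult sq_def ..
  also have "\<dots> \<le> ennreal (2 / (m\<^sup>2 + W\<^sup>2)) * (ennreal (W\<^sup>2) * sq c) + ennreal \<kappa> * sq G"
    by (intro add_right_mono mult_left_mono sq_T_le) auto
  also have "ennreal (2 / (m\<^sup>2 + W\<^sup>2)) * (ennreal (W\<^sup>2) * sq c) = ennreal \<sigma> * sq c"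
    using pos by (simp add: mult.assoc[symmetric] ennreal_mult[symmetric] \<sigma>_def)
  finally show ?thesis .
qed

text \<open>\<open>\<kappa> / (1 - \<sigma>)\<close> is the fixed point of the affine recursion
  given by \<open>sq_step\<close>, hence a bound that the iteration never leaves.\<close>

lemma sigma_kappa:
  "ennreal \<sigma> * (ennreal (\<kappa> / (1 - \<sigma>)) * x) + ennreal \<kappa> * x = ennreal (\<kappa> / (1 - \<sigma>)) * x"
proof -
  have "ennreal \<sigma> * (ennreal (\<kappa> / (1 - \<sigma>)) * x) + ennreal \<kappa> * x = ennreal (\<sigma> * (\<kappa> / (1 - \<sigma>)) + \<kappa>) * x"
    using sigma kappa by (intro ennreal_affine) auto
  also have "\<sigma> * (\<kappa> / (1 - \<sigma>)) + \<kappa> = \<kappa> / (1 - \<sigma>)" using sigma by (simp add: field_simps)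
  finally show ?thesis .
qed

text \<open>\<open>sq_step\<close> with \<open>c' = c\<close>. Finiteness of \<open>sq c\<close> is
  what allows the term with factor \<open>\<sigma>\<close> to be absorbed on the left.\<close>

lemma apriori:
  assumes "\<And>v. v \<in> lat_vertices d \<Longrightarrow> m *\<^sub>R c v = T c v - G v" and fin: "sq c < \<infinity>"
  shows "sq c \<le> ennreal (\<kappa> / (1 - \<sigma>)) * sq G"
proof (cases "sq G = \<infinity>")
  case True
  then show ?thesis using sigma kappa by (simp add: ennreal_mult_top)
next
  case False
  obtain x where x: "sq c = ennreal x" "0 \<le> x" using fin by (cases "sq c") auto
  obtain y where y: "sq G = ennreal y" "0 \<le> y" using False by (cases "sq G") auto
  have "ennreal x \<le> ennreal \<sigma> * ennreal x + ennreal \<kappa> * ennreal y"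
    using sq_step[OF assms(1)] by (simp add: x y)
  also have "\<dots> = ennreal (\<sigma> * x + \<kappa> * y)"
    using sigma kappa x y by (intro ennreal_linear[symmetric]) auto
  finally have "x \<le> \<sigma> * x + \<kappa> * y"
    by (subst (asm) ennreal_le_iff) (use sigma kappa x y in auto)
  then have "(1 - \<sigma>) * x \<le> \<kappa> * y" by (simp add: algebra_simps)
  then have "x \<le> \<kappa> / (1 - \<sigma>) * y" using sigma by (simp add: field_simps)
  then have "ennreal x \<le> ennreal (\<kappa> / (1 - \<sigma>) * y)" by (rule ennreal_leI)
  also have "ennreal (\<kappa> / (1 - \<sigma>) * y) = ennreal (\<kappa> / (1 - \<sigma>)) * ennreal y"
    using sigma kappa y by (intro ennreal_mult) auto
  finally show ?thesis by (simp add: x y)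
qed

text \<open>Fixed-point iteration from 0. Convergence is only shown at each vertex, by a geometric
  bound on successive differences in the supremum norm; the uniform \<open>l\<^sup>2\<close> bound
  passes to the limit by Fatou's lemma.\<close>

lemma solvable:
  assumes fin: "sq G < \<infinity>"
  obtains c where "\<And>v. v \<in> lat_vertices d \<Longrightarrow> m *\<^sub>R c v = T c v - G v" "sq c < \<infinity>"
proof -
  define cc where "cc n = ((\<lambda>c v. (1 / m) *\<^sub>R (T c v - G v)) ^^ n) (\<lambda>_. 0)" for n
  have cc0: "cc 0 = (\<lambda>_. 0)" by (simp add: cc_def)
  have ccS: "cc (Suc n) v = (1 / m) *\<^sub>R (T (cc n) v - G v)" for n v by (simp add: cc_def)
  have eq: "m *\<^sub>R cc (Suc n) v = T (cc n) v - G v" for n v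
    using m_nonzero by (simp add: ccS)
  have bound: "sq (cc n) \<le> ennreal (\<kappa> / (1 - \<sigma>)) * sq G" for n
  proof (induction n)
    case 0 then show ?case by (simp add: cc0 sq_def vsum_def)
  next
    case (Suc n)
    have "sq (cc (Suc n)) \<le> ennreal \<sigma> * sq (cc n) + ennreal \<kappa> * sq G" using eq by (rule sq_step)
    also have "\<dots> \<le> ennreal \<sigma> * (ennreal (\<kappa> / (1 - \<sigma>)) * sq G) + ennreal \<kappa> * sq G"
      by (intro add_right_mono mult_left_mono Suc.IH) auto
    finally show ?case unfolding sigma_kappa .
  qed
  obtain g where g: "sq G = ennreal g" "0 \<le> g" using fin by (cases "sq G") auto
  \<comment> \<open>A single value of \<open>G\<close> is at most \<open>sqrt g\<close>, because one
    summand is at most the whole sum; thus \<open>B\<close> bounds the first iterate.\<close>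
  define B where "B = sqrt g / \<bar>m\<bar>"
  define r where "r = W / \<bar>m\<bar>"
  have r: "0 \<le> r" "r < 1" using W_nonneg W_less by (auto simp: r_def field_simps)
  have B0: "0 \<le> B" using g by (simp add: B_def)
  have GB: "cmod (G v) \<le> \<bar>m\<bar> * B" if "v \<in> lat_vertices d" for v
  proof -
    have "ennreal ((cmod (G v))\<^sup>2) \<le> ennreal g"
      using vsum_ge_point[OF that, of "\<lambda>v. ennreal ((cmod (G v))\<^sup>2)"] g by (simp add: sq_def)
    then have "(cmod (G v))\<^sup>2 \<le> g" using g by (simp add: ennreal_le_iff)
    then have "cmod (G v) \<le> sqrt g" by (rule real_le_rsqrt)
    then show ?thesis using m_nonzero by (simp add: B_def)
  qed
  have diff: "cmod (cc (Suc n) v - cc n v) \<le> B * r ^ n" if "v \<in> lat_vertices d" for n v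
    using that
  proof (induction n arbitrary: v)
    case 0
    have "cmod (cc (Suc 0) v - cc 0 v) = cmod (G v) / \<bar>m\<bar>" by (simp add: ccS cc0 T_def)
    also have "\<dots> \<le> B" using GB[OF 0] m_nonzero by (simp add: pos_divide_le_eq mult.commute)
    finally show ?case by simp
  next
    case (Suc n)
    have shift: "cmod (cc (Suc n) (v(j := z)) - cc n (v(j := z))) \<le> B * r ^ n" if "j \<in> {..<d}" for j z
      using that by (intro Suc.IH lat_vertices_shift Suc.prems) auto
    have "cc (Suc (Suc n)) v - cc (Suc n) v = (1 / m) *\<^sub>R T (\<lambda>v. cc (Suc n) v - cc n v) v"
      unfolding ccS[of "Suc n"] ccS[of n v]
      by (simp add: T_def algebra_simps sum_subtractf scaleR_diff_right sum.distrib flip: scaleR_right.sum)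
    then have "cmod (cc (Suc (Suc n)) v - cc (Suc n) v) = cmod (T (\<lambda>v. cc (Suc n) v - cc n v) v) / \<bar>m\<bar>"
      by simp
    also have "\<dots> \<le> (\<Sum>j<d. \<bar>w j\<bar> * (B * r ^ n + B * r ^ n)) / \<bar>m\<bar>"
      by (intro divide_right_mono order.trans[OF norm_T_le] sum_mono mult_left_mono add_mono shift) auto
    also have "\<dots> = B * r ^ Suc n"
      by (simp add: r_def W_def sum_distrib_right[symmetric])
    finally show ?case .
  qed
  define c where "c v = lim (\<lambda>n. cc n v)" for v
  have lim: "(\<lambda>n. cc n v) \<longlonglongrightarrow> c v" if v: "v \<in> lat_vertices d" for v
  proof -
    have "summable (\<lambda>n. cc (Suc n) v - cc n v)"
    proof (rule summable_comparison_test')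
      show "summable (\<lambda>n. B * r ^ n)" using r by (intro summable_mult summable_geometric) simp
      show "cmod (cc (Suc n) v - cc n v) \<le> B * r ^ n" for n using v by (rule diff)
    qed
    then have "convergent (\<lambda>n. \<Sum>i<n. cc (Suc i) v - cc i v)" by (simp add: summable_iff_convergent)
    then have "convergent (\<lambda>n. cc n v)" 
      unfolding sum_lessThan_telescope[of "\<lambda>n. cc n v"] by (simp add: cc0)
    then show ?thesis unfolding c_def by (simp add: convergent_LIMSEQ_iff)
  qed
  show thesis
  proof (rule that)
    fix v assume v: "v \<in> lat_vertices d"
    have "(\<lambda>n. m *\<^sub>R cc (Suc n) v) \<longlonglongrightarrow> m *\<^sub>R c v"
      by (intro tendsto_intros LIMSEQ_Suc lim v)
    moreover have "(\<lambda>n. T (cc n) v - G v) \<longlonglongrightarrow> T c v - G v"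
      unfolding T_def using v by (intro tendsto_intros lim) auto
    ultimately show "m *\<^sub>R c v = T c v - G v"
      unfolding eq by (rule LIMSEQ_unique)
  next
    have "sq c = vsum d (\<lambda>v. liminf (\<lambda>n. ennreal ((cmod (cc n v))\<^sup>2)))"
      unfolding sq_def
    proof (rule vsum_cong)
      fix v assume "v \<in> lat_vertices d"
      then have "(\<lambda>n. ennreal ((cmod (cc n v))\<^sup>2)) \<longlonglongrightarrow> ennreal ((cmod (c v))\<^sup>2)"
        by (intro tendsto_ennrealI tendsto_intros lim)
      then show "ennreal ((cmod (c v))\<^sup>2) = liminf (\<lambda>n. ennreal ((cmod (cc n v))\<^sup>2))"
        by (rule lim_imp_Liminf[OF sequentially_bot, symmetric])
    qed
    also have "\<dots> \<le> liminf (\<lambda>n. sq (cc n))"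
      unfolding sq_def vsum_def by (intro nn_integral_liminf) auto
    also have "\<dots> \<le> ennreal (\<kappa> / (1 - \<sigma>)) * sq G"
      using bound by (intro Liminf_le always_eventually) auto
    also have "\<dots> < \<infinity>" using fin by (simp add: ennreal_mult_less_top)
    finally show "sq c < \<infinity>" .
  qed
qed

end

section \<open>The resolvent set\<close>

lemma gnorm2_eq: "gnorm2 d aa \<psi> = (\<Sum>j<d. vsum d (\<lambda>v. en (aa j) (\<psi> v j)))"
  unfolding gnorm2_def lat_edges_eq
  by (subst nn_integral_count_space_Times_finite) (auto simp: en_def vsum_def)

lemma vsum_en_le_gnorm2: "j < d \<Longrightarrow> vsum d (\<lambda>v. en (aa j) (\<psi> v j)) \<le> gnorm2 d aa \<psi>"
  unfolding gnorm2_eq by (rule member_le_sum) auto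

lemma en_le_gnorm2: "v \<in> lat_vertices d \<Longrightarrow> j < d \<Longrightarrow> en (aa j) (\<psi> v j) \<le> gnorm2 d aa \<psi>"
  using vsum_ge_point[of v d "\<lambda>v. en (aa j) (\<psi> v j)"] vsum_en_le_gnorm2[of j d aa \<psi>] by (rule order.trans)

lemma in_L2_iff:
  "in_L2 d aa \<psi> \<longleftrightarrow>
     (\<forall>v\<in>lat_vertices d. \<forall>j<d. edge_meas (aa j) (\<psi> v j)) \<and> gnorm2 d aa \<psi> < \<infinity>"
  by (auto simp: in_L2_def lat_edges_eq)

lemma in_L2_combine:
  assumes "in_L2 d aa \<phi>" "in_L2 d aa \<psi>"
  shows "in_L2 d aa (\<lambda>v j t. - \<phi> v j t - r *\<^sub>R \<psi> v j t)"
proof -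
  have m: "edge_meas (aa j) (\<phi> v j)" "edge_meas (aa j) (\<psi> v j)" if "v \<in> lat_vertices d" "j < d" for v j
    using assms that by (auto simp: in_L2_iff)
  have m': "edge_meas (aa j) (\<lambda>t. - \<phi> v j t - r *\<^sub>R \<psi> v j t)" if "v \<in> lat_vertices d" "j < d" for v j
    using edge_meas_add[OF edge_meas_scale[OF m(1)[OF that], of "- 1"] edge_meas_scale[OF m(2)[OF that], of "- r"]]
    by simp
  have "gnorm2 d aa (\<lambda>v j t. - \<phi> v j t - r *\<^sub>R \<psi> v j t)
      \<le> (\<Sum>j<d. vsum d (\<lambda>v. 2 * en (aa j) (\<phi> v j) + (2 * ennreal (r\<^sup>2)) * en (aa j) (\<psi> v j)))"
    unfolding gnorm2_eq
  proof (intro sum_mono vsum_mono)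
    fix v j assume v: "v \<in> lat_vertices d" and "j \<in> {..<d}"
    then have j: "j < d" by simp
    have "en (aa j) (\<lambda>t. (- 1) *\<^sub>R \<phi> v j t + (- r) *\<^sub>R \<psi> v j t)
        \<le> 2 * en (aa j) (\<lambda>t. (- 1) *\<^sub>R \<phi> v j t) + 2 * en (aa j) (\<lambda>t. (- r) *\<^sub>R \<psi> v j t)"
      by (intro en_add edge_meas_scale m v j)
    also have "\<dots> = 2 * en (aa j) (\<phi> v j) + (2 * ennreal (r\<^sup>2)) * en (aa j) (\<psi> v j)"
      unfolding en_scale[OF m(1)[OF v j]] en_scale[OF m(2)[OF v j]] by (simp add: mult.assoc)
    finally show "en (aa j) (\<lambda>t. - \<phi> v j t - r *\<^sub>R \<psi> v j t)
        \<le> 2 * en (aa j) (\<phi> v j) + (2 * ennreal (r\<^sup>2)) * en (aa j) (\<psi> v j)" by simp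
  qed
  also have "\<dots> = 2 * gnorm2 d aa \<phi> + (2 * ennreal (r\<^sup>2)) * gnorm2 d aa \<psi>"
    unfolding vsum_add vsum_cmult gnorm2_eq by (simp add: sum.distrib sum_distrib_left)
  also have "\<dots> < \<infinity>" using assms by (simp add: in_L2_iff ennreal_mult_less_top)
  finally show ?thesis using m' by (simp add: in_L2_iff)
qed

text \<open>Away from the zeros of \<open>sn k (aa j)\<close> the slopes on an edge follow from its
  end values. Eliminating them leaves a vertex equation with hopping \<open>1 / sn\<close> and
  diagonal \<open>\<alpha>\<close> plus twice the sum of \<open>cs / sn\<close>; the assumption
  \<open>gap\<close> is its dominance condition.\<close>

locale lattice_gap =
  fixes d :: nat and aa :: "nat \<Rightarrow> real" and \<alpha> k :: real
  assumes d0: "0 < d" and aa_pos: "j < d \<Longrightarrow> 0 < aa j"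
    and sn_nz: "j < d \<Longrightarrow> sn k (aa j) \<noteq> 0"
    and gap: "2 * (\<Sum>j<d. 1 / \<bar>sn k (aa j)\<bar>) < \<bar>\<alpha> + 2 * (\<Sum>j<d. cs k (aa j) / sn k (aa j))\<bar>"
begin

sublocale vertex_operator d "\<lambda>j. 1 / sn k (aa j)" "\<alpha> + 2 * (\<Sum>j<d. cs k (aa j) / sn k (aa j))"
  using gap by unfold_locales simp

abbreviation "m \<equiv> \<alpha> + 2 * (\<Sum>j<d. cs k (aa j) / sn k (aa j))"
abbreviation "V \<equiv> lat_vertices d"

definition pw :: "gfun \<Rightarrow> (nat \<Rightarrow> int) \<Rightarrow> nat \<Rightarrow> complex" where
  "pw f v j = part k (f v j) (aa j)"
definition pw' :: "gfun \<Rightarrow> (nat \<Rightarrow> int) \<Rightarrow> nat \<Rightarrow> complex" where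
  "pw' f v j = part' k (f v j) (aa j)"

definition source :: "gfun \<Rightarrow> (nat \<Rightarrow> int) \<Rightarrow> complex" where
  "source f v = (\<Sum>j<d. (1 / sn k (aa j)) *\<^sub>R pw f v j
     - (cs k (aa j) / sn k (aa j)) *\<^sub>R pw f (pred_v v j) j + pw' f (pred_v v j) j)"

text \<open>\<open>slope0\<close> and \<open>slope1\<close> are the derivatives at the two ends of
  an edge that the vertex values \<open>c\<close> and the inhomogeneity \<open>f\<close>
  force.\<close>

definition slope0 :: "gfun \<Rightarrow> ((nat \<Rightarrow> int) \<Rightarrow> complex) \<Rightarrow> (nat \<Rightarrow> int) \<Rightarrow> nat \<Rightarrow> complex" where
  "slope0 f c v j = (1 / sn k (aa j)) *\<^sub>R (c (succ_v v j) - cs k (aa j) *\<^sub>R c v - pw f v j)"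

definition slope1 :: "gfun \<Rightarrow> ((nat \<Rightarrow> int) \<Rightarrow> complex) \<Rightarrow> (nat \<Rightarrow> int) \<Rightarrow> nat \<Rightarrow> complex" where
  "slope1 f c v j = (1 / sn k (aa j)) *\<^sub>R (cs k (aa j) *\<^sub>R (c (succ_v v j) - pw f v j) - c v) + pw' f v j"

lemma slope1_eq:
  assumes "j < d"
  shows "slope1 f c v j = cs k (aa j) *\<^sub>R slope0 f c v j - (k\<^sup>2 * sn k (aa j)) *\<^sub>R c v + pw' f v j"
proof -
  define C S where "C = cs k (aa j)" and "S = sn k (aa j)"
  have "S \<noteq> 0" "C\<^sup>2 + k\<^sup>2 * S\<^sup>2 = 1" using sn_nz[OF assms] cs_sn[of k "aa j"] by (auto simp: S_def C_def)
  then have e: "1 / S = C * C / S + k\<^sup>2 * S" by (simp add: field_simps power2_eq_square)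
  have "C *\<^sub>R ((1 / S) *\<^sub>R (b - C *\<^sub>R a - p)) - (k\<^sup>2 * S) *\<^sub>R a
      = (1 / S) *\<^sub>R (C *\<^sub>R (b - p)) - (C * C / S + k\<^sup>2 * S) *\<^sub>R a" for a b p :: complex
    by (simp add: algebra_simps)
  then have "C *\<^sub>R ((1 / S) *\<^sub>R (b - C *\<^sub>R a - p)) - (k\<^sup>2 * S) *\<^sub>R a
      = (1 / S) *\<^sub>R (C *\<^sub>R (b - p) - a)" for a b p :: complex
    by (simp only: e[symmetric] scaleR_diff_right)
  then show ?thesis by (simp add: slope0_def slope1_def C_def S_def)
qed

text \<open>The bridge between graph and lattice: read from right to left it builds elements of the
  domain, from left to right it shows that the vertex values of any element solve the difference
  equation.\<close>

lemma kirchhoff_iff: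
  "(\<Sum>j<d. slope0 f c v j - slope1 f c (pred_v v j) j) = complex_of_real \<alpha> * c v
    \<longleftrightarrow> m *\<^sub>R c v = T c v - source f v"
proof -
  have "slope0 f c v j - slope1 f c (pred_v v j) j
     = (1 / sn k (aa j)) *\<^sub>R (c (succ_v v j) + c (pred_v v j)) - (2 * (cs k (aa j) / sn k (aa j))) *\<^sub>R c v
       - ((1 / sn k (aa j)) *\<^sub>R pw f v j
     - (cs k (aa j) / sn k (aa j)) *\<^sub>R pw f (pred_v v j) j + pw' f (pred_v v j) j)" for j
  proof -
    have 2: "(2 * x) *\<^sub>R z = x *\<^sub>R z + x *\<^sub>R z" for x and z :: complex
      by (simp add: scaleR_add_left[symmetric])
    show ?thesis unfolding slope0_def slope1_def 2
      by (simp add: algebra_simps)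
  qed
  then have "(\<Sum>j<d. slope0 f c v j - slope1 f c (pred_v v j) j)
     = T c v - (2 * (\<Sum>j<d. cs k (aa j) / sn k (aa j))) *\<^sub>R c v - source f v"
    by (simp only: T_def source_def sum_subtractf scaleR_sum_left[symmetric] sum_distrib_left[symmetric])
  moreover have "m *\<^sub>R c v = complex_of_real \<alpha> * c v + (2 * (\<Sum>j<d. cs k (aa j) / sn k (aa j))) *\<^sub>R c v"
    by (simp only: scaleR_add_left scaleR_conv_of_real[of \<alpha>])
  moreover have "x - z - g = y \<longleftrightarrow> y + z = x - g" for x y z g :: complex
    by (auto simp: algebra_simps)
  ultimately show ?thesis by simp
qed

definition Mf :: "nat \<Rightarrow> ennreal" where "Mf j = ennreal ((part_const k (aa j))\<^sup>2 * aa j)"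
definition qf :: "nat \<Rightarrow> real" where "qf j = 1 + 1 / \<bar>sn k (aa j)\<bar>"

lemma Mf_finite [simp]: "Mf j < top" by (simp add: Mf_def)

lemma qf_ge1: "1 \<le> qf j" by (simp add: qf_def)

definition source_bound :: ennreal where
  "source_bound = ennreal (\<Sum>j<d. qf j) * (\<Sum>j<d. ennreal (3 * qf j) * (3 * Mf j))"

lemma source_bound_finite: "source_bound < top"
  by (simp add: source_bound_def ennreal_mult_less_top)

lemma pw_bound:
  assumes "in_L2 d aa f" "v \<in> V" "j < d"
  shows "ennreal ((cmod (pw f v j))\<^sup>2) \<le> Mf j * en (aa j) (f v j)"
    and "ennreal ((cmod (pw' f v j))\<^sup>2) \<le> Mf j * en (aa j) (f v j)"
proof -
  have "edge_meas (aa j) (f v j)" "en (aa j) (f v j) < \<infinity>"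
    using assms en_le_gnorm2[of v d j aa f] by (auto simp: in_L2_iff intro: order.strict_trans1)
  from part_L2[OF this, of "aa j" k] show "ennreal ((cmod (pw f v j))\<^sup>2) \<le> Mf j * en (aa j) (f v j)"
    "ennreal ((cmod (pw' f v j))\<^sup>2) \<le> Mf j * en (aa j) (f v j)"
    using aa_pos[OF assms(3)] by (auto simp: pw_def pw'_def Mf_def)
qed

text \<open>\<open>qf j\<close> dominates all three coefficients 1 / |sn|, |cs / sn| and 1. One
  factor 3 comes from squaring three terms, the other from three edge sums that agree after
  translation.\<close>

lemma sq_source:
  assumes f: "in_L2 d aa f"
  shows "sq (source f) \<le> source_bound * gnorm2 d aa f"
proof -
  have "sq (source f) \<le> vsum d (\<lambda>v. ennreal (\<Sum>j<d. qf j) * (\<Sum>j<d. ennreal (3 * qf j) *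
      (Mf j * en (aa j) (f v j) + Mf j * en (aa j) (f (pred_v v j) j) + Mf j * en (aa j) (f (pred_v v j) j))))"
    unfolding sq_def
  proof (rule vsum_mono)
    fix v assume v: "v \<in> V"
    let ?x = "\<lambda>j. cmod (pw f v j)" and ?y = "\<lambda>j. cmod (pw f (pred_v v j) j)" and ?z = "\<lambda>j. cmod (pw' f (pred_v v j) j)"
    have "cmod (source f v) \<le> (\<Sum>j<d. qf j * (?x j + ?y j + ?z j))"
      unfolding source_def
    proof (rule order.trans[OF norm_sum], rule sum_mono)
      fix j
      have "\<bar>1 / sn k (aa j)\<bar> \<le> qf j" by (simp add: qf_def)
      moreover have "\<bar>cs k (aa j) / sn k (aa j)\<bar> \<le> qf j"
        using divide_right_mono[OF abs_cs_le[of k "aa j"], of "\<bar>sn k (aa j)\<bar>"] by (simp add: qf_def)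
      moreover have "1 \<le> qf j" by (simp add: qf_def)
      ultimately have "\<bar>1 / sn k (aa j)\<bar> * ?x j + \<bar>cs k (aa j) / sn k (aa j)\<bar> * ?y j + 1 * ?z j
          \<le> qf j * ?x j + qf j * ?y j + qf j * ?z j"
        by (intro add_mono mult_right_mono) auto
      moreover have "cmod (a - b + e) \<le> cmod a + cmod b + cmod e" for a b e :: complex
        using norm_triangle_ineq[of "a - b" e] norm_triangle_ineq4[of a b] by linarith
      note this[of "(1 / sn k (aa j)) *\<^sub>R pw f v j" "(cs k (aa j) / sn k (aa j)) *\<^sub>R pw f (pred_v v j) j" "pw' f (pred_v v j) j"]
      ultimately show "cmod ((1 / sn k (aa j)) *\<^sub>R pw f v j
         - (cs k (aa j) / sn k (aa j)) *\<^sub>R pw f (pred_v v j) j + pw' f (pred_v v j) j)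
         \<le> qf j * (?x j + ?y j + ?z j)"
        by (simp add: algebra_simps)
    qed
    then have "(cmod (source f v))\<^sup>2 \<le> (\<Sum>j<d. qf j * (?x j + ?y j + ?z j))\<^sup>2"
      by (intro power_mono) auto
    also have "\<dots> \<le> (\<Sum>j<d. qf j) * (\<Sum>j<d. qf j * (?x j + ?y j + ?z j)\<^sup>2)"
      by (rule weighted_square_sum_le) (use qf_ge1 in \<open>auto intro: order.trans[of 0 1]\<close>)
    also have "\<dots> \<le> (\<Sum>j<d. qf j) * (\<Sum>j<d. qf j * (3 * ((?x j)\<^sup>2 + (?y j)\<^sup>2 + (?z j)\<^sup>2)))"
    proof (intro mult_left_mono sum_mono sum_nonneg)
      fix j
      have "3 * (a\<^sup>2 + b\<^sup>2 + c\<^sup>2) - (a + b + c)\<^sup>2 = (a - b)\<^sup>2 + (b - c)\<^sup>2 + (a - c)\<^sup>2" for a b c :: real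
        by (simp add: power2_eq_square algebra_simps)
      then show "(?x j + ?y j + ?z j)\<^sup>2 \<le> 3 * ((?x j)\<^sup>2 + (?y j)\<^sup>2 + (?z j)\<^sup>2)"
        by (metis add_nonneg_nonneg diff_ge_0_iff_ge zero_le_power2)
    qed (use qf_ge1 in \<open>auto intro: order.trans[of 0 1]\<close>)
    finally have "ennreal ((cmod (source f v))\<^sup>2)
        \<le> ennreal ((\<Sum>j<d. qf j) * (\<Sum>j<d. (3 * qf j) * ((?x j)\<^sup>2 + (?y j)\<^sup>2 + (?z j)\<^sup>2)))"
      by (intro ennreal_leI) (simp only: mult.left_commute[of _ 3] mult.assoc)
    also have "\<dots> = ennreal (\<Sum>j<d. qf j) * (\<Sum>j<d. ennreal (3 * qf j) *
        (ennreal ((?x j)\<^sup>2) + ennreal ((?y j)\<^sup>2) + ennreal ((?z j)\<^sup>2)))"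
    proof -
      have q0: "0 \<le> qf j" for j using qf_ge1[of j] by simp
      have "(\<Sum>j<d. ennreal (3 * qf j) * (ennreal ((?x j)\<^sup>2) + ennreal ((?y j)\<^sup>2) + ennreal ((?z j)\<^sup>2)))
          = (\<Sum>j<d. ennreal ((3 * qf j) * ((?x j)\<^sup>2 + (?y j)\<^sup>2 + (?z j)\<^sup>2)))"
        using q0 by (intro sum.cong) (auto simp: ennreal_mult' ennreal_plus)
      also have "\<dots> = ennreal (\<Sum>j<d. (3 * qf j) * ((?x j)\<^sup>2 + (?y j)\<^sup>2 + (?z j)\<^sup>2))"
        using q0 by (intro sum_ennreal) auto
      finally show ?thesis using q0 by (simp add: ennreal_mult' sum_nonneg)
    qed
    also have "\<dots> \<le> ennreal (\<Sum>j<d. qf j) * (\<Sum>j<d. ennreal (3 * qf j) *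
      (Mf j * en (aa j) (f v j) + Mf j * en (aa j) (f (pred_v v j) j) + Mf j * en (aa j) (f (pred_v v j) j)))"
      using v by (intro mult_left_mono sum_mono add_mono pw_bound f lat_vertices_shift) auto
    finally show "ennreal ((cmod (source f v))\<^sup>2) \<le> ennreal (\<Sum>j<d. qf j) * (\<Sum>j<d. ennreal (3 * qf j) *
      (Mf j * en (aa j) (f v j) + Mf j * en (aa j) (f (pred_v v j) j) + Mf j * en (aa j) (f (pred_v v j) j)))" .
  qed
  also have "\<dots> = ennreal (\<Sum>j<d. qf j) * (\<Sum>j<d. ennreal (3 * qf j) *
      (3 * Mf j * vsum d (\<lambda>v. en (aa j) (f v j))))"
    unfolding vsum_cmult vsum_sum vsum_add
  proof (intro arg_cong2[where f = "(*)"] refl sum.cong)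
    fix j assume "j \<in> {..<d}"
    then have p: "vsum d (\<lambda>v. en (aa j) (f (pred_v v j) j)) = vsum d (\<lambda>v. en (aa j) (f v j))"
      using vsum_pred[of j d "\<lambda>v. en (aa j) (f v j)"] by simp
    have 3: "x + x + x = 3 * x" for x :: ennreal
      by (metis distrib_right mult_1 numeral_Bit1 numeral_One one_add_one)
    show "Mf j * vsum d (\<lambda>v. en (aa j) (f v j)) + Mf j * vsum d (\<lambda>v. en (aa j) (f (pred_v v j) j))
        + Mf j * vsum d (\<lambda>v. en (aa j) (f (pred_v v j) j)) = 3 * Mf j * vsum d (\<lambda>v. en (aa j) (f v j))"
      unfolding p 3 by (simp add: mult.assoc)
  qed
  also have "\<dots> \<le> ennreal (\<Sum>j<d. qf j) * (\<Sum>j<d. ennreal (3 * qf j) * (3 * Mf j * gnorm2 d aa f))"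
    by (intro mult_left_mono sum_mono vsum_en_le_gnorm2) auto
  also have "\<dots> = source_bound * gnorm2 d aa f"
    by (simp only: source_bound_def sum_distrib_right mult.assoc)
  finally show ?thesis .
qed

definition energy_const :: "nat \<Rightarrow> ennreal" where
  "energy_const j = ennreal (3 * (1 + aa j / \<bar>sn k (aa j)\<bar>)\<^sup>2 * aa j)"

lemma energy_bound:
  assumes f: "in_L2 d aa f"
    and rep: "\<And>v j t. v \<in> V \<Longrightarrow> j < d \<Longrightarrow> t \<in> {0..aa j} \<Longrightarrow>
      \<psi> v j t = cs k t *\<^sub>R c v + sn k t *\<^sub>R B v j + part k (f v j) t"
    and endval: "\<And>v j. v \<in> V \<Longrightarrow> j < d \<Longrightarrow> \<psi> v j (aa j) = c (succ_v v j)"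
  shows "gnorm2 d aa \<psi> \<le> (\<Sum>j<d. energy_const j * (sq c + sq c + 4 * (Mf j * gnorm2 d aa f)))"
proof -
  have "gnorm2 d aa \<psi> \<le> (\<Sum>j<d. vsum d (\<lambda>v. energy_const j * (ennreal ((cmod (c v))\<^sup>2)
      + ennreal ((cmod (c (succ_v v j)))\<^sup>2) + 4 * (Mf j * en (aa j) (f v j)))))"
    unfolding gnorm2_eq
  proof (intro sum_mono vsum_mono)
    fix v j assume v: "v \<in> V" and "j \<in> {..<d}"
    then have j: "j < d" by simp
    have "edge_meas (aa j) (f v j)" "en (aa j) (f v j) < \<infinity>"
      using f v j en_le_gnorm2[of v d j aa f] by (auto simp: in_L2_iff intro: order.strict_trans1)
    from edge_energy[OF rep[OF v j] endval[OF v j] sn_nz[OF j] aa_pos[OF j] this]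
    show "en (aa j) (\<psi> v j) \<le> energy_const j * (ennreal ((cmod (c v))\<^sup>2)
      + ennreal ((cmod (c (succ_v v j)))\<^sup>2) + 4 * (Mf j * en (aa j) (f v j)))"
      by (simp add: energy_const_def Mf_def)
  qed
  also have "\<dots> = (\<Sum>j<d. energy_const j * (sq c + sq c + 4 * (Mf j * vsum d (\<lambda>v. en (aa j) (f v j)))))"
    unfolding vsum_cmult vsum_add sq_def
    by (intro sum.cong) (simp_all add: vsum_succ[where h = "\<lambda>v. ennreal ((cmod (c v))\<^sup>2)"])
  also have "\<dots> \<le> (\<Sum>j<d. energy_const j * (sq c + sq c + 4 * (Mf j * gnorm2 d aa f)))"
    by (intro sum_mono mult_left_mono add_left_mono vsum_en_le_gnorm2) auto
  finally show ?thesis .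
qed

text \<open>Solve the vertex equation with source term, then fill in each edge by the explicit
  formula with initial slope \<open>slope0\<close>. The far end value is correct by the choice of
  that slope, and the coupling condition by \<open>kirchhoff_iff\<close>.\<close>

lemma surjective:
  assumes f: "in_L2 d aa f"
  shows "\<exists>\<psi> u. hdom d aa \<alpha> \<psi> u \<and> L2_eq d aa (\<lambda>v j t. - u v j t - complex_of_real (k\<^sup>2) * \<psi> v j t) f"
proof -
  have fin: "sq (source f) < \<infinity>"
    using sq_source[OF f] source_bound_finite f
    by (auto simp: in_L2_iff ennreal_mult_less_top intro: order.strict_trans1)
  obtain c where c: "\<And>v. v \<in> V \<Longrightarrow> m *\<^sub>R c v = T c v - source f v" and cfin: "sq c < \<infinity>"
    using solvable[OF fin] by blast
  define \<psi> :: gfun where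
    "\<psi> v j t = cs k t *\<^sub>R c v + sn k t *\<^sub>R slope0 f c v j + part k (f v j) t" for v j t
  define D :: gfun where
    "D v j t = cs k t *\<^sub>R slope0 f c v j - (k\<^sup>2 * sn k t) *\<^sub>R c v + part' k (f v j) t" for v j t
  define u :: gfun where "u v j t = - f v j t - k\<^sup>2 *\<^sub>R \<psi> v j t" for v j t
  have fe: "edge_meas (aa j) (f v j)" "en (aa j) (f v j) < \<infinity>" if "v \<in> V" "j < d" for v j
    using f that en_le_gnorm2[of v d j aa f] by (auto simp: in_L2_iff intro: order.strict_trans1)
  have H: "H2_data (aa j) (\<psi> v j) (D v j) (u v j)" if v: "v \<in> V" and j: "j < d" for v j
  proof -
    have "f v j integrable_on {0..aa j}"
      using L2_imp_L1(1)[OF fe[OF v j]] aa_pos[OF j] by (simp add: absolutely_integrable_on_def)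
    from H2_data_add[OF H2_data_homogeneous[of "aa j" k "c v" "slope0 f c v j"] H2_data_part[OF this, of k]]
    show ?thesis using aa_pos[OF j]
      by (simp add: \<psi>_def[abs_def] D_def[abs_def] u_def[abs_def] algebra_simps)
  qed
  have end0: "\<psi> v j 0 = c v" "D v j 0 = slope0 f c v j" for v j
    by (simp_all add: \<psi>_def D_def)
  have end1: "\<psi> v j (aa j) = c (succ_v v j)" "D v j (aa j) = slope1 f c v j" if "j < d" for v j
  proof -
    show "\<psi> v j (aa j) = c (succ_v v j)"
      using sn_nz[OF that] by (simp add: \<psi>_def slope0_def pw_def)
    show "D v j (aa j) = slope1 f c v j"
      unfolding slope1_eq[OF that] by (simp add: D_def pw'_def)
  qed
  have "gnorm2 d aa \<psi> \<le> (\<Sum>j<d. energy_const j * (sq c + sq c + 4 * (Mf j * gnorm2 d aa f)))"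
    using end1(1) by (intro energy_bound[OF f]) (auto simp: \<psi>_def)
  also have "\<dots> < \<infinity>"
    using cfin f by (auto simp: in_L2_iff ennreal_mult_less_top energy_const_def)
  finally have \<psi>2: "in_L2 d aa \<psi>"
    using H by (auto simp: in_L2_iff intro!: edge_meas_continuous H2_data_continuous)
  have u2: "in_L2 d aa u"
    using in_L2_combine[OF f \<psi>2, of "k\<^sup>2"] by (simp add: u_def[abs_def])
  have "hdom d aa \<alpha> \<psi> u"
    unfolding hdom_def
  proof (intro conjI \<psi>2 u2 exI[of _ D] ballI)
    fix e assume "e \<in> lat_edges d"
    then show "case e of (v, j) \<Rightarrow> H2_data (aa j) (\<psi> v j) (D v j) (u v j)"
      using H by (auto simp: lat_edges_eq)
  next
    fix v assume v: "v \<in> V"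
    have "(\<Sum>j<d. slope0 f c v j - slope1 f c (pred_v v j) j) = complex_of_real \<alpha> * c v"
      unfolding kirchhoff_iff by (rule c[OF v])
    moreover have "(\<Sum>j<d. D v j 0 - D (pred_v v j) j (aa j)) = (\<Sum>j<d. slope0 f c v j - slope1 f c (pred_v v j) j)"
      by (intro sum.cong) (auto simp: end0 end1)
    ultimately show "\<exists>c. (\<forall>j<d. \<psi> v j 0 = c \<and> \<psi> (pred_v v j) j (aa j) = c) \<and>
        (\<Sum>j<d. D v j 0 - D (pred_v v j) j (aa j)) = complex_of_real \<alpha> * c"
      by (intro exI[of _ "c v"]) (auto simp: end0 end1)
  qed
  moreover have "L2_eq d aa (\<lambda>v j t. - u v j t - complex_of_real (k\<^sup>2) * \<psi> v j t) f"
    by (simp add: L2_eq_def u_def scaleR_conv_of_real)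
  ultimately show ?thesis by blast
qed

text \<open>The construction in reverse: every element of the domain has the explicit form on its
  edges, so its norm is controlled by its vertex values and \<open>f\<close>, and those values are
  controlled by \<open>apriori\<close>.\<close>

lemma bounded:
  assumes "hdom d aa \<alpha> \<psi> u"
  shows "gnorm2 d aa \<psi> \<le> (\<Sum>j<d. energy_const j * (2 * (ennreal (\<kappa> / (1 - \<sigma>)) * source_bound) + 4 * Mf j))
    * gnorm2 d aa (\<lambda>v j t. - u v j t - complex_of_real (k\<^sup>2) * \<psi> v j t)"
proof -
  define f :: gfun where "f v j t = - u v j t - k\<^sup>2 *\<^sub>R \<psi> v j t" for v j t
  have f_eq: "(\<lambda>v j t. - u v j t - complex_of_real (k\<^sup>2) * \<psi> v j t) = f"
    by (intro ext) (simp add: f_def scaleR_conv_of_real)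
  obtain D where \<psi>2: "in_L2 d aa \<psi>" and u2: "in_L2 d aa u"
    and H': "\<forall>(v, j)\<in>lat_edges d. H2_data (aa j) (\<psi> v j) (D v j) (u v j)"
    and vc: "\<forall>v\<in>V. \<exists>c. (\<forall>j<d. \<psi> v j 0 = c \<and> \<psi> (pred_v v j) j (aa j) = c) \<and>
        (\<Sum>j<d. D v j 0 - D (pred_v v j) j (aa j)) = complex_of_real \<alpha> * c"
    using assms unfolding hdom_def by blast
  have H: "H2_data (aa j) (\<psi> v j) (D v j) (u v j)" if "v \<in> V" "j < d" for v j
    using H' that by (auto simp: lat_edges_eq)
  have f2: "in_L2 d aa f" using in_L2_combine[OF u2 \<psi>2] by (simp add: f_def[abs_def])
  \<comment> \<open>Continuity makes all edges at a vertex agree there; direction 0 exists because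
    \<open>0 < d\<close>.\<close>
  define c where "c v = \<psi> v 0 0" for v
  have c0: "\<psi> v j 0 = c v" and c1: "\<psi> (pred_v v j) j (aa j) = c v"
    if "v \<in> V" "j < d" for v j
    using bspec[OF vc that(1)] d0 that(2) by (auto simp: c_def)
  have cs: "(\<Sum>j<d. D v j 0 - D (pred_v v j) j (aa j)) = complex_of_real \<alpha> * c v" if "v \<in> V" for v
    using bspec[OF vc that] d0 by (auto simp: c_def)
  have c2: "\<psi> v j (aa j) = c (succ_v v j)" if "v \<in> V" "j < d" for v j
    using c1[OF lat_vertices_shift[OF that, of "v j + 1"] that(2)] by simp
  have rep: "\<psi> v j t = cs k t *\<^sub>R c v + sn k t *\<^sub>R D v j 0 + part k (f v j) t"
    and rep': "D v j t = cs k t *\<^sub>R D v j 0 - (k\<^sup>2 * sn k t) *\<^sub>R c v + part' k (f v j) t"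
    if "v \<in> V" "j < d" "t \<in> {0..aa j}" for v j t
    using edge_solution[OF H[OF that(1,2)] less_imp_le[OF aa_pos[OF that(2)]] that(3), of k] c0[OF that(1,2)]
    by (simp_all add: f_def[abs_def])
  have s0: "D v j 0 = slope0 f c v j" if "v \<in> V" "j < d" for v j
  proof -
    have "sn k (aa j) *\<^sub>R D v j 0 = c (succ_v v j) - cs k (aa j) *\<^sub>R c v - pw f v j"
      using rep[OF that, of "aa j"] aa_pos[OF that(2)] c2[OF that] by (simp add: pw_def)
    then have "(1 / sn k (aa j)) *\<^sub>R (sn k (aa j) *\<^sub>R D v j 0) = slope0 f c v j"
      by (simp add: slope0_def)
    then show ?thesis using sn_nz[OF that(2)] by simp
  qed
  have s1: "D v j (aa j) = slope1 f c v j" if "v \<in> V" "j < d" for v j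
    using rep'[OF that, of "aa j"] aa_pos[OF that(2)] s0[OF that] slope1_eq[OF that(2)] by (simp add: pw'_def)
  have eqn: "m *\<^sub>R c v = T c v - source f v" if v: "v \<in> V" for v
  proof -
    have "(\<Sum>j<d. slope0 f c v j - slope1 f c (pred_v v j) j) = (\<Sum>j<d. D v j 0 - D (pred_v v j) j (aa j))"
      using v by (intro sum.cong) (auto simp: s0 s1)
    also have "\<dots> = complex_of_real \<alpha> * c v" by (rule cs[OF v])
    finally show ?thesis unfolding kirchhoff_iff .
  qed
  \<comment> \<open>Only finiteness is wanted here, since the bound itself involves
    \<open>\<psi>\<close>; it is the missing hypothesis of \<open>apriori\<close>.\<close>
  have "sq c < \<infinity>"
  proof -
    have "sq c \<le> vsum d (\<lambda>v. ennreal (72 / aa 0) * en (aa 0) (\<psi> v 0)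
        + ennreal (72 * (part_const k (aa 0))\<^sup>2 * aa 0) * en (aa 0) (f v 0))"
      unfolding sq_def
    proof (rule vsum_mono)
      fix v assume v: "v \<in> V"
      have "edge_meas (aa 0) (f v 0)" "en (aa 0) (f v 0) < \<infinity>" "en (aa 0) (\<psi> v 0) < \<infinity>"
        using f2 \<psi>2 v d0 en_le_gnorm2[of v d 0 aa] by (auto simp: in_L2_iff intro: order.strict_trans1)
      then show "ennreal ((cmod (c v))\<^sup>2) \<le> ennreal (72 / aa 0) * en (aa 0) (\<psi> v 0)
        + ennreal (72 * (part_const k (aa 0))\<^sup>2 * aa 0) * en (aa 0) (f v 0)"
        using H2_data_trace[OF H[OF v d0] aa_pos[OF d0], of k] by (simp add: f_def[abs_def] c_def)
    qed
    also have "\<dots> \<le> ennreal (72 / aa 0) * gnorm2 d aa \<psi> + ennreal (72 * (part_const k (aa 0))\<^sup>2 * aa 0) * gnorm2 d aa f"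
      unfolding vsum_add vsum_cmult using d0 by (intro add_mono mult_left_mono vsum_en_le_gnorm2) auto
    also have "\<dots> < \<infinity>" using \<psi>2 f2 by (simp add: in_L2_iff ennreal_mult_less_top)
    finally show ?thesis .
  qed
  with eqn have "sq c \<le> ennreal (\<kappa> / (1 - \<sigma>)) * sq (source f)" by (rule apriori)
  also have "\<dots> \<le> ennreal (\<kappa> / (1 - \<sigma>)) * (source_bound * gnorm2 d aa f)"
    by (intro mult_left_mono sq_source f2) auto
  finally have sqc: "sq c \<le> ennreal (\<kappa> / (1 - \<sigma>)) * source_bound * gnorm2 d aa f" by (simp add: mult.assoc)
  have "gnorm2 d aa \<psi> \<le> (\<Sum>j<d. energy_const j * (sq c + sq c + 4 * (Mf j * gnorm2 d aa f)))"
    using rep c2 by (rule energy_bound[OF f2])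
  also have "\<dots> \<le> (\<Sum>j<d. energy_const j * (ennreal (\<kappa> / (1 - \<sigma>)) * source_bound * gnorm2 d aa f
      + ennreal (\<kappa> / (1 - \<sigma>)) * source_bound * gnorm2 d aa f + 4 * (Mf j * gnorm2 d aa f)))"
    by (intro sum_mono mult_left_mono add_mono sqc order_refl) auto
  also have "\<dots> = (\<Sum>j<d. energy_const j * (2 * (ennreal (\<kappa> / (1 - \<sigma>)) * source_bound) + 4 * Mf j)) * gnorm2 d aa f"
  proof -
    have "e * (x * y + x * y + 4 * (z * y)) = e * (2 * x + 4 * z) * y" for e x y z :: ennreal
      by (simp only: mult_2 distrib_left distrib_right mult.assoc)
    then show ?thesis unfolding sum_distrib_right by (intro sum.cong) auto
  qed
  finally show ?thesis unfolding f_eq .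
qed

theorem resolvent: "resolvent_pt d aa \<alpha> (complex_of_real (k\<^sup>2))"
proof -
  define K where "K = (\<Sum>j<d. energy_const j * (2 * (ennreal (\<kappa> / (1 - \<sigma>)) * source_bound) + 4 * Mf j))"
  have "K < top"
    using source_bound_finite by (auto simp: K_def ennreal_mult_less_top energy_const_def)
  then have K: "ennreal (enn2real K) = K" by simp
  show ?thesis unfolding resolvent_pt_def
  proof (intro conjI exI[of _ "enn2real K"] allI impI)
    fix \<psi> u assume "hdom d aa \<alpha> \<psi> u"
    then have "gnorm2 d aa \<psi> \<le> K * gnorm2 d aa (\<lambda>v j t. - u v j t - complex_of_real (k\<^sup>2) * \<psi> v j t)"
      unfolding K_def by (rule bounded)
    then show "gnorm2 d aa \<psi> \<le> ennreal (enn2real K) * gnorm2 d aa (\<lambda>v j t. - u v j t - complex_of_real (k\<^sup>2) * \<psi> v j t)"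
      by (simp only: K)
  qed (rule surjective)
qed

end

section \<open>The spectrum\<close>

definition l1 :: "nat \<Rightarrow> (nat \<Rightarrow> int) \<Rightarrow> nat" where "l1 d v = (\<Sum>i<d. nat \<bar>v i\<bar>)"

lemma l1_upd: assumes "j < d" shows "l1 d (v(j := z)) + nat \<bar>v j\<bar> = l1 d v + nat \<bar>z\<bar>"
proof -
  have "l1 d u = nat \<bar>u j\<bar> + (\<Sum>i\<in>{..<d} - {j}. nat \<bar>u i\<bar>)" for u
    unfolding l1_def using assms by (intro sum.remove) auto
  note this[of v] this[of "v(j := z)"]
  moreover have "(\<Sum>i\<in>{..<d} - {j}. nat \<bar>(v(j := z)) i\<bar>) = (\<Sum>i\<in>{..<d} - {j}. nat \<bar>v i\<bar>)"
    by (intro sum.cong) auto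
  ultimately show ?thesis by simp
qed

lemma geometric_int_finite:
  assumes "0 \<le> r" "r < 1"
  shows "(\<integral>\<^sup>+ n. ennreal (r ^ nat \<bar>n :: int\<bar>) \<partial>count_space UNIV) < top"
proof -
  let ?f = "\<lambda>n :: int. ennreal (r ^ nat \<bar>n\<bar>)"
  have "(\<Sum>n. ennreal (r ^ n)) \<noteq> top"
    using assms by (intro ennreal_suminf_neq_top summable_geometric) auto
  then have fin: "(\<integral>\<^sup>+ n. ennreal (r ^ n) \<partial>count_space UNIV) < top"
    unfolding nn_integral_count_space_nat by (simp only: top.not_eq_extremum)
  have pos: "(\<integral>\<^sup>+ n. ?f n \<partial>count_space {0..}) = (\<integral>\<^sup>+ n. ennreal (r ^ n) \<partial>count_space UNIV)"
  proof -
    have "bij_betw int UNIV {0..}" by (intro bij_betw_byWitness[where f' = nat]) auto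
    from nn_integral_bij_count_space[OF this, of ?f] show ?thesis by simp
  qed
  have neg: "(\<integral>\<^sup>+ n. ?f n \<partial>count_space {..0}) = (\<integral>\<^sup>+ n. ennreal (r ^ n) \<partial>count_space UNIV)"
  proof -
    have "bij_betw (\<lambda>n. - int n) UNIV {..0}" by (intro bij_betw_byWitness[where f' = "\<lambda>n. nat (- n)"]) auto
    from nn_integral_bij_count_space[OF this, of ?f] show ?thesis by simp
  qed
  have "(\<integral>\<^sup>+ n. ?f n \<partial>count_space UNIV) \<le> (\<integral>\<^sup>+ n. ?f n * indicator {0..} n + ?f n * indicator {..0} n \<partial>count_space UNIV)"
    by (intro nn_integral_mono) (auto simp: indicator_def)
  also have "\<dots> = (\<integral>\<^sup>+ n. ?f n \<partial>count_space {0..}) + (\<integral>\<^sup>+ n. ?f n \<partial>count_space {..0})"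
    by (subst nn_integral_add) (auto simp: nn_integral_count_space_indicator)
  also have "\<dots> < top" using fin by (simp add: pos neg)
  finally show ?thesis .
qed

text \<open>Induction on the dimension: splitting off the last coordinate factors the sum into a
  lower-dimensional one and a two-sided geometric series.\<close>

lemma vsum_geometric_finite:
  assumes "0 \<le> r" "r < 1"
  shows "vsum d (\<lambda>v. ennreal (r ^ l1 d v)) < top"
proof (induction d)
  case 0
  have "lat_vertices 0 = {\<lambda>_. 0}" by (auto simp: lat_vertices_def)
  then show ?case by (simp add: vsum_def l1_def nn_integral_count_space_finite)
next
  case (Suc d)
  define S where "S = (\<integral>\<^sup>+ n. ennreal (r ^ nat \<bar>n :: int\<bar>) \<partial>count_space UNIV)"
  have bij: "bij_betw (\<lambda>(v, n). v(d := n)) (lat_vertices d \<times> UNIV) (lat_vertices (Suc d))"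
  proof (rule bij_betw_byWitness[where f' = "\<lambda>v. (v(d := 0), v d)"])
    show "\<forall>e\<in>lat_vertices d \<times> UNIV. (\<lambda>v. (v(d := 0), v d)) (case e of (v, n) \<Rightarrow> v(d := n)) = e"
      by (auto simp: lat_vertices_def fun_upd_idem)
    show "(\<lambda>v. (v(d := 0), v d)) ` lat_vertices (Suc d) \<subseteq> lat_vertices d \<times> UNIV"
      by (auto simp: lat_vertices_def Suc_le_eq)
  qed (auto simp: lat_vertices_def)
  have l1: "l1 (Suc d) (v(d := n)) = l1 d v + nat \<bar>n\<bar>" for v n
    by (simp add: l1_def)
  have "vsum (Suc d) (\<lambda>v. ennreal (r ^ l1 (Suc d) v))
      = (\<integral>\<^sup>+ e. ennreal (r ^ l1 (Suc d) (case e of (v, n) \<Rightarrow> v(d := n))) \<partial>count_space (lat_vertices d \<times> UNIV))"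
    unfolding vsum_def by (rule nn_integral_bij_count_space[OF bij, symmetric])
  also have "\<dots> = (\<integral>\<^sup>+ e. ennreal (r ^ l1 d (fst e)) * ennreal (r ^ nat \<bar>snd e\<bar>) * indicator (lat_vertices d \<times> UNIV) e \<partial>count_space UNIV)"
    using assms
    by (subst nn_integral_count_space_indicator)
       (auto intro!: nn_integral_cong simp: l1 power_add ennreal_mult split: prod.splits)
  also have "\<dots> = (\<integral>\<^sup>+ v. \<integral>\<^sup>+ n. ennreal (r ^ l1 d v) * ennreal (r ^ nat \<bar>n\<bar>) * indicator (lat_vertices d \<times> UNIV) (v, n) \<partial>count_space UNIV \<partial>count_space UNIV)"
    by (subst nn_integral_fst_count_space[symmetric]) simp
  also have "\<dots> = (\<integral>\<^sup>+ v. ennreal (r ^ l1 d v) * indicator (lat_vertices d) v * S \<partial>count_space UNIV)"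
    unfolding S_def
    by (subst nn_integral_cmult[symmetric]) (auto intro!: nn_integral_cong simp: indicator_def)
  also have "\<dots> = vsum d (\<lambda>v. ennreal (r ^ l1 d v)) * S"
    unfolding vsum_def by (subst nn_integral_multc) (auto simp: nn_integral_count_space_indicator)
  also have "\<dots> < top"
    using Suc.IH geometric_int_finite[OF assms] by (simp add: S_def ennreal_mult_less_top)
  finally show ?case .
qed

lemma en_nonzero:
  assumes c: "continuous_on {0..l} f" and l: "0 < l" and t: "t \<in> {0..l}" "f t \<noteq> 0"
  shows "en l f \<noteq> 0"
proof
  assume 0: "en l f = 0"
  then have "ennreal ((integral {0..l} (\<lambda>t. cmod (f t)))\<^sup>2) \<le> 0"
    using L2_imp_L1(2)[OF edge_meas_continuous[OF c]] l by simp
  then have "integral {0..l} (\<lambda>t. cmod (f t)) = 0" by simp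
  then have "\<forall>x\<in>{0..l}. cmod (f x) = 0"
    using l by (subst (asm) integral_eq_0_iff) (auto intro!: continuous_intros c)
  then show False using t by auto
qed

text \<open>\<open>\<Phi> j\<close> is the profile on the edge in direction \<open>j\<close> at the
  origin, and translation by a lattice step multiplies it by \<open>cis (\<theta> j)\<close>. The
  common vertex value \<open>z\<close> may be 0, which covers solutions vanishing at all vertices;
  \<open>j0\<close> then witnesses that the solution is not zero.\<close>

locale bloch_solution =
  fixes d :: nat and aa :: "nat \<Rightarrow> real" and \<alpha> k :: real
    and \<Phi> \<Phi>' :: "nat \<Rightarrow> real \<Rightarrow> complex" and \<theta> :: "nat \<Rightarrow> real" and z :: complex and j0 :: nat
  assumes aa_pos: "j < d \<Longrightarrow> 0 < aa j"
    and deriv: "j < d \<Longrightarrow> (\<Phi> j has_vector_derivative \<Phi>' j t) (at t within {0..aa j})"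
    and deriv': "j < d \<Longrightarrow> (\<Phi>' j has_vector_derivative - k\<^sup>2 *\<^sub>R \<Phi> j t) (at t within {0..aa j})"
    and start: "j < d \<Longrightarrow> \<Phi> j 0 = z"
    and finish: "j < d \<Longrightarrow> \<Phi> j (aa j) = cis (\<theta> j) * z"
    and kirchhoff: "(\<Sum>j<d. \<Phi>' j 0 - cis (- \<theta> j) * \<Phi>' j (aa j)) = complex_of_real \<alpha> * z"
    and nontrivial: "j0 < d" "en (aa j0) (\<Phi> j0) \<noteq> 0"
begin

abbreviation "V \<equiv> lat_vertices d"

definition phase :: "(nat \<Rightarrow> int) \<Rightarrow> complex" where
  "phase v = cis (\<Sum>i<d. \<theta> i * v i)"

lemma phase_norm [simp]: "cmod (phase v) = 1" by (simp add: phase_def)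

lemma phase_pred: assumes "j < d" shows "phase (pred_v v j) = phase v * cis (- \<theta> j)"
proof -
  have "(\<Sum>i<d. \<theta> i * u i) = \<theta> j * u j + (\<Sum>i\<in>{..<d} - {j}. \<theta> i * u i)" for u :: "nat \<Rightarrow> int"
    using assms by (intro sum.remove) auto
  note this[of v] this[of "pred_v v j"]
  moreover have "(\<Sum>i\<in>{..<d} - {j}. \<theta> i * (pred_v v j) i) = (\<Sum>i\<in>{..<d} - {j}. \<theta> i * v i)"
    by (intro sum.cong) auto
  ultimately have "(\<Sum>i<d. \<theta> i * (pred_v v j) i) = (\<Sum>i<d. \<theta> i * v i) + - \<theta> j"
    by (simp add: algebra_simps)
  then show ?thesis unfolding phase_def by (simp only: cis_mult)
qed

lemma continuous: "j < d \<Longrightarrow> continuous_on {0..aa j} (\<Phi> j)" "j < d \<Longrightarrow> continuous_on {0..aa j} (\<Phi>' j)"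
  by (rule continuous_on_vector_derivative, erule deriv deriv')+

lemma amplitude_bound:
  obtains B where "0 \<le> B" "\<And>j t. j < d \<Longrightarrow> t \<in> {0..aa j} \<Longrightarrow> cmod (\<Phi> j t) \<le> B \<and> cmod (\<Phi>' j t) \<le> B"
proof -
  have "\<exists>b. \<forall>t\<in>{0..aa j}. cmod (\<Phi> j t) \<le> b \<and> cmod (\<Phi>' j t) \<le> b" if j: "j < d" for j
  proof -
    have "bounded (\<Phi> j ` {0..aa j})" "bounded (\<Phi>' j ` {0..aa j})"
      by (intro compact_imp_bounded compact_continuous_image continuous[OF j] compact_Icc)+
    then obtain b b' where "\<forall>x\<in>\<Phi> j ` {0..aa j}. cmod x \<le> b" "\<forall>x\<in>\<Phi>' j ` {0..aa j}. cmod x \<le> b'"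
      unfolding bounded_iff by blast
    then show ?thesis by (intro exI[of _ "max b b'"]) (auto simp: le_max_iff_disj)
  qed
  then obtain b where b: "\<And>j t. j < d \<Longrightarrow> t \<in> {0..aa j} \<Longrightarrow> cmod (\<Phi> j t) \<le> b j \<and> cmod (\<Phi>' j t) \<le> b j"
    by metis
  have le: "b j \<le> (\<Sum>i<d. \<bar>b i\<bar>)" if "j < d" for j
    using member_le_sum[of j "{..<d}" "\<lambda>i. \<bar>b i\<bar>"] that by auto
  show thesis
    by (rule that[of "\<Sum>i<d. \<bar>b i\<bar>"]) (use b le in \<open>fastforce intro: sum_nonneg order.trans\<close>)+
qed

end

text \<open>The weight \<open>r ^ l1 d v\<close> changes along an edge by at most the relative amount \<open>1 / r - 1\<close>, so cutting
  off a bounded Bloch solution with it gives a Weyl sequence as \<open>r\<close> tends to \<open>1\<close>. Along an edge the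
  weight is interpolated by the cubic with vanishing slopes at both ends, which
  preserves the vertex conditions.\<close>
locale bloch_cutoff = bloch_solution +
  fixes r B :: real
  assumes r: "0 < r" "r < 1"
    and B: "0 \<le> B" "j < d \<Longrightarrow> t \<in> {0..aa j} \<Longrightarrow> cmod (\<Phi> j t) \<le> B"
      "j < d \<Longrightarrow> t \<in> {0..aa j} \<Longrightarrow> cmod (\<Phi>' j t) \<le> B"
begin

definition \<eta> :: "(nat \<Rightarrow> int) \<Rightarrow> real" where "\<eta> v = r ^ l1 d v"

definition jump :: "(nat \<Rightarrow> int) \<Rightarrow> nat \<Rightarrow> real" where "jump v j = \<eta> (succ_v v j) - \<eta> v"

definition \<epsilon> :: real where "\<epsilon> = 1 / r - 1"

lemma eta_pos: "0 < \<eta> v" using r by (simp add: \<eta>_def)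

lemma eta_succ: assumes "j < d" shows "r * \<eta> v \<le> \<eta> (succ_v v j)" "r * \<eta> (succ_v v j) \<le> \<eta> v"
proof -
  have "l1 d (succ_v v j) \<le> Suc (l1 d v)" "l1 d v \<le> Suc (l1 d (succ_v v j))"
    using l1_upd[OF assms, of v "v j + 1"] by linarith+
  then have "r ^ Suc (l1 d v) \<le> r ^ l1 d (succ_v v j)" "r ^ Suc (l1 d (succ_v v j)) \<le> r ^ l1 d v"
    using r by (intro power_decreasing; simp)+
  then show "r * \<eta> v \<le> \<eta> (succ_v v j)" "r * \<eta> (succ_v v j) \<le> \<eta> v" by (simp_all add: \<eta>_def)
qed

lemma jump_le: assumes "j < d" shows "\<bar>jump v j\<bar> \<le> \<epsilon> * \<eta> v"
proof -
  have "\<eta> (succ_v v j) \<le> \<eta> v / r" using eta_succ(2)[OF assms, of v] r by (simp add: pos_le_divide_eq mult.commute)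
  then have 1: "jump v j \<le> \<epsilon> * \<eta> v" by (simp add: jump_def \<epsilon>_def algebra_simps)
  have "(1 - r) * 1 \<le> (1 - r) * (1 / r)" using r by (intro mult_left_mono) auto
  also have "\<dots> = \<epsilon>" using r by (simp add: \<epsilon>_def field_simps)
  finally have "(1 - r) * \<eta> v \<le> \<epsilon> * \<eta> v" using eta_pos[of v] by (intro mult_right_mono) auto
  then have "- jump v j \<le> \<epsilon> * \<eta> v" using eta_succ(1)[OF assms, of v] by (simp add: jump_def algebra_simps)
  with 1 show ?thesis by linarith
qed

definition step :: "nat \<Rightarrow> real \<Rightarrow> real" where "step j t = 3 * (t / aa j)\<^sup>2 - 2 * (t / aa j) ^ 3"
definition step' :: "nat \<Rightarrow> real \<Rightarrow> real" where "step' j t = 6 / aa j * (t / aa j) * (1 - t / aa j)"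
definition step'' :: "nat \<Rightarrow> real \<Rightarrow> real" where "step'' j t = 6 / (aa j)\<^sup>2 * (1 - 2 * (t / aa j))"

lemma step_deriv: "j < d \<Longrightarrow> (step j has_real_derivative step' j t) (at t within X)"
  unfolding step_def[abs_def] step'_def using aa_pos[of j]
  by (auto intro!: derivative_eq_intros simp: field_simps power2_eq_square power3_eq_cube)

lemma step'_deriv: "j < d \<Longrightarrow> (step' j has_real_derivative step'' j t) (at t within X)"
  unfolding step'_def[abs_def] step''_def using aa_pos[of j]
  by (auto intro!: derivative_eq_intros simp: field_simps power2_eq_square)

lemma step_ends [simp]: "step j 0 = 0" "step' j 0 = 0" "j < d \<Longrightarrow> step j (aa j) = 1" "j < d \<Longrightarrow> step' j (aa j) = 0"
  using aa_pos[of j] by (auto simp: step_def step'_def)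

lemma step_bounds:
  assumes "j < d" "t \<in> {0..aa j}"
  shows "0 \<le> step j t" "step j t \<le> 1" "\<bar>step' j t\<bar> \<le> 6 / aa j" "\<bar>step'' j t\<bar> \<le> 6 / (aa j)\<^sup>2"
proof -
  define x where "x = t / aa j"
  have x: "0 \<le> x" "x \<le> 1" using assms aa_pos[OF assms(1)] by (auto simp: x_def)
  have "step j t = x\<^sup>2 * (3 - 2 * x)" by (simp add: step_def x_def power2_eq_square power3_eq_cube algebra_simps)
  then show "0 \<le> step j t" using x by simp
  have "1 - step j t = (1 - x)\<^sup>2 * (1 + 2 * x)"
    by (simp add: step_def x_def[symmetric] power2_eq_square power3_eq_cube algebra_simps)
  moreover have "0 \<le> (1 - x)\<^sup>2 * (1 + 2 * x)" using x by simp
  ultimately show "step j t \<le> 1" by linarith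
  have "\<bar>x * (1 - x)\<bar> \<le> 1 * 1" unfolding abs_mult using x by (intro mult_mono) auto
  then have "6 / aa j * \<bar>x * (1 - x)\<bar> \<le> 6 / aa j * 1" using aa_pos[OF assms(1)] by (intro mult_left_mono) auto
  then show "\<bar>step' j t\<bar> \<le> 6 / aa j"
    using aa_pos[OF assms(1)] by (simp add: step'_def x_def[symmetric] abs_mult)
  have "6 / (aa j)\<^sup>2 * \<bar>1 - 2 * x\<bar> \<le> 6 / (aa j)\<^sup>2 * 1" using x by (intro mult_left_mono) auto
  then show "\<bar>step'' j t\<bar> \<le> 6 / (aa j)\<^sup>2"
    unfolding step''_def x_def[symmetric] abs_mult by simp
qed

definition cut :: "(nat \<Rightarrow> int) \<Rightarrow> nat \<Rightarrow> real \<Rightarrow> real" where "cut v j t = \<eta> v + jump v j * step j t"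

lemma cut_bounds:
  assumes "j < d" "t \<in> {0..aa j}"
  shows "r * \<eta> v \<le> cut v j t" "cut v j t \<le> \<eta> v / r"
proof -
  have e: "cut v j t = (1 - step j t) * \<eta> v + step j t * \<eta> (succ_v v j)"
    by (simp add: cut_def jump_def algebra_simps)
  have "r * \<eta> v \<le> 1 * \<eta> v" using r eta_pos[of v] by (intro mult_right_mono) auto
  then have "(1 - step j t) * (r * \<eta> v) + step j t * (r * \<eta> v) \<le> cut v j t"
    unfolding e using step_bounds[OF assms] eta_succ(1)[OF assms(1), of v] by (intro add_mono mult_left_mono) auto
  then show "r * \<eta> v \<le> cut v j t" by (simp add: algebra_simps)
  have 1: "\<eta> (succ_v v j) \<le> \<eta> v / r" using eta_succ(2)[OF assms(1), of v] r by (simp add: pos_le_divide_eq mult.commute)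
  have "\<eta> v / 1 \<le> \<eta> v / r" using r eta_pos[of v] by (intro divide_left_mono) auto
  then have "cut v j t \<le> (1 - step j t) * (\<eta> v / r) + step j t * (\<eta> v / r)"
    unfolding e using step_bounds[OF assms] 1 by (intro add_mono mult_left_mono) auto
  also have "(1 - step j t) * y + step j t * y = y" for y by (simp add: algebra_simps)
  finally show "cut v j t \<le> \<eta> v / r" .
qed

lemma cut_deriv: "j < d \<Longrightarrow> (cut v j has_real_derivative jump v j * step' j t) (at t within X)"
  unfolding cut_def[abs_def] by (auto intro!: derivative_eq_intros step_deriv)

definition \<psi> :: gfun where "\<psi> v j t = cut v j t *\<^sub>R (phase v * \<Phi> j t)"
definition D\<psi> :: gfun where
  "D\<psi> v j t = cut v j t *\<^sub>R (phase v * \<Phi>' j t) + (jump v j * step' j t) *\<^sub>R (phase v * \<Phi> j t)"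
text \<open>This is \<open>H - k\<^sup>2\<close> applied to the cut-off function: only terms in
  which the cut-off is differentiated survive, and each carries a factor
  \<open>jump v j\<close>.\<close>

definition err :: gfun where
  "err v j t = - ((jump v j * step'' j t) *\<^sub>R (phase v * \<Phi> j t) + (2 * (jump v j * step' j t)) *\<^sub>R (phase v * \<Phi>' j t))"
definition u :: gfun where "u v j t = - err v j t - k\<^sup>2 *\<^sub>R \<psi> v j t"

lemma continuous_on_cut: "j < d \<Longrightarrow> continuous_on X (cut v j)"
  by (rule DERIV_continuous_on[OF cut_deriv])

lemma continuous_on_step': "j < d \<Longrightarrow> continuous_on X (step' j)"
  by (rule DERIV_continuous_on[OF step'_deriv])

lemma continuous_on_step'': "continuous_on X (step'' j)"
  unfolding step''_def[abs_def] divide_inverse by (intro continuous_intros)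

lemma continuous_err: "j < d \<Longrightarrow> continuous_on {0..aa j} (err v j)"
  unfolding err_def[abs_def]
  by (intro continuous_intros continuous continuous_on_step' continuous_on_step'')

lemma H2_cutoff: assumes j: "j < d" shows "H2_data (aa j) (\<psi> v j) (D\<psi> v j) (u v j)"
proof (rule H2_data_smooth)
  note ph = has_vector_derivative_mult_right[of _ _ _ "phase v"]
  fix t assume t: "t \<in> {0..aa j}"
  show "(\<psi> v j has_vector_derivative D\<psi> v j t) (at t within {0..aa j})"
    unfolding \<psi>_def[abs_def] D\<psi>_def
    by (intro has_vector_derivative_scaleR cut_deriv[OF j] ph deriv[OF j])
  have "(D\<psi> v j has_vector_derivative
      (cut v j t *\<^sub>R (phase v * (- k\<^sup>2 *\<^sub>R \<Phi> j t)) + (jump v j * step' j t) *\<^sub>R (phase v * \<Phi>' j t))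
      + ((jump v j * step' j t) *\<^sub>R (phase v * \<Phi>' j t) + (jump v j * step'' j t) *\<^sub>R (phase v * \<Phi> j t)))
      (at t within {0..aa j})"
    unfolding D\<psi>_def[abs_def]
    by (intro has_vector_derivative_add has_vector_derivative_scaleR cut_deriv[OF j] ph deriv[OF j] deriv'[OF j]
        DERIV_cmult step'_deriv[OF j])
  moreover have "(cut v j t *\<^sub>R (phase v * (- k\<^sup>2 *\<^sub>R \<Phi> j t)) + (jump v j * step' j t) *\<^sub>R (phase v * \<Phi>' j t))
      + ((jump v j * step' j t) *\<^sub>R (phase v * \<Phi>' j t) + (jump v j * step'' j t) *\<^sub>R (phase v * \<Phi> j t)) = u v j t"
    unfolding u_def err_def \<psi>_def by (simp add: scaleR_conv_of_real algebra_simps)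
  ultimately show "(D\<psi> v j has_vector_derivative u v j t) (at t within {0..aa j})" by simp
next
  show "continuous_on {0..aa j} (u v j)"
    unfolding u_def[abs_def] \<psi>_def[abs_def]
    by (intro continuous_intros continuous_err continuous_on_cut continuous j)
qed

text \<open>The mass of the weight, common to the lower bound for the cut-off function and the upper
  bound for its error.\<close>

definition N :: ennreal where "N = vsum d (\<lambda>v. ennreal ((\<eta> v)\<^sup>2))"

lemma N_finite: "N < top"
proof -
  have "(\<eta> v)\<^sup>2 = (r\<^sup>2) ^ l1 d v" for v by (simp add: \<eta>_def power_mult[symmetric] mult.commute)
  moreover have "r\<^sup>2 < 1" using r by (simp add: power_less_one_iff)
  ultimately show ?thesis unfolding N_def using vsum_geometric_finite[of "r\<^sup>2" d] r by simp
qed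

lemma N_nonzero: "N \<noteq> 0"
proof -
  have "0 < ennreal ((\<eta> (\<lambda>_. 0))\<^sup>2)" using eta_pos[of "\<lambda>_. 0"] by simp
  also have "\<dots> \<le> N" unfolding N_def by (rule vsum_ge_point) (simp add: lat_vertices_def)
  finally show ?thesis by simp
qed

lemma gnorm2_le_N:
  assumes "\<And>v j t. v \<in> V \<Longrightarrow> j < d \<Longrightarrow> t \<in> {0..aa j} \<Longrightarrow> cmod (f v j t) \<le> K j * \<eta> v"
  shows "gnorm2 d aa f \<le> ennreal (\<Sum>j<d. (K j)\<^sup>2 * aa j) * N"
proof -
  have "gnorm2 d aa f \<le> (\<Sum>j<d. vsum d (\<lambda>v. ennreal ((K j)\<^sup>2 * aa j) * ennreal ((\<eta> v)\<^sup>2)))"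
    unfolding gnorm2_eq
  proof (intro sum_mono vsum_mono)
    fix v j assume v: "v \<in> V" and "j \<in> {..<d}"
    then have j: "j < d" by simp
    have "en (aa j) (f v j) \<le> ennreal ((K j * \<eta> v)\<^sup>2) * ennreal (aa j)"
    proof (rule en_bound)
      show "ennreal ((cmod (f v j t))\<^sup>2) \<le> ennreal ((K j * \<eta> v)\<^sup>2)" if "t \<in> {0..aa j}" for t
        using assms[OF v j that] by (intro ennreal_leI power_mono) auto
    qed (use aa_pos[OF j] in simp)
    also have "\<dots> = ennreal ((K j)\<^sup>2 * aa j) * ennreal ((\<eta> v)\<^sup>2)"
      using aa_pos[OF j] by (simp add: ennreal_mult[symmetric] power_mult_distrib mult_ac)
    finally show "en (aa j) (f v j) \<le> ennreal ((K j)\<^sup>2 * aa j) * ennreal ((\<eta> v)\<^sup>2)" .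
  qed
  also have "\<dots> = (\<Sum>j<d. ennreal ((K j)\<^sup>2 * aa j)) * N"
    unfolding vsum_cmult N_def sum_distrib_right ..
  also have "(\<Sum>j<d. ennreal ((K j)\<^sup>2 * aa j)) = ennreal (\<Sum>j<d. (K j)\<^sup>2 * aa j)"
    using aa_pos by (intro sum_ennreal) (auto intro!: mult_nonneg_nonneg intro: less_imp_le)
  finally show ?thesis .
qed

lemma err_le:
  assumes "j < d" "t \<in> {0..aa j}"
  shows "cmod (err v j t) \<le> \<epsilon> * ((6 / (aa j)\<^sup>2 + 12 / aa j) * B) * \<eta> v"
proof -
  have e: "0 \<le> \<epsilon>" using r by (simp add: \<epsilon>_def)
  have "cmod (err v j t) \<le> (\<bar>jump v j\<bar> * \<bar>step'' j t\<bar>) * cmod (\<Phi> j t)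
      + (2 * (\<bar>jump v j\<bar> * \<bar>step' j t\<bar>)) * cmod (\<Phi>' j t)"
    unfolding err_def norm_minus_cancel
    by (rule order.trans[OF norm_triangle_ineq]) (simp add: norm_mult abs_mult)
  also have "\<dots> \<le> ((\<epsilon> * \<eta> v) * (6 / (aa j)\<^sup>2)) * B + (2 * ((\<epsilon> * \<eta> v) * (6 / aa j))) * B"
    using e eta_pos[of v] aa_pos[OF assms(1)]
    by (intro add_mono mult_mono jump_le step_bounds assms B mult_nonneg_nonneg order_refl) auto
  finally show ?thesis by (simp add: algebra_simps)
qed

lemma in_L2_err: "in_L2 d aa err"
proof -
  have "gnorm2 d aa err \<le> ennreal (\<Sum>j<d. (\<epsilon> * ((6 / (aa j)\<^sup>2 + 12 / aa j) * B))\<^sup>2 * aa j) * N"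
    by (intro gnorm2_le_N err_le)
  also have "\<dots> < \<infinity>" using N_finite by (simp add: ennreal_mult_less_top)
  finally show ?thesis unfolding in_L2_iff by (auto intro!: edge_meas_continuous continuous_err)
qed

lemma in_L2_psi: "in_L2 d aa \<psi>"
proof -
  have "cmod (\<psi> v j t) \<le> (B / r) * \<eta> v" if "j < d" "t \<in> {0..aa j}" for v j t
  proof -
    have "0 < r * \<eta> v" using r eta_pos[of v] by simp
    then have c: "0 \<le> cut v j t" using cut_bounds(1)[OF that, of v] by linarith
    then have "cmod (\<psi> v j t) = cut v j t * cmod (\<Phi> j t)" by (simp add: \<psi>_def norm_mult)
    also have "\<dots> \<le> (\<eta> v / r) * B"
      using c eta_pos[of v] r by (intro mult_mono cut_bounds that B) auto
    finally show ?thesis by (simp add: mult.commute)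
  qed
  then have "gnorm2 d aa \<psi> \<le> ennreal (\<Sum>j<d. (B / r)\<^sup>2 * aa j) * N"
    by (intro gnorm2_le_N[where K = "\<lambda>_. B / r"])
  also have "\<dots> < \<infinity>" using N_finite by (simp add: ennreal_mult_less_top)
  finally show ?thesis unfolding in_L2_iff
    by (auto intro!: edge_meas_continuous H2_data_continuous[OF H2_cutoff])
qed

lemma hdom_cutoff: "hdom d aa \<alpha> \<psi> u"
  unfolding hdom_def
proof (intro conjI in_L2_psi exI[of _ D\<psi>] ballI)
  show "in_L2 d aa u" using in_L2_combine[OF in_L2_err in_L2_psi] by (simp add: u_def[abs_def])
next
  fix e assume "e \<in> lat_edges d"
  then show "case e of (v, j) \<Rightarrow> H2_data (aa j) (\<psi> v j) (D\<psi> v j) (u v j)"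
    by (auto simp: lat_edges_eq H2_cutoff)
next
  fix v assume v: "v \<in> V"
  have 1: "\<psi> v j 0 = \<eta> v *\<^sub>R (phase v * z)" if "j < d" for j
    using that by (simp add: \<psi>_def cut_def start)
  \<comment> \<open>The edge arriving at \<open>v\<close> also ends with weight
    \<open>\<eta> v\<close>. As \<open>step'\<close> vanishes at both ends, values and derivatives
    at all edge ends of \<open>v\<close> carry the same factor, and the vertex condition is
    inherited.\<close>
  have cut1: "cut (pred_v v j) j (aa j) = \<eta> v" if "j < d" for j
    using that by (simp add: cut_def jump_def)
  have 2: "\<psi> (pred_v v j) j (aa j) = \<eta> v *\<^sub>R (phase v * z)" if "j < d" for j
    using that by (simp add: \<psi>_def cut1 finish phase_pred cis_mult mult.assoc[symmetric])
  have "(\<Sum>j<d. D\<psi> v j 0 - D\<psi> (pred_v v j) j (aa j))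
      = (\<Sum>j<d. \<eta> v *\<^sub>R (phase v * (\<Phi>' j 0 - cis (- \<theta> j) * \<Phi>' j (aa j))))"
    by (intro sum.cong) (auto simp: D\<psi>_def cut1 phase_pred cut_def[of v _ 0] algebra_simps)
  also have "\<dots> = \<eta> v *\<^sub>R (phase v * (complex_of_real \<alpha> * z))"
    unfolding kirchhoff[symmetric] sum_distrib_left scaleR_right.sum ..
  also have "\<dots> = complex_of_real \<alpha> * (\<eta> v *\<^sub>R (phase v * z))" by (simp add: mult_ac)
  finally show "\<exists>c. (\<forall>j<d. \<psi> v j 0 = c \<and> \<psi> (pred_v v j) j (aa j) = c) \<and>
      (\<Sum>j<d. D\<psi> v j 0 - D\<psi> (pred_v v j) j (aa j)) = complex_of_real \<alpha> * c"
    using 1 2 by (intro exI[of _ "\<eta> v *\<^sub>R (phase v * z)"]) auto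
qed

lemma gnorm2_psi_ge: "(ennreal (r\<^sup>2) * en (aa j0) (\<Phi> j0)) * N \<le> gnorm2 d aa \<psi>"
proof -
  note j = nontrivial(1)
  have "(ennreal (r\<^sup>2) * en (aa j0) (\<Phi> j0)) * N
      = vsum d (\<lambda>v. (ennreal (r\<^sup>2) * en (aa j0) (\<Phi> j0)) * ennreal ((\<eta> v)\<^sup>2))"
    unfolding N_def vsum_cmult ..
  also have "\<dots> \<le> vsum d (\<lambda>v. en (aa j0) (\<psi> v j0))"
  proof (rule vsum_mono)
    fix v
    have "ennreal ((r * \<eta> v)\<^sup>2) * en (aa j0) (\<Phi> j0) = en (aa j0) (\<lambda>t. (r * \<eta> v) *\<^sub>R \<Phi> j0 t)"
      by (intro en_scale[symmetric] edge_meas_continuous continuous j)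
    also have "\<dots> \<le> en (aa j0) (\<psi> v j0)"
      unfolding en_def
    proof (intro nn_integral_mono)
      fix t
      have "ennreal ((cmod ((r * \<eta> v) *\<^sub>R \<Phi> j0 t))\<^sup>2) \<le> ennreal ((cmod (\<psi> v j0 t))\<^sup>2)" if "t \<in> {0..aa j0}"
      proof (intro ennreal_leI power_mono)
        have "0 < r * \<eta> v" using r eta_pos[of v] by simp
        then show "cmod ((r * \<eta> v) *\<^sub>R \<Phi> j0 t) \<le> cmod (\<psi> v j0 t)"
          using cut_bounds(1)[OF j that, of v] by (simp add: \<psi>_def norm_mult mult_right_mono)
      qed auto
      then show "ennreal ((cmod ((r * \<eta> v) *\<^sub>R \<Phi> j0 t))\<^sup>2) * indicator {0..aa j0} t
          \<le> ennreal ((cmod (\<psi> v j0 t))\<^sup>2) * indicator {0..aa j0} t"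
        by (auto simp: indicator_def)
    qed
    finally show "(ennreal (r\<^sup>2) * en (aa j0) (\<Phi> j0)) * ennreal ((\<eta> v)\<^sup>2) \<le> en (aa j0) (\<psi> v j0)"
      by (simp add: power_mult_distrib ennreal_mult mult_ac)
  qed
  also have "\<dots> \<le> gnorm2 d aa \<psi>" by (rule vsum_en_le_gnorm2[OF j])
  finally show ?thesis .
qed

text \<open>\<open>N\<close> is finite and nonzero, so it cancels. The remaining inequality depends
  on \<open>r\<close> only through \<open>r\<^sup>2\<close> and
  \<open>\<epsilon>\<^sup>2\<close>.\<close>

lemma resolvent_bound:
  assumes C: "\<And>\<psi> u. hdom d aa \<alpha> \<psi> u \<Longrightarrow>
    gnorm2 d aa \<psi> \<le> ennreal C * gnorm2 d aa (\<lambda>v j t. - u v j t - complex_of_real (k\<^sup>2) * \<psi> v j t)"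
  shows "ennreal (r\<^sup>2) * en (aa j0) (\<Phi> j0)
    \<le> ennreal C * ennreal (\<epsilon>\<^sup>2 * (\<Sum>j<d. ((6 / (aa j)\<^sup>2 + 12 / aa j) * B)\<^sup>2 * aa j))"
proof -
  have "(ennreal (r\<^sup>2) * en (aa j0) (\<Phi> j0)) * N
      \<le> ennreal C * gnorm2 d aa (\<lambda>v j t. - u v j t - complex_of_real (k\<^sup>2) * \<psi> v j t)"
    using gnorm2_psi_ge C[OF hdom_cutoff] by (rule order.trans)
  also have "(\<lambda>v j t. - u v j t - complex_of_real (k\<^sup>2) * \<psi> v j t) = err"
    by (intro ext) (simp add: u_def scaleR_conv_of_real)
  also have "ennreal C * gnorm2 d aa err
      \<le> ennreal C * (ennreal (\<Sum>j<d. (\<epsilon> * ((6 / (aa j)\<^sup>2 + 12 / aa j) * B))\<^sup>2 * aa j) * N)"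
    by (intro mult_left_mono gnorm2_le_N err_le) auto
  also have "(\<Sum>j<d. (\<epsilon> * ((6 / (aa j)\<^sup>2 + 12 / aa j) * B))\<^sup>2 * aa j)
      = \<epsilon>\<^sup>2 * (\<Sum>j<d. ((6 / (aa j)\<^sup>2 + 12 / aa j) * B)\<^sup>2 * aa j)"
    unfolding sum_distrib_left by (intro sum.cong) (auto simp: power_mult_distrib)
  finally have "N * (ennreal (r\<^sup>2) * en (aa j0) (\<Phi> j0))
      \<le> N * (ennreal C * ennreal (\<epsilon>\<^sup>2 * (\<Sum>j<d. ((6 / (aa j)\<^sup>2 + 12 / aa j) * B)\<^sup>2 * aa j)))"
    by (simp only: mult_ac)
  then show ?thesis using N_nonzero N_finite by (simp add: ennreal_mult_le_mult_iff)
qed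

end

context bloch_solution begin

text \<open>As \<open>r\<close> tends to 1, the left side of \<open>resolvent_bound\<close> tends to
  a positive number and the right side to 0.\<close>

theorem not_resolvent: "\<not> resolvent_pt d aa \<alpha> (complex_of_real (k\<^sup>2))"
proof
  assume "resolvent_pt d aa \<alpha> (complex_of_real (k\<^sup>2))"
  then obtain C where C: "\<And>\<psi> u. hdom d aa \<alpha> \<psi> u \<Longrightarrow>
    gnorm2 d aa \<psi> \<le> ennreal C * gnorm2 d aa (\<lambda>v j t. - u v j t - complex_of_real (k\<^sup>2) * \<psi> v j t)"
    unfolding resolvent_pt_def by blast
  obtain B where B: "0 \<le> B" "\<And>j t. j < d \<Longrightarrow> t \<in> {0..aa j} \<Longrightarrow> cmod (\<Phi> j t) \<le> B \<and> cmod (\<Phi>' j t) \<le> B"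
    by (rule amplitude_bound) blast
  define L where "L = (\<Sum>j<d. ((6 / (aa j)\<^sup>2 + 12 / aa j) * B)\<^sup>2 * aa j)"
  have L: "0 \<le> L" unfolding L_def using aa_pos by (intro sum_nonneg mult_nonneg_nonneg) (auto intro: less_imp_le)
  have bound: "ennreal (r\<^sup>2) * en (aa j0) (\<Phi> j0) \<le> ennreal C * ennreal ((1 / r - 1)\<^sup>2 * L)"
    if r: "0 < r" "r < 1" for r
  proof -
    interpret bloch_cutoff d aa \<alpha> k \<Phi> \<Phi>' \<theta> z j0 r B
      using r B by unfold_locales auto
    show ?thesis using resolvent_bound[OF C] by (simp add: L_def \<epsilon>_def)
  qed
  have "en (aa j0) (\<Phi> j0) < top"
  proof -
    have "en (aa j0) (\<Phi> j0) \<le> ennreal (B\<^sup>2) * ennreal (aa j0)"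
      using B nontrivial(1) aa_pos[OF nontrivial(1)] by (intro en_bound ennreal_leI power_mono) auto
    also have "\<dots> < top" by (simp add: ennreal_mult_less_top)
    finally show ?thesis .
  qed
  then obtain e where e: "en (aa j0) (\<Phi> j0) = ennreal e" "0 < e"
    using nontrivial(2) by (cases "en (aa j0) (\<Phi> j0)") (auto simp: less_le)
  \<comment> \<open>A negative \<open>C\<close> becomes 0 under \<open>ennreal\<close>, hence the
    maximum.\<close>
  define X where "X = max 0 C * L"
  have X: "0 \<le> X" using L by (simp add: X_def)
  \<comment> \<open>With \<open>r = 1 - \<delta>\<close> the left side is at least
    \<open>e / 4\<close>. As \<open>\<delta> \<le> 1 / 2\<close>, the right side is at most
    \<open>4 * \<delta>\<^sup>2 * X \<le> 2 * \<delta> * X\<close>, which the second entry of the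
    minimum keeps below \<open>e / 16\<close>; \<open>X + 1\<close> avoids dividing by 0.\<close>
  define \<delta> where "\<delta> = min (1 / 2) (e / (32 * (X + 1)))"
  have "0 < \<delta>" using e X by (simp add: \<delta>_def)
  moreover have "\<delta> \<le> 1 / 2" unfolding \<delta>_def by (rule min.cobounded1)
  ultimately have \<delta>: "0 < \<delta>" "\<delta> \<le> 1 / 2" .
  have "\<delta> \<le> e / (32 * (X + 1))" by (simp add: \<delta>_def)
  then have \<delta>X: "32 * (\<delta> * (X + 1)) \<le> e" using X by (simp add: pos_le_divide_eq mult_ac)
  define r where "r = 1 - \<delta>"
  have r: "1 / 2 \<le> r" "0 < r" "r < 1" using \<delta> by (auto simp: r_def)
  have "ennreal (r\<^sup>2 * e) \<le> ennreal ((1 / r - 1)\<^sup>2 * X)"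
  proof -
    have "ennreal (r\<^sup>2 * e) = ennreal (r\<^sup>2) * en (aa j0) (\<Phi> j0)" using e by (simp add: ennreal_mult)
    also have "\<dots> \<le> ennreal C * ennreal ((1 / r - 1)\<^sup>2 * L)" using bound[OF r(2,3)] .
    also have "ennreal C = ennreal (max 0 C)" by (simp add: max_def ennreal_neg)
    also have "ennreal (max 0 C) * ennreal ((1 / r - 1)\<^sup>2 * L) = ennreal ((1 / r - 1)\<^sup>2 * X)"
      using L by (subst ennreal_mult[symmetric]) (auto simp: X_def mult_ac)
    finally show ?thesis .
  qed
  then have "r\<^sup>2 * e \<le> (1 / r - 1)\<^sup>2 * X" using X by (subst (asm) ennreal_le_iff) auto
  moreover have "(1 / 2)\<^sup>2 * e \<le> r\<^sup>2 * e" using r e by (intro mult_right_mono power_mono) auto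
  moreover have "(1 / r - 1)\<^sup>2 * X \<le> (2 * \<delta>)\<^sup>2 * X"
  proof (intro mult_right_mono power_mono X)
    have "1 / r - 1 = \<delta> / r" using r by (simp add: r_def field_simps)
    also have "\<dots> \<le> \<delta> / (1 / 2)" using r \<delta> by (intro divide_left_mono) auto
    finally show "1 / r - 1 \<le> 2 * \<delta>" by simp
    show "0 \<le> 1 / r - 1" using r by simp
  qed
  moreover have "(2 * \<delta>)\<^sup>2 * X \<le> 2 * (\<delta> * X)"
  proof -
    have "\<delta> * (\<delta> * X) \<le> (1 / 2) * (\<delta> * X)" using \<delta> X by (intro mult_right_mono) auto
    then show ?thesis by (simp add: power2_eq_square mult_ac)
  qed
  moreover have "\<delta> * X \<le> \<delta> * (X + 1)" using \<delta> by simp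
  ultimately have "(1 / 2)\<^sup>2 * e \<le> e / 16" using \<delta>X by linarith
  then show False using e by (simp add: power2_eq_square)
qed

end

text \<open>The dispersion relation asks for phases with \<open>m\<close> equal to the sum of
  \<open>2 * cos (\<theta> j) / sn k (aa j)\<close>. Taking each cosine to be \<open>w\<close> times
  the sign of \<open>sn\<close> aligns all terms, so the sum is \<open>2 * w * S\<close>, and
  \<open>w = m / (2 * S)\<close> is admissible exactly when
  \<open>\<bar>m\<bar> \<le> 2 * S\<close>.\<close>

theorem band_in_spectrum:
  assumes d: "0 < d" and aa: "\<And>j. j < d \<Longrightarrow> 0 < aa j" and nz: "\<And>j. j < d \<Longrightarrow> sn k (aa j) \<noteq> 0"
    and band: "\<bar>\<alpha> + 2 * (\<Sum>j<d. cs k (aa j) / sn k (aa j))\<bar> \<le> 2 * (\<Sum>j<d. 1 / \<bar>sn k (aa j)\<bar>)"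
  shows "\<not> resolvent_pt d aa \<alpha> (complex_of_real (k\<^sup>2))"
proof -
  define m where "m = \<alpha> + 2 * (\<Sum>j<d. cs k (aa j) / sn k (aa j))"
  define S where "S = (\<Sum>j<d. 1 / \<bar>sn k (aa j)\<bar>)"
  have S: "0 < S" unfolding S_def using d nz by (intro sum_pos) auto
  define w where "w = m / (2 * S)"
  have w: "\<bar>w\<bar> \<le> 1" using band S by (simp add: w_def m_def[symmetric] S_def[symmetric] abs_mult)
  define \<theta> where "\<theta> j = arccos (w * sgn (sn k (aa j)))" for j
  have cos: "cos (\<theta> j) = w * sgn (sn k (aa j))" if "j < d" for j
  proof -
    have "\<bar>w * sgn (sn k (aa j))\<bar> \<le> 1" using w by (simp add: abs_mult abs_sgn_eq)
    then show ?thesis unfolding \<theta>_def by (intro cos_arccos) linarith+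
  qed
  \<comment> \<open>The initial slope for which the profile starts at 1 and ends at
    \<open>cis (\<theta> j)\<close>.\<close>
  define b where "b j = (1 / sn k (aa j)) *\<^sub>R (cis (\<theta> j) - complex_of_real (cs k (aa j)))" for j
  define \<Phi> where "\<Phi> j t = cs k t *\<^sub>R 1 + sn k t *\<^sub>R b j" for j t
  define \<Phi>' where "\<Phi>' j t = cs k t *\<^sub>R b j - (k\<^sup>2 * sn k t) *\<^sub>R 1" for j t
  have c: "continuous_on X (\<Phi> j)" for X j unfolding \<Phi>_def by (intro continuous_intros)
  have end': "\<Phi>' j 0 - cis (- \<theta> j) * \<Phi>' j (aa j) = complex_of_real (2 * w * (1 / \<bar>sn k (aa j)\<bar>) - 2 * (cs k (aa j) / sn k (aa j)))"
    if j: "j < d" for j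
  proof -
    define s where "s = complex_of_real (sn k (aa j))"
    define e where "e = complex_of_real (cs k (aa j))"
    have s: "s \<noteq> 0" using nz[OF j] by (simp add: s_def)
    have es: "e\<^sup>2 + (complex_of_real k)\<^sup>2 * s\<^sup>2 = 1"
      using arg_cong[OF cs_sn[of k "aa j"], of complex_of_real] by (simp add: e_def s_def)
    have zz: "cis (- \<theta> j) * cis (\<theta> j) = 1" by (simp add: cis_mult)
    have sum: "cis (\<theta> j) + cis (- \<theta> j) = complex_of_real (2 * cos (\<theta> j))"
      by (simp add: complex_eq_iff)
    have "s * \<Phi>' j (aa j) = e * (cis (\<theta> j) - e) - (complex_of_real k)\<^sup>2 * s\<^sup>2"
      using s by (simp add: \<Phi>'_def b_def scaleR_conv_of_real s_def[symmetric] e_def[symmetric] field_simps power2_eq_square)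
    also have "\<dots> = e * cis (\<theta> j) - (e\<^sup>2 + (complex_of_real k)\<^sup>2 * s\<^sup>2)" by (simp add: algebra_simps power2_eq_square)
    also have "\<dots> = e * cis (\<theta> j) - 1" unfolding es ..
    finally have p: "s * \<Phi>' j (aa j) = e * cis (\<theta> j) - 1" .
    have "s * \<Phi>' j 0 = cis (\<theta> j) - e"
      using s by (simp add: \<Phi>'_def b_def scaleR_conv_of_real s_def[symmetric] e_def[symmetric])
    then have "s * (\<Phi>' j 0 - cis (- \<theta> j) * \<Phi>' j (aa j)) = cis (\<theta> j) - e - cis (- \<theta> j) * (e * cis (\<theta> j) - 1)"
      unfolding p[symmetric] by (simp add: algebra_simps)
    also have "\<dots> = cis (\<theta> j) + cis (- \<theta> j) - e - e * (cis (- \<theta> j) * cis (\<theta> j))" by (simp add: algebra_simps)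
    also have "\<dots> = complex_of_real (2 * cos (\<theta> j)) - 2 * e" unfolding zz sum by simp
    finally have "\<Phi>' j 0 - cis (- \<theta> j) * \<Phi>' j (aa j) = (complex_of_real (2 * cos (\<theta> j)) - 2 * e) / s"
      using s by (simp add: field_simps)
    also have "\<dots> = complex_of_real ((2 * cos (\<theta> j) - 2 * cs k (aa j)) / sn k (aa j))"
      by (simp add: e_def s_def)
    also have "(2 * cos (\<theta> j) - 2 * cs k (aa j)) / sn k (aa j)
        = 2 * w * (1 / \<bar>sn k (aa j)\<bar>) - 2 * (cs k (aa j) / sn k (aa j))"
      unfolding cos[OF j] using nz[OF j] by (simp add: diff_divide_distrib sgn_if abs_if)
    finally show ?thesis .
  qed
  interpret bloch_solution d aa \<alpha> k \<Phi> \<Phi>' \<theta> 1 0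
  proof
    fix j t assume j: "j < d"
    show "0 < aa j" using j by (rule aa)
    show "(\<Phi> j has_vector_derivative \<Phi>' j t) (at t within {0..aa j})"
      "(\<Phi>' j has_vector_derivative - k\<^sup>2 *\<^sub>R \<Phi> j t) (at t within {0..aa j})"
      unfolding \<Phi>_def \<Phi>'_def
      by (auto intro!: derivative_eq_intros sn_deriv cs_deriv simp: algebra_simps)
    show "\<Phi> j 0 = 1" by (simp add: \<Phi>_def)
    show "\<Phi> j (aa j) = cis (\<theta> j) * 1"
      using nz[OF j] by (simp add: \<Phi>_def b_def scaleR_conv_of_real)
  next
    have "(\<Sum>j<d. 2 * w * (1 / \<bar>sn k (aa j)\<bar>) - 2 * (cs k (aa j) / sn k (aa j))) = 2 * w * S - (m - \<alpha>)"
      by (simp add: sum_subtractf sum_distrib_left S_def m_def)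
    also have "\<dots> = \<alpha>" using S by (simp add: w_def)
    finally have \<alpha>: "(\<Sum>j<d. 2 * w * (1 / \<bar>sn k (aa j)\<bar>) - 2 * (cs k (aa j) / sn k (aa j))) = \<alpha>" .
    have "(\<Sum>j<d. \<Phi>' j 0 - cis (- \<theta> j) * \<Phi>' j (aa j))
        = (\<Sum>j<d. complex_of_real (2 * w * (1 / \<bar>sn k (aa j)\<bar>) - 2 * (cs k (aa j) / sn k (aa j))))"
      by (intro sum.cong refl end') simp
    then show "(\<Sum>j<d. \<Phi>' j 0 - cis (- \<theta> j) * \<Phi>' j (aa j)) = complex_of_real \<alpha> * 1"
      unfolding of_real_sum[symmetric] \<alpha> by simp
  next
    show "en (aa 0) (\<Phi> 0) \<noteq> 0"
      using aa[OF d] by (intro en_nonzero[OF c, of _ 0]) (auto simp: \<Phi>_def)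
  qed (rule d)
  show ?thesis by (rule not_resolvent)
qed

text \<open>Sine waves on the edges in direction \<open>j0\<close>, zero on all others. They vanish
  at every vertex, and the phase \<open>k * aa j0\<close> is a multiple of \<pi> that matches the
  sign change per edge, so incoming and outgoing derivatives cancel.\<close>

theorem dirichlet_in_spectrum:
  assumes aa: "\<And>j. j < d \<Longrightarrow> 0 < aa j" and j0: "j0 < d" and zero: "sn k (aa j0) = 0" and k: "k \<noteq> 0"
  shows "\<not> resolvent_pt d aa \<alpha> (complex_of_real (k\<^sup>2))"
proof -
  define I where "I j = (if j = j0 then 1 else 0 :: complex)" for j
  define \<Phi> where "\<Phi> j t = sn k t *\<^sub>R I j" for j t
  define \<Phi>' where "\<Phi>' j t = cs k t *\<^sub>R I j" for j t
  define \<theta> where "\<theta> j = k * aa j" for j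
  have sin0: "sin (k * aa j0) = 0" using zero k by (simp add: sn_def)
  have cc: "cis (- \<theta> j0) * complex_of_real (cs k (aa j0)) = 1"
  proof -
    have "cis (- \<theta> j0) = complex_of_real (cs k (aa j0))"
      using sin0 by (simp add: complex_eq_iff \<theta>_def cs_def)
    moreover have "(cs k (aa j0))\<^sup>2 = 1" using cs_sn[of k "aa j0"] zero by simp
    ultimately show ?thesis by (simp add: power2_eq_square flip: of_real_mult)
  qed
  interpret bloch_solution d aa \<alpha> k \<Phi> \<Phi>' \<theta> 0 j0
  proof
    fix j t assume j: "j < d"
    show "0 < aa j" using j by (rule aa)
    show "(\<Phi> j has_vector_derivative \<Phi>' j t) (at t within {0..aa j})"
      "(\<Phi>' j has_vector_derivative - k\<^sup>2 *\<^sub>R \<Phi> j t) (at t within {0..aa j})"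
      unfolding \<Phi>_def \<Phi>'_def
      by (auto intro!: derivative_eq_intros sn_deriv cs_deriv simp: algebra_simps)
    show "\<Phi> j 0 = 0" by (simp add: \<Phi>_def)
    show "\<Phi> j (aa j) = cis (\<theta> j) * 0" using zero by (simp add: \<Phi>_def I_def)
  next
    have "(\<Sum>j<d. \<Phi>' j 0 - cis (- \<theta> j) * \<Phi>' j (aa j)) = (\<Sum>j<d. 0)"
    proof (intro sum.cong refl)
      fix j show "\<Phi>' j 0 - cis (- \<theta> j) * \<Phi>' j (aa j) = 0"
        using cc by (simp add: \<Phi>'_def I_def scaleR_conv_of_real)
    qed
    then show "(\<Sum>j<d. \<Phi>' j 0 - cis (- \<theta> j) * \<Phi>' j (aa j)) = complex_of_real \<alpha> * 0" by simp
  next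
    \<comment> \<open>A point of the edge with \<open>\<bar>k\<bar> * t \<le> 1 < pi\<close>, where
      the sine is certainly positive.\<close>
    define t where "t = min (aa j0) (1 / \<bar>k\<bar>)"
    have t: "0 < t" "t \<le> aa j0" "t \<le> 1 / \<bar>k\<bar>" using aa[OF j0] k by (auto simp: t_def)
    then have "0 < \<bar>k\<bar> * t" "\<bar>k\<bar> * t \<le> 1" using k by (auto simp: pos_le_divide_eq mult.commute)
    then have "0 < sin (\<bar>k\<bar> * t)" using pi_gt3 by (intro sin_gt_zero) auto
    then have "sn k t \<noteq> 0" using k by (auto simp: sn_def abs_if split: if_splits)
    moreover have "continuous_on {0..aa j0} (\<Phi> j0)" unfolding \<Phi>_def by (intro continuous_intros)
    ultimately show "en (aa j0) (\<Phi> j0) \<noteq> 0"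
      using aa[OF j0] t by (intro en_nonzero[of _ _ t]) (auto simp: \<Phi>_def I_def)
  qed (rule j0)
  show ?thesis by (rule not_resolvent)
qed

section \<open>Lower endpoints of gaps\<close>

definition tan_frac :: "real \<Rightarrow> real" where "tan_frac y = tan (pi / 2 * frac y)"

text \<open>Both \<open>\<bar>sin\<bar>\<close> and the cotangent have period \<pi>, so
  \<open>x\<close> may be replaced by \<open>y\<close> in the open interval from 0 to \<pi>. There
  \<open>tan (y / 2) = (1 - cos y) / sin y\<close>.\<close>

lemma tan_frac_eq:
  assumes "frac (x / pi) \<noteq> 0"
  shows "sin x \<noteq> 0" "tan_frac (x / pi) = 1 / \<bar>sin x\<bar> - cos x / sin x"
proof -
  define n where "n = \<lfloor>x / pi\<rfloor>"
  define y where "y = pi * frac (x / pi)"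
  have "0 < frac (x / pi)" "frac (x / pi) < 1" using assms frac_ge_0[of "x / pi"] frac_lt_1[of "x / pi"] by linarith+
  then have y: "0 < y" "y < pi" by (auto simp: y_def)
  then have sy: "0 < sin y" by (rule sin_gt_zero)
  have x: "x = y + of_int n * pi" by (simp add: y_def n_def frac_def algebra_simps)
  have sgn: "(\<exists>s\<in>{1, -1}. sin x = s * sin y \<and> cos x = s * cos y)"
  proof -
    have s0: "sin (of_int n * pi) = 0" unfolding sin_zero_iff_int2 by blast
    moreover have "cos (of_int n * pi) = 1 \<or> cos (of_int n * pi) = - 1"
      using sin_cos_squared_add[of "of_int n * pi"] s0 by (simp add: power2_eq_1_iff)
    ultimately show ?thesis unfolding x by (auto simp: sin_add cos_add)
  qed
  then show nz: "sin x \<noteq> 0" using sy by auto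
  have "tan_frac (x / pi) = tan (y / 2)" by (simp add: tan_frac_def y_def)
  also have "\<dots> = (1 - cos y) / sin y"
  proof -
    have y2: "sin y = 2 * sin (y / 2) * cos (y / 2)" "1 - cos y = 2 * (sin (y / 2))\<^sup>2"
      using sin_double[of "y / 2"] cos_double_sin[of "y / 2"] by simp_all
    then have "sin (y / 2) \<noteq> 0" "cos (y / 2) \<noteq> 0" using sy by auto
    then show ?thesis unfolding y2 by (simp add: tan_def power2_eq_square)
  qed
  also have "\<dots> = 1 / \<bar>sin x\<bar> - cos x / sin x" using sgn sy by (auto simp: diff_divide_distrib)
  finally show "tan_frac (x / pi) = 1 / \<bar>sin x\<bar> - cos x / sin x" .
qed

section \<open>Bands and gaps of the lattice with two edge lengths\<close>

locale rectangular_lattice =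
  fixes d :: nat and \<gamma> a \<alpha> :: real
  assumes d: "2 \<le> d" and gamma_pos: "0 < \<gamma>" and a_pos: "0 < a" and alpha_pos: "0 < \<alpha>"
begin

abbreviation lengths :: "nat \<Rightarrow> real" where "lengths \<equiv> \<lambda>j. if j = 0 then \<gamma> * a else a"

abbreviation spec :: "complex set" where "spec \<equiv> spectrum_H d lengths \<alpha>"

definition p :: "real \<Rightarrow> real" where "p k = \<gamma> * a * k / pi"
definition q :: "real \<Rightarrow> real" where "q k = a * k / pi"

text \<open>Where neither fractional part vanishes, \<open>2 * k * F k\<close> is the hopping total
  minus the diagonal of the vertex equation. Where one vanishes, \<open>F\<close> takes its limit
  from the right.\<close>

definition F :: "real \<Rightarrow> real" where
  "F k = tan_frac (p k) + (real d - 1) * tan_frac (q k) - \<alpha> / (2 * k)"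

lemma lengths_pos: "0 < lengths j" using gamma_pos a_pos by simp

lemma sum_lengths: "(\<Sum>j<d. g (lengths j)) = g (\<gamma> * a) + (real d - 1) * (g a :: real)"
proof -
  have "(\<Sum>j<d. g (lengths j)) = g (lengths 0) + (\<Sum>j\<in>{..<d} - {0}. g (lengths j))"
    using d by (intro sum.remove) auto
  also have "(\<Sum>j\<in>{..<d} - {0}. g (lengths j)) = (\<Sum>j\<in>{..<d} - {0}. g a)"
    by (intro sum.cong) auto
  also have "\<dots> = (real d - 1) * g a" using d by (simp add: of_nat_diff)
  finally show ?thesis by simp
qed

text \<open>At \<open>k = 0\<close> diagonal and hopping sums coincide, so
  \<open>\<alpha> > 0\<close> alone gives strict dominance.\<close>

lemma zero_not_spec: "0 \<notin> spec"
proof -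
  have "2 * (\<Sum>j<d. 1 / \<bar>sn 0 (lengths j)\<bar>) < \<bar>\<alpha> + 2 * (\<Sum>j<d. cs 0 (lengths j) / sn 0 (lengths j))\<bar>"
  proof -
    have "(\<Sum>j<d. 1 / \<bar>sn 0 (lengths j)\<bar>) = (\<Sum>j<d. 1 / lengths j)"
      "(\<Sum>j<d. cs 0 (lengths j) / sn 0 (lengths j)) = (\<Sum>j<d. 1 / lengths j)"
      using gamma_pos a_pos by (auto intro!: sum.cong simp: sn_def cs_def abs_mult)
    moreover have "0 \<le> (\<Sum>j<d. 1 / lengths j)" using gamma_pos a_pos by (intro sum_nonneg) auto
    ultimately show ?thesis using alpha_pos by simp
  qed
  then interpret lattice_gap d lengths \<alpha> 0
    using d lengths_pos by unfold_locales (auto simp: sn_def less_imp_neq[symmetric])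
  show ?thesis using resolvent by (simp add: spectrum_H_def)
qed

text \<open>The band condition is two-sided, but its lower half always holds: a cotangent is at
  least \<open>- 1 / \<bar>sin\<bar>\<close>, and \<open>\<alpha>\<close> is positive. What remains
  is \<open>0 \<le> F k\<close>.\<close>

lemma spec_iff:
  assumes k: "0 < k"
  shows "complex_of_real (k\<^sup>2) \<in> spec \<longleftrightarrow> frac (p k) = 0 \<or> frac (q k) = 0 \<or> 0 \<le> F k"
proof (cases "frac (p k) = 0 \<or> frac (q k) = 0")
  case True
  have zero: "sn k l = 0" if "frac (l * k / pi) = 0" for l
  proof -
    have "l * k / pi \<in> \<int>" using that by simp
    then obtain n where "l * k / pi = of_int n" by (elim Ints_cases)
    then have "k * l = of_int n * pi" by (simp add: field_simps)
    then have "sin (k * l) = 0" unfolding sin_zero_iff_int2 by blast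
    then show ?thesis using k by (simp add: sn_def)
  qed
  have "\<exists>j<d. sn k (lengths j) = 0"
    using True
  proof
    assume "frac (p k) = 0"
    then show ?thesis using zero[of "\<gamma> * a"] d by (intro exI[of _ 0]) (auto simp: p_def)
  next
    assume "frac (q k) = 0"
    then show ?thesis using zero[of a] d by (intro exI[of _ 1]) (auto simp: q_def mult.commute)
  qed
  then obtain j where j: "j < d" "sn k (lengths j) = 0" by blast
  have "\<not> resolvent_pt d lengths \<alpha> (complex_of_real (k\<^sup>2))"
    using k by (intro dirichlet_in_spectrum[of d lengths j, OF lengths_pos j]) auto
  then show ?thesis using True unfolding spectrum_H_def by blast
next
  case False
  define x y where "x = k * (\<gamma> * a)" and "y = k * a"
  have "frac (x / pi) \<noteq> 0" "frac (y / pi) \<noteq> 0"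
    using False by (auto simp: p_def q_def x_def y_def mult_ac)
  note X = tan_frac_eq[OF this(1)] and Y = tan_frac_eq[OF this(2)]
  have px: "p k = x / pi" "q k = y / pi" by (simp_all add: p_def q_def x_def y_def mult_ac)
  define e where "e = real d - 1"
  have e: "1 \<le> e" using d by (simp add: e_def)
  define R where "R = 1 / \<bar>sin x\<bar> + e * (1 / \<bar>sin y\<bar>)"
  define S where "S = cos x / sin x + e * (cos y / sin y)"
  have R: "(\<Sum>j<d. 1 / \<bar>sn k (lengths j)\<bar>) = k * R"
    unfolding sum_lengths[of "\<lambda>l. 1 / \<bar>sn k l\<bar>"] using k by (simp add: sn_def R_def e_def x_def y_def abs_mult algebra_simps)
  have S: "(\<Sum>j<d. cs k (lengths j) / sn k (lengths j)) = k * S"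
    unfolding sum_lengths[of "\<lambda>l. cs k l / sn k l"] using k by (simp add: sn_def cs_def S_def e_def x_def y_def algebra_simps)
  have cot: "- (1 / \<bar>sin z\<bar>) \<le> cos z / sin z" for z :: real
  proof -
    have "\<bar>cos z / sin z\<bar> \<le> 1 / \<bar>sin z\<bar>" by (simp add: divide_right_mono)
    then show ?thesis by linarith
  qed
  have "- (e * (1 / \<bar>sin y\<bar>)) \<le> e * (cos y / sin y)"
    using mult_left_mono[OF cot[of y], of e] e by simp
  then have "- R \<le> S" using cot[of x] by (simp add: R_def S_def)
  then have "k * (- R) \<le> k * S" using k by (intro mult_left_mono) auto
  then have low: "- (2 * (k * R)) < \<alpha> + 2 * (k * S)" using alpha_pos by simp
  have F: "F k = R - S - \<alpha> / (2 * k)"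
    unfolding F_def px X(2) Y(2) R_def S_def e_def by (simp add: algebra_simps)
  have iff: "0 \<le> F k \<longleftrightarrow> \<alpha> + 2 * (k * S) \<le> 2 * (k * R)"
  proof -
    have "0 \<le> F k \<longleftrightarrow> \<alpha> / (2 * k) \<le> R - S" unfolding F by linarith
    also have "\<dots> \<longleftrightarrow> \<alpha> \<le> (R - S) * (2 * k)" using k by (simp add: pos_divide_le_eq)
    also have "\<dots> \<longleftrightarrow> \<alpha> + 2 * (k * S) \<le> 2 * (k * R)" by (simp add: algebra_simps)
    finally show ?thesis .
  qed
  have nz: "sn k (lengths j) \<noteq> 0" for j
    using X(1) Y(1) k by (simp add: sn_def x_def y_def)
  show ?thesis
  proof (cases "0 \<le> F k")
    case True
    then have "\<bar>\<alpha> + 2 * (k * S)\<bar> \<le> 2 * (k * R)" using iff low by linarith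
    then have "\<not> resolvent_pt d lengths \<alpha> (complex_of_real (k\<^sup>2))"
      using d lengths_pos nz by (intro band_in_spectrum) (auto simp only: R S)
    then show ?thesis using True by (simp add: spectrum_H_def)
  next
    case neg: False
    then have "2 * (k * R) < \<bar>\<alpha> + 2 * (k * S)\<bar>" using iff by linarith
    then interpret lattice_gap d lengths \<alpha> k
      using d lengths_pos nz by unfold_locales (auto simp only: R S)
    show ?thesis using resolvent False neg by (simp add: spectrum_H_def)
  qed
qed

text \<open>The first point to the right of \<open>k\<close> at which the sine of one of the edge
  lengths vanishes.\<close>

definition next_point :: "real \<Rightarrow> real" where
  "next_point k = min ((of_int \<lfloor>p k\<rfloor> + 1) * pi / (\<gamma> * a)) ((of_int \<lfloor>q k\<rfloor> + 1) * pi / a)"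

lemma next_point_greater: "k < next_point k"
proof -
  have "p k < of_int \<lfloor>p k\<rfloor> + 1" "q k < of_int \<lfloor>q k\<rfloor> + 1" by linarith+
  then have "p k * pi / (\<gamma> * a) < (of_int \<lfloor>p k\<rfloor> + 1) * pi / (\<gamma> * a)" "q k * pi / a < (of_int \<lfloor>q k\<rfloor> + 1) * pi / a"
    using gamma_pos a_pos by (intro divide_strict_right_mono mult_strict_right_mono; simp)+
  moreover have "p k * pi / (\<gamma> * a) = k" "q k * pi / a = k" using gamma_pos a_pos by (simp_all add: p_def q_def)
  ultimately show ?thesis by (simp add: next_point_def)
qed

lemma next_point_frac: "frac (p (next_point k)) = 0 \<or> frac (q (next_point k)) = 0"
proof -
  have "p ((of_int n + 1) * pi / (\<gamma> * a)) = of_int (n + 1)" "q ((of_int n + 1) * pi / a) = of_int (n + 1)" for n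
    using gamma_pos a_pos by (simp_all add: p_def q_def)
  then have "frac (p ((of_int n + 1) * pi / (\<gamma> * a))) = 0" "frac (q ((of_int n + 1) * pi / a)) = 0" for n
    by (simp_all only: frac_of_int)
  then show ?thesis unfolding next_point_def by (auto simp: min_def)
qed

lemma frac_between:
  assumes "k \<le> x" "x < next_point k"
  shows "frac (p x) = p x - of_int \<lfloor>p k\<rfloor>" "frac (q x) = q x - of_int \<lfloor>q k\<rfloor>"
proof -
  have "p k \<le> p x" "q k \<le> q x" using assms gamma_pos a_pos
    by (auto simp: p_def q_def divide_right_mono)
  moreover have "p x < of_int \<lfloor>p k\<rfloor> + 1" "q x < of_int \<lfloor>q k\<rfloor> + 1"
    using assms gamma_pos a_pos
    by (auto simp: next_point_def p_def q_def pos_divide_less_eq pos_less_divide_eq mult_ac)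
  ultimately have "\<lfloor>p x\<rfloor> = \<lfloor>p k\<rfloor>" "\<lfloor>q x\<rfloor> = \<lfloor>q k\<rfloor>" by linarith+
  then show "frac (p x) = p x - of_int \<lfloor>p k\<rfloor>" "frac (q x) = q x - of_int \<lfloor>q k\<rfloor>"
    by (simp_all add: frac_def)
qed

text \<open>The interval is closed at \<open>k\<close>, even if a fractional part vanishes there,
  since \<open>frac\<close> is continuous from the right. This lets the sign of \<open>F k\<close>
  govern the energies just above \<open>k\<^sup>2\<close>.\<close>

lemma F_strict_mono:
  assumes k: "0 < k" and x: "k \<le> x" "x < y" "y < next_point k"
  shows "F x < F y"
proof -
  have p: "p x < p y" and q: "q x < q y" using x gamma_pos a_pos
    by (auto simp: p_def q_def divide_strict_right_mono)
  have "frac (p x) < frac (p y)" "frac (q x) < frac (q y)"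
    using frac_between[of k x] frac_between[of k y] x p q by auto
  then have "tan_frac (p x) < tan_frac (p y)" "tan_frac (q x) < tan_frac (q y)"
    unfolding tan_frac_def using frac_lt_1[of "p y"] frac_lt_1[of "q y"] frac_ge_0[of "p x"] frac_ge_0[of "q x"]
    by (auto intro!: tan_monotone intro: order.strict_trans2[of _ 0])
  moreover have "(real d - 1) * tan_frac (q x) \<le> (real d - 1) * tan_frac (q y)"
    using calculation d by (intro mult_left_mono) auto
  moreover have "\<alpha> / (2 * y) < \<alpha> / (2 * x)"
    using k x alpha_pos by (intro divide_strict_left_mono) auto
  ultimately show ?thesis by (simp add: F_def)
qed

lemma frac_nonzero_between:
  assumes "k < x" "x < next_point k" shows "frac (p x) \<noteq> 0" "frac (q x) \<noteq> 0"
proof -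
  have "p k < p x" "q k < q x" using assms gamma_pos a_pos
    by (auto simp: p_def q_def divide_strict_right_mono)
  moreover have "of_int \<lfloor>p k\<rfloor> \<le> p k" "of_int \<lfloor>q k\<rfloor> \<le> q k" by linarith+
  moreover have "frac (p x) = p x - of_int \<lfloor>p k\<rfloor>" "frac (q x) = q x - of_int \<lfloor>q k\<rfloor>"
    using frac_between[of k x] assms by auto
  ultimately show "frac (p x) \<noteq> 0" "frac (q x) \<noteq> 0" by linarith+
qed

lemma F_continuous:
  assumes k: "0 < k" and x: "x < next_point k"
  shows "continuous_on {k..x} F"
proof -
  have cos_nz: "cos (pi / 2 * frac z) \<noteq> 0" for z
  proof -
    have "0 \<le> frac z" "frac z < 1" by (auto simp: frac_lt_1)
    then have "0 < cos (pi / 2 * frac z)"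
      by (intro cos_gt_zero_pi) (auto intro: order.strict_trans2[of _ 0])
    then show ?thesis by simp
  qed
  have pq: "continuous_on {k..x} p" "continuous_on {k..x} q"
    unfolding p_def[abs_def] q_def[abs_def] divide_inverse by (intro continuous_intros)+
  have c1: "continuous_on {k..x} (\<lambda>y. tan (pi / 2 * (p y - of_int \<lfloor>p k\<rfloor>)))"
  proof (rule Transcendental.continuous_on_tan)
    show "\<forall>y\<in>{k..x}. cos (pi / 2 * (p y - of_int \<lfloor>p k\<rfloor>)) \<noteq> 0"
      using cos_nz frac_between(1)[of k] x by (metis atLeastAtMost_iff order.strict_trans1)
  qed (intro continuous_intros pq)
  have c2: "continuous_on {k..x} (\<lambda>y. tan (pi / 2 * (q y - of_int \<lfloor>q k\<rfloor>)))"
  proof (rule Transcendental.continuous_on_tan)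
    show "\<forall>y\<in>{k..x}. cos (pi / 2 * (q y - of_int \<lfloor>q k\<rfloor>)) \<noteq> 0"
      using cos_nz frac_between(2)[of k] x by (metis atLeastAtMost_iff order.strict_trans1)
  qed (intro continuous_intros pq)
  have "continuous_on {k..x} (\<lambda>x. tan (pi / 2 * (p x - of_int \<lfloor>p k\<rfloor>))
      + (real d - 1) * tan (pi / 2 * (q x - of_int \<lfloor>q k\<rfloor>)) - \<alpha> / (2 * x))"
    using k by (intro continuous_on_diff continuous_on_add continuous_on_mult continuous_on_divide
        continuous_on_const continuous_on_id c1 c2) auto
  also have "?this \<longleftrightarrow> ?thesis"
    using x frac_between[of k] by (intro continuous_on_cong) (auto simp: F_def tan_frac_def)
  finally show ?thesis .
qed

text \<open>For the forward direction, a point of the gap close to \<open>k\<close> has negative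
  \<open>F\<close>, hence so has \<open>k\<close>; as \<open>k\<^sup>2\<close> is spectral,
  \<open>spec_iff\<close> leaves only a vanishing fractional part.\<close>

lemma gap_iff:
  assumes k: "0 < k"
  shows "(\<exists>E2. spectral_gap spec (k\<^sup>2) E2) \<longleftrightarrow> (frac (p k) = 0 \<or> frac (q k) = 0) \<and> F k < 0"
proof
  assume "\<exists>E2. spectral_gap spec (k\<^sup>2) E2"
  then obtain E2 where E2: "k\<^sup>2 < E2" "complex_of_real (k\<^sup>2) \<in> spec"
    and gap: "\<And>E. k\<^sup>2 < E \<Longrightarrow> E < E2 \<Longrightarrow> complex_of_real E \<notin> spec"
    by (auto simp: spectral_gap_def)
  have "k < sqrt E2" using E2(1) k by (simp add: real_less_rsqrt)
  then have "k < min (sqrt E2) (next_point k)" using next_point_greater[of k] by simp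
  then obtain x where x: "k < x" "x < min (sqrt E2) (next_point k)" using dense by blast
  have "x\<^sup>2 < (sqrt E2)\<^sup>2" using x k by (intro power_strict_mono) auto
  moreover have "0 \<le> E2" using E2(1) zero_le_power2[of k] by linarith
  ultimately have "x\<^sup>2 < E2" by simp
  moreover have "k\<^sup>2 < x\<^sup>2" using x k by (intro power_strict_mono) auto
  ultimately have "complex_of_real (x\<^sup>2) \<notin> spec" by (intro gap)
  then have "F x < 0" using spec_iff[of x] x k by simp
  moreover have "F k < F x" using k x by (intro F_strict_mono) auto
  ultimately have "F k < 0" by simp
  then show "(frac (p k) = 0 \<or> frac (q k) = 0) \<and> F k < 0" using spec_iff[OF k] E2(2) by auto
next
  assume A: "(frac (p k) = 0 \<or> frac (q k) = 0) \<and> F k < 0"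
  have *: "spectral_gap spec (k\<^sup>2) (y\<^sup>2)"
    if y: "k < y" "y \<le> next_point k" "complex_of_real (y\<^sup>2) \<in> spec"
      and neg: "\<And>x. k < x \<Longrightarrow> x < y \<Longrightarrow> F x < 0" for y
    unfolding spectral_gap_def
  proof (intro conjI ballI)
    show "k\<^sup>2 < y\<^sup>2" using y k by (intro power_strict_mono) auto
    show "complex_of_real (k\<^sup>2) \<in> spec" using spec_iff[OF k] A by blast
    fix E assume E: "E \<in> {k\<^sup>2<..<y\<^sup>2}"
    define x where "x = sqrt E"
    have "k\<^sup>2 < E" using E by simp
    then have E0: "0 \<le> E" using zero_le_power2[of k] by linarith
    have x: "k < x" "x < y" using E k y unfolding x_def
      by (auto intro: real_less_rsqrt real_less_lsqrt E0)
    have "frac (p x) \<noteq> 0" "frac (q x) \<noteq> 0" using frac_nonzero_between[of k x] x y by auto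
    then have "complex_of_real (x\<^sup>2) \<notin> spec" using spec_iff[of x] neg[OF x] x k by auto
    then show "complex_of_real E \<notin> spec" using E0 by (simp add: x_def)
  qed (rule y)
  show "\<exists>E2. spectral_gap spec (k\<^sup>2) E2"
  \<comment> \<open>The gap ends at the zero of \<open>F\<close> if there is one before
    \<open>next_point k\<close>, and otherwise at \<open>next_point k\<close>, whose energy is
    always spectral.\<close>
  proof (cases "\<exists>x. k < x \<and> x < next_point k \<and> 0 \<le> F x")
    case True
    then obtain x where x: "k < x" "x < next_point k" "0 \<le> F x" by blast
    obtain y where y: "k \<le> y" "y \<le> x" "F y = 0"
      using IVT'[of F k 0 x] A x F_continuous[OF k x(2)] by auto
    have ky: "k < y" using y A by (cases "y = k") auto
    have "F z < 0" if "k < z" "z < y" for z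
      using F_strict_mono[OF k, of z y] that x y by auto
    then show ?thesis using ky y x spec_iff[of y] k by (intro exI[of _ "y\<^sup>2"] *) auto
  next
    case False
    have "complex_of_real ((next_point k)\<^sup>2) \<in> spec"
      using spec_iff[of "next_point k"] next_point_frac[of k] next_point_greater[of k] k by auto
    then show ?thesis using False next_point_greater[of k]
      by (intro exI[of _ "(next_point k)\<^sup>2"] *) (auto simp: not_le)
  qed
qed

end

theorem theorem5p5:
  fixes c :: "nat \<Rightarrow> nat" and \<gamma> a \<alpha> :: real and d :: nat
  assumes cf: "has_cf_expansion \<gamma> c"
    and c0: "c 0 = 0" and c1: "c 1 = 1"
    and ceven: "\<And>n. n \<ge> 1 \<Longrightarrow> c (2 * n) = 1"
    and codd: "\<And>n. c (2 * n + 1) \<in> {1, 2}"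
    and d: "d \<ge> 2" and a: "a > 0"
    and \<alpha>: "4 * pi * (2 - sqrt 3) / a \<le> \<alpha>" "\<alpha> \<le> 2 * pi\<^sup>2 / (5 * a)"
  shows "\<forall>k::real.
           (\<exists>E2. spectral_gap (spectrum_H d (\<lambda>j. if j = 0 then \<gamma> * a else a) \<alpha>) (k\<^sup>2) E2)
           \<longleftrightarrow> (\<exists>n. c (2 * n + 1) = 2 \<and> k\<^sup>2 = (real_of_int (conv_q c (2 * n)) * pi / a)\<^sup>2)"
proof
  fix k :: real
  interpret cf_one_two c \<gamma>
    using cf c0 c1 ceven codd by unfold_locales auto
  have g: "0 < \<gamma>" using gamma_bounds by simp
  have "sqrt 3 < 2" by (simp add: real_less_lsqrt)
  then have "0 < 4 * pi * (2 - sqrt 3) / a" using a by simp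
  then have \<alpha>0: "0 < \<alpha>" using \<alpha>(1) by linarith
  interpret rectangular_lattice d \<gamma> a \<alpha>
    using d g a \<alpha>0 by unfold_locales
  have conv: "conv_q c n = Q n" for n by (rule conv_q_eq) (rule c_ge_1)
  define A where "A = \<alpha> * a / (2 * pi)"
  have A: "2 * (2 - sqrt 3) \<le> A" "A \<le> pi / 5"
    using \<alpha> a by (simp_all add: A_def field_simps power2_eq_square)
  have q_point: "F k < 0 \<longleftrightarrow> (\<exists>n. c (2 * n + 1) = 2 \<and> m = Q (2 * n))"
    if m: "1 \<le> m" and k: "k = m * pi / a" for m :: int and k
  proof -
    \<comment> \<open>\<open>q k\<close> is an integer, so the term with weight \<open>d - 1\<close>
      drops out of \<open>F\<close>.\<close>
    have pk: "p k = m * \<gamma>" "q k = m" using a by (simp_all add: p_def q_def k)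
    have "\<alpha> / (2 * k) = A / m" using a by (simp add: A_def k)
    then have "F k = tan (pi / 2 * frac (m * \<gamma>)) - A / m"
      unfolding F_def pk by (simp add: tan_frac_def)
    then have "F k < 0 \<longleftrightarrow> m * tan (pi / 2 * frac (m * \<gamma>)) < A"
      using m by (simp add: pos_less_divide_eq mult.commute)
    also have "\<dots> \<longleftrightarrow> (\<exists>n. c (2 * n + 1) = 2 \<and> m = Q (2 * n))" by (rule frac_gap_iff[OF m A])
    finally show ?thesis .
  qed
  have p_point: "\<not> F k < 0" if m: "1 \<le> m" and k: "k = m * pi / (\<gamma> * a)" for m :: int and k
  proof -
    \<comment> \<open>Now the single term of the short direction drops out and the one with weight
      \<open>d - 1\<close> stays.\<close>
    have pk: "p k = m" "q k = m / \<gamma>" using a g by (simp_all add: p_def q_def k)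
    have "\<alpha> / (2 * k) = A * \<gamma> / m" using a g m by (simp add: A_def k field_simps)
    then have Fk: "F k = (real d - 1) * tan (pi / 2 * frac (m / \<gamma>)) - A * \<gamma> / m"
      unfolding F_def pk by (simp add: tan_frac_def)
    have "A * \<gamma> \<le> m * ((real d - 1) * tan (pi / 2 * frac (m / \<gamma>)))"
      using d by (intro frac_no_gap[OF m A(2)]) simp
    moreover have "0 < real_of_int m" using m by simp
    ultimately have "A * \<gamma> / m \<le> (real d - 1) * tan (pi / 2 * frac (m / \<gamma>))"
      by (simp only: pos_divide_le_eq mult.commute)
    then show ?thesis unfolding Fk by linarith
  qed
  have main: "(\<exists>E2. spectral_gap spec (k\<^sup>2) E2) \<longleftrightarrow> (\<exists>n. c (2 * n + 1) = 2 \<and> k = Q (2 * n) * pi / a)"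
    if k: "0 < k" for k
  proof -
    have pos: "1 \<le> m" if "real_of_int m = k * x" "0 < x" for m x
    proof -
      have "0 < real_of_int m" unfolding that(1) using k that(2) by simp
      then show ?thesis by linarith
    qed
    show ?thesis unfolding gap_iff[OF k]
    proof
      assume L: "(frac (p k) = 0 \<or> frac (q k) = 0) \<and> F k < 0"
      then have "p k \<in> \<int> \<or> q k \<in> \<int>" by simp
      then show "\<exists>n. c (2 * n + 1) = 2 \<and> k = Q (2 * n) * pi / a"
      proof
        assume "p k \<in> \<int>"
        then obtain m where m: "p k = of_int m" by (elim Ints_cases)
        then have "1 \<le> m" using g a by (intro pos[of m "\<gamma> * a / pi"]) (auto simp: p_def mult_ac)
        moreover have "k = m * pi / (\<gamma> * a)" using m g a by (simp add: p_def field_simps)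
        ultimately show ?thesis using p_point L by blast
      next
        assume "q k \<in> \<int>"
        then obtain m where m: "q k = of_int m" by (elim Ints_cases)
        then have "1 \<le> m" using a by (intro pos[of m "a / pi"]) (auto simp: q_def mult.commute)
        moreover have km: "k = m * pi / a" using m a by (simp add: q_def field_simps)
        ultimately have "\<exists>n. c (2 * n + 1) = 2 \<and> m = Q (2 * n)" using q_point L by blast
        then show ?thesis using km by blast
      qed
    next
      assume "\<exists>n. c (2 * n + 1) = 2 \<and> k = Q (2 * n) * pi / a"
      then obtain n where n: "c (2 * n + 1) = 2" "k = Q (2 * n) * pi / a" by blast
      have "q k = Q (2 * n)" using n a by (simp add: q_def)
      then have "frac (q k) = 0" by simp
      moreover have "F k < 0" using q_point[of "Q (2 * n)" k] Q_pos[of "2 * n"] n by auto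
      ultimately show "(frac (p k) = 0 \<or> frac (q k) = 0) \<and> F k < 0" by simp
    qed
  qed
  \<comment> \<open>Denominators are positive, so the squares compare as
    \<open>\<bar>k\<bar>\<close> and negative \<open>k\<close> reduce to the positive case.\<close>
  have sq: "k\<^sup>2 = (Q n * pi / a)\<^sup>2 \<longleftrightarrow> \<bar>k\<bar> = Q n * pi / a" for n
  proof -
    have "0 < Q n * pi / a" using Q_pos[of n] a by simp
    then show ?thesis by (auto simp: power2_eq_iff abs_if)
  qed
  show "(\<exists>E2. spectral_gap spec (k\<^sup>2) E2)
      \<longleftrightarrow> (\<exists>n. c (2 * n + 1) = 2 \<and> k\<^sup>2 = (real_of_int (conv_q c (2 * n)) * pi / a)\<^sup>2)"
    unfolding conv sq
  proof (cases "k = 0")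
    case True
    have "\<bar>k\<bar> \<noteq> Q n * pi / a" for n using True Q_pos[of n] a by simp
    moreover have "\<not> spectral_gap spec (k\<^sup>2) E2" for E2
      using zero_not_spec True by (simp add: spectral_gap_def)
    ultimately show "(\<exists>E2. spectral_gap spec (k\<^sup>2) E2) \<longleftrightarrow> (\<exists>n. c (2 * n + 1) = 2 \<and> \<bar>k\<bar> = Q (2 * n) * pi / a)"
      by blast
  next
    case False
    then show "(\<exists>E2. spectral_gap spec (k\<^sup>2) E2) \<longleftrightarrow> (\<exists>n. c (2 * n + 1) = 2 \<and> \<bar>k\<bar> = Q (2 * n) * pi / a)"
      using main[of "\<bar>k\<bar>"] by simp
  qed
qed

end
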